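(* Consider an oriented tree of CSA$^\ast$-groups (an oriented graph of groups whose underlying graph is a tree and all of whose vertex groups are CSA$^\ast$-groups) such that for every edge $e$ the edge group $G(e)$ is maximal abelian in $G(\bar\iota(e))$ and its image $t_e(G(e))$ is maximal abelian in $G(\bar\tau(e))$. Then the fundamental group of the tree of groups is a CSA$^\ast$-group.
   Context: A subgroup $H$ of a group $G$ is malnormal if $H\cap x^{-1}Hx=1$ for all $x\in G\setminus H$. A group is a CSA-group if all its maximal abelian subgroups are malnormal. A CSA$^\ast$-group is a CSA-group without elements of order 2. An oriented graph of groups consists of an oriented graph $\Gamma=(V,E,\bar\iota,\bar\tau)$ (where $\bar\iota(e),\bar\tau(e)\in V$ are the initial and terminal vertices of $e\in E$) together with a function $G$ assigning to each vertex $v\in V$ a group $G(v)$ and to each edge $e\in E$ a subgroup $G(e)$ of $G(\bar\iota(e))$ and a monomorphism $t_e:G(e)\to G(\bar\tau(e))$. When $\Gamma$ is a tree, its fundamental group is the quotient of the free product of the vertex groups by the relations $g=t_e(g)$ for all $e\in E$, $g\in G(e)$. *)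

theory Defs
  imports
    "HOL-Algebra.Coset"
    "HOL-Algebra.Multiplicative_Group"
    "Graph_Theory.Digraph_Component"
begin

section \<open>CSA groups\<close>

definition malnormal :: "'a set \<Rightarrow> ('a, 'm) monoid_scheme \<Rightarrow> bool" where
  "malnormal H G \<longleftrightarrow> subgroup H G \<and>
     (\<forall>x\<in>carrier G - H. H \<inter> ((inv\<^bsub>G\<^esub> x <#\<^bsub>G\<^esub> H) #>\<^bsub>G\<^esub> x) = {\<one>\<^bsub>G\<^esub>})"

definition abelian_subgroup :: "'a set \<Rightarrow> ('a, 'm) monoid_scheme \<Rightarrow> bool" where
  "abelian_subgroup H G \<longleftrightarrow> subgroup H G \<and> comm_group (G\<lparr>carrier := H\<rparr>)"

definition maximal_abelian :: "'a set \<Rightarrow> ('a, 'm) monoid_scheme \<Rightarrow> bool" where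
  "maximal_abelian H G \<longleftrightarrow> abelian_subgroup H G \<and>
     (\<forall>K. abelian_subgroup K G \<and> H \<subseteq> K \<longrightarrow> K = H)"

definition CSA_group :: "('a, 'm) monoid_scheme \<Rightarrow> bool" where
  "CSA_group G \<longleftrightarrow> group G \<and> (\<forall>H. maximal_abelian H G \<longrightarrow> malnormal H G)"

definition CSA_star_group :: "('a, 'm) monoid_scheme \<Rightarrow> bool" where
  "CSA_star_group G \<longleftrightarrow> CSA_group G \<and> (\<forall>x\<in>carrier G. group.ord G x \<noteq> 2)"


section \<open>Oriented trees\<close>

text \<open>
  The graph with the same vertices in which every edge can be traversed in both directions:
  \<open>(e, True)\<close> is \<open>e\<close> itself and \<open>(e, False)\<close> is its reverse.
\<close>

definition double_graph :: "('v, 'e) pre_digraph \<Rightarrow> ('v, 'e \<times> bool) pre_digraph" where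
  "double_graph \<Gamma> =
     \<lparr>verts = verts \<Gamma>,
      arcs = arcs \<Gamma> \<times> UNIV,
      tail = (\<lambda>(e, b). if b then tail \<Gamma> e else head \<Gamma> e),
      head = (\<lambda>(e, b). if b then head \<Gamma> e else tail \<Gamma> e)\<rparr>"

text \<open>
  The predicate \<^const>\<open>tree\<close> only excludes \<^emph>\<open>directed\<close> cycles, so it is not used here.
  A cycle of the underlying undirected graph (loops and pairs of parallel edges included) is a
  cycle of the double graph that does not use the same edge twice; the latter condition rules out
  just the walks that follow an edge and immediately return along it.
  Connectedness includes that the graph has a vertex; the graph may be infinite.
\<close>

definition oriented_tree :: "('v, 'e) pre_digraph \<Rightarrow> bool" where
  "oriented_tree \<Gamma> \<longleftrightarrow> wf_digraph \<Gamma> \<and> connected \<Gamma> \<and>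
     \<not> (\<exists>p. pre_digraph.cycle (double_graph \<Gamma>) p \<and> distinct (map fst p))"


section \<open>Free products\<close>

text \<open>
  The free product of the family \<open>(G i)\<^sub>i\<close> over \<open>i \<in> I\<close>: words in the disjoint union of the
  carriers, modulo deleting identity letters and multiplying adjacent letters from the same factor.
\<close>

definition fp_words :: "'i set \<Rightarrow> ('i \<Rightarrow> ('a, 'm) monoid_scheme) \<Rightarrow> ('i \<times> 'a) list set" where
  "fp_words I G = lists (SIGMA i:I. carrier (G i))"

inductive_set fp_rel ::
    "'i set \<Rightarrow> ('i \<Rightarrow> ('a, 'm) monoid_scheme) \<Rightarrow> (('i \<times> 'a) list \<times> ('i \<times> 'a) list) set"
  for I :: "'i set" and G :: "'i \<Rightarrow> ('a, 'm) monoid_scheme"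
where
  one: "\<lbrakk>u \<in> fp_words I G; w \<in> fp_words I G; i \<in> I\<rbrakk>
    \<Longrightarrow> (u @ [(i, \<one>\<^bsub>G i\<^esub>)] @ w, u @ w) \<in> fp_rel I G"
| mult: "\<lbrakk>u \<in> fp_words I G; w \<in> fp_words I G; i \<in> I; g \<in> carrier (G i); h \<in> carrier (G i)\<rbrakk>
    \<Longrightarrow> (u @ [(i, g), (i, h)] @ w, u @ [(i, g \<otimes>\<^bsub>G i\<^esub> h)] @ w) \<in> fp_rel I G"
| refl: "u \<in> fp_words I G \<Longrightarrow> (u, u) \<in> fp_rel I G"
| sym: "(u, v) \<in> fp_rel I G \<Longrightarrow> (v, u) \<in> fp_rel I G"
| trans: "\<lbrakk>(u, v) \<in> fp_rel I G; (v, w) \<in> fp_rel I G\<rbrakk> \<Longrightarrow> (u, w) \<in> fp_rel I G"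

definition free_product ::
    "'i set \<Rightarrow> ('i \<Rightarrow> ('a, 'm) monoid_scheme) \<Rightarrow> ('i \<times> 'a) list set monoid" where
  "free_product I G =
     \<lparr>carrier = fp_words I G // fp_rel I G,
      monoid.mult = (\<lambda>X Y. \<Union>u\<in>X. \<Union>v\<in>Y. fp_rel I G `` {u @ v}),
      monoid.one = fp_rel I G `` {[]}\<rparr>"

definition fp_incl ::
    "'i set \<Rightarrow> ('i \<Rightarrow> ('a, 'm) monoid_scheme) \<Rightarrow> 'i \<Rightarrow> 'a \<Rightarrow> ('i \<times> 'a) list set" where
  "fp_incl I G i g = fp_rel I G `` {[(i, g)]}"


section \<open>Graphs of groups\<close>

locale graph_of_groups = wf_digraph \<Gamma>
  for \<Gamma> :: "('v, 'e) pre_digraph"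
    and G :: "'v \<Rightarrow> ('a, 'm) monoid_scheme"
    and E :: "'e \<Rightarrow> 'a set"
    and t :: "'e \<Rightarrow> 'a \<Rightarrow> 'a" +
  assumes vertex_group: "v \<in> verts \<Gamma> \<Longrightarrow> group (G v)"
    and edge_group: "e \<in> arcs \<Gamma> \<Longrightarrow> subgroup (E e) (G (tail \<Gamma> e))"
    and edge_mon: "e \<in> arcs \<Gamma> \<Longrightarrow> t e \<in> mon (G (tail \<Gamma> e)\<lparr>carrier := E e\<rparr>) (G (head \<Gamma> e))"

definition normal_closure :: "('a, 'm) monoid_scheme \<Rightarrow> 'a set \<Rightarrow> 'a set" where
  "normal_closure G S = \<Inter>{N. N \<lhd> G \<and> S \<subseteq> N}"

definition edge_relators ::
    "('v, 'e) pre_digraph \<Rightarrow> ('v \<Rightarrow> ('a, 'm) monoid_scheme) \<Rightarrow> ('e \<Rightarrow> 'a set) \<Rightarrow>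
     ('e \<Rightarrow> 'a \<Rightarrow> 'a) \<Rightarrow> ('v \<times> 'a) list set set" where
  "edge_relators \<Gamma> G E t =
     (let P = free_product (verts \<Gamma>) G; \<iota> = fp_incl (verts \<Gamma>) G
      in {\<iota> (tail \<Gamma> e) g \<otimes>\<^bsub>P\<^esub> inv\<^bsub>P\<^esub> (\<iota> (head \<Gamma> e) (t e g)) | e g. e \<in> arcs \<Gamma> \<and> g \<in> E e})"

text \<open>The following is the fundamental group only if \<open>\<Gamma>\<close> is a tree: there are no stable letters.\<close>

definition tree_fundamental_group ::
    "('v, 'e) pre_digraph \<Rightarrow> ('v \<Rightarrow> ('a, 'm) monoid_scheme) \<Rightarrow> ('e \<Rightarrow> 'a set) \<Rightarrow>
     ('e \<Rightarrow> 'a \<Rightarrow> 'a) \<Rightarrow> ('v \<times> 'a) list set set monoid" where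
  "tree_fundamental_group \<Gamma> G E t =
     free_product (verts \<Gamma>) G Mod
       normal_closure (free_product (verts \<Gamma>) G) (edge_relators \<Gamma> G E t)"


section \<open>Basic facts\<close>

lemma fp_words_simps [simp]:
  "[] \<in> fp_words I G"
  "x # u \<in> fp_words I G \<longleftrightarrow> fst x \<in> I \<and> snd x \<in> carrier (G (fst x)) \<and> u \<in> fp_words I G"
  "u @ v \<in> fp_words I G \<longleftrightarrow> u \<in> fp_words I G \<and> v \<in> fp_words I G"
proof -
  show "x # u \<in> fp_words I G \<longleftrightarrow> fst x \<in> I \<and> snd x \<in> carrier (G (fst x)) \<and> u \<in> fp_words I G"
    by (cases x) (simp add: fp_words_def)
qed (auto simp: fp_words_def)

lemma fp_rel_words:
  assumes "\<And>i. i \<in> I \<Longrightarrow> group (G i)" "(u, v) \<in> fp_rel I G"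
  shows "u \<in> fp_words I G \<and> v \<in> fp_words I G"
  using assms(2)
proof induction
  case (one u w i)
  then interpret group "G i" using assms(1) by blast
  show ?case using one by simp
next
  case (mult u w i g h)
  then interpret group "G i" using assms(1) by blast
  show ?case using mult by simp
qed auto

lemma equiv_fp_rel:
  assumes "\<And>i. i \<in> I \<Longrightarrow> group (G i)"
  shows "equiv (fp_words I G) (fp_rel I G)"
proof (rule equivI)
  show "fp_rel I G \<subseteq> fp_words I G \<times> fp_words I G"
    by (rule subrelI) (rule mem_Sigma_iff[THEN iffD2], rule fp_rel_words[of I G, OF assms])
  show "refl_on (fp_words I G) (fp_rel I G)" by (rule refl_onI) (rule fp_rel.refl)
  show "Relation.sym (fp_rel I G)" by (rule symI) (rule fp_rel.sym)
  show "Relation.trans (fp_rel I G)" by (rule transI) (rule fp_rel.trans)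
qed

lemma fp_rel_append_left:
  assumes "(u, v) \<in> fp_rel I G" "x \<in> fp_words I G"
  shows "(x @ u, x @ v) \<in> fp_rel I G"
  using assms
proof induction
  case (one u w i)
  then show ?case using fp_rel.one[of "x @ u" I G w i] by simp
next
  case (mult u w i g h)
  then show ?case using fp_rel.mult[of "x @ u" I G w i g h] by simp
next
  case (refl u)
  then show ?case by (simp add: fp_rel.refl)
next
  case (sym u v)
  then show ?case by (simp add: fp_rel.sym)
next
  case (trans u v w)
  then show ?case using fp_rel.trans by blast
qed

lemma fp_rel_append_right:
  assumes "(u, v) \<in> fp_rel I G" "x \<in> fp_words I G"
  shows "(u @ x, v @ x) \<in> fp_rel I G"
  using assms
proof induction
  case (one u w i)
  then show ?case using fp_rel.one[of u I G "w @ x" i] by simp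
next
  case (mult u w i g h)
  then show ?case using fp_rel.mult[of u I G "w @ x" i g h] by simp
next
  case (refl u)
  then show ?case by (simp add: fp_rel.refl)
next
  case (sym u v)
  then show ?case by (simp add: fp_rel.sym)
next
  case (trans u v w)
  then show ?case using fp_rel.trans by blast
qed

lemma free_product_carrierE:
  assumes "X \<in> carrier (free_product I G)"
  obtains u where "u \<in> fp_words I G" "X = fp_rel I G `` {u}"
  using assms by (auto simp: free_product_def elim: quotientE)

lemma free_product_class_closed:
  "u \<in> fp_words I G \<Longrightarrow> fp_rel I G `` {u} \<in> carrier (free_product I G)"
  by (auto simp: free_product_def intro: quotientI)

lemma free_product_mult:
  assumes G: "\<And>i. i \<in> I \<Longrightarrow> group (G i)"
    and u: "u \<in> fp_words I G" and v: "v \<in> fp_words I G"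
  shows "fp_rel I G `` {u} \<otimes>\<^bsub>free_product I G\<^esub> fp_rel I G `` {v} = fp_rel I G `` {u @ v}"
proof -
  note eq = equiv_fp_rel[of I G, OF G]
  have "fp_rel I G `` {u' @ v'} = fp_rel I G `` {u @ v}"
    if u': "(u, u') \<in> fp_rel I G" and v': "(v, v') \<in> fp_rel I G" for u' v'
  proof -
    have "(u @ v, u' @ v) \<in> fp_rel I G" using u' v by (rule fp_rel_append_right)
    moreover have "(u' @ v, u' @ v') \<in> fp_rel I G"
      using v' fp_rel_words[of I G, OF G u'] by (intro fp_rel_append_left) auto
    ultimately have "(u @ v, u' @ v') \<in> fp_rel I G" by (rule fp_rel.trans)
    from equiv_class_eq[OF eq this] show ?thesis by simp
  qed
  then have "(\<Union>u'\<in>fp_rel I G `` {u}. \<Union>v'\<in>fp_rel I G `` {v}. fp_rel I G `` {u' @ v'})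
      = (\<Union>u'\<in>fp_rel I G `` {u}. \<Union>v'\<in>fp_rel I G `` {v}. fp_rel I G `` {u @ v})"
    by (intro SUP_cong HOL.refl) (simp only: Image_singleton_iff)
  moreover have "u \<in> fp_rel I G `` {u}" "v \<in> fp_rel I G `` {v}"
    using u v by (simp_all add: fp_rel.refl)
  then have "fp_rel I G `` {u} \<noteq> {}" "fp_rel I G `` {v} \<noteq> {}" by blast+
  ultimately have "(\<Union>u'\<in>fp_rel I G `` {u}. \<Union>v'\<in>fp_rel I G `` {v}. fp_rel I G `` {u' @ v'})
      = fp_rel I G `` {u @ v}"
    by (simp only: UN_constant if_False)
  then show ?thesis by (simp add: free_product_def)
qed

lemma free_product_one: "\<one>\<^bsub>free_product I G\<^esub> = fp_rel I G `` {[]}"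
  by (simp add: free_product_def)

lemma fp_inverse_word:
  assumes G: "\<And>i. i \<in> I \<Longrightarrow> group (G i)" and "u \<in> fp_words I G"
  shows "\<exists>v\<in>fp_words I G. (v @ u, []) \<in> fp_rel I G"
  using assms(2)
proof (induction u)
  case Nil
  then show ?case by (auto intro!: bexI[of _ "[]"] fp_rel.refl)
next
  case (Cons x u)
  obtain i g where x: "x = (i, g)" by force
  from Cons x have i: "i \<in> I" and g: "g \<in> carrier (G i)" and u: "u \<in> fp_words I G" by auto
  interpret Gi: group "G i" using i by (rule G)
  from Cons u obtain v where v: "v \<in> fp_words I G" "(v @ u, []) \<in> fp_rel I G" by auto
  have "(v @ [(i, inv\<^bsub>G i\<^esub> g), (i, g)] @ u, v @ [(i, inv\<^bsub>G i\<^esub> g \<otimes>\<^bsub>G i\<^esub> g)] @ u) \<in> fp_rel I G"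
    by (rule fp_rel.mult) (use v u i g in auto)
  moreover have "(v @ [(i, inv\<^bsub>G i\<^esub> g \<otimes>\<^bsub>G i\<^esub> g)] @ u, v @ u) \<in> fp_rel I G"
    using fp_rel.one[of v I G u i] v u i g by simp
  ultimately have "(v @ [(i, inv\<^bsub>G i\<^esub> g), (i, g)] @ u, []) \<in> fp_rel I G"
    using v(2) by (blast intro: fp_rel.trans)
  then show ?case
    using v i g x by (intro bexI[of _ "v @ [(i, inv\<^bsub>G i\<^esub> g)]"]) auto
qed

lemma group_free_product:
  assumes G: "\<And>i. i \<in> I \<Longrightarrow> group (G i)"
  shows "group (free_product I G)"
proof (rule groupI)
  note mult = free_product_mult[of I G, OF G]
  let ?P = "free_product I G"
  show "\<one>\<^bsub>?P\<^esub> \<in> carrier ?P"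
    by (simp add: free_product_one free_product_class_closed)
  fix X Y assume X: "X \<in> carrier ?P" and Y: "Y \<in> carrier ?P"
  obtain u where u: "u \<in> fp_words I G" "X = fp_rel I G `` {u}"
    using X by (rule free_product_carrierE)
  obtain v where v: "v \<in> fp_words I G" "Y = fp_rel I G `` {v}"
    using Y by (rule free_product_carrierE)
  show "X \<otimes>\<^bsub>?P\<^esub> Y \<in> carrier ?P"
    using u v by (simp add: mult free_product_class_closed)
  show "X \<otimes>\<^bsub>?P\<^esub> Y \<otimes>\<^bsub>?P\<^esub> Z = X \<otimes>\<^bsub>?P\<^esub> (Y \<otimes>\<^bsub>?P\<^esub> Z)" if Z: "Z \<in> carrier ?P" for Z
  proof -
    obtain w where "w \<in> fp_words I G" "Z = fp_rel I G `` {w}"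
      using Z by (rule free_product_carrierE)
    then show ?thesis using u v by (simp add: mult)
  qed
next
  note mult = free_product_mult[of I G, OF G]
  let ?P = "free_product I G"
  fix X assume X: "X \<in> carrier ?P"
  obtain u where u: "u \<in> fp_words I G" "X = fp_rel I G `` {u}"
    using X by (rule free_product_carrierE)
  show "\<one>\<^bsub>?P\<^esub> \<otimes>\<^bsub>?P\<^esub> X = X"
    using u by (simp add: free_product_one mult)
  obtain v where v: "v \<in> fp_words I G" "(v @ u, []) \<in> fp_rel I G"
    using fp_inverse_word[of I G, OF G u(1)] by blast
  have "fp_rel I G `` {v} \<otimes>\<^bsub>?P\<^esub> X = \<one>\<^bsub>?P\<^esub>"
    using u v equiv_class_eq[OF equiv_fp_rel[of I G, OF G] v(2)]
    by (simp add: free_product_one mult)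
  then show "\<exists>Y\<in>carrier ?P. Y \<otimes>\<^bsub>?P\<^esub> X = \<one>\<^bsub>?P\<^esub>"
    using free_product_class_closed[OF v(1)] by (rule bexI)
qed

lemma fp_incl_hom:
  assumes G: "\<And>i. i \<in> I \<Longrightarrow> group (G i)" and i: "i \<in> I"
  shows "fp_incl I G i \<in> hom (G i) (free_product I G)"
proof (rule homI)
  fix g h assume g: "g \<in> carrier (G i)" and h: "h \<in> carrier (G i)"
  show "fp_incl I G i g \<in> carrier (free_product I G)"
    unfolding fp_incl_def by (rule free_product_class_closed) (use i g in auto)
  have rel: "([(i, g), (i, h)], [(i, g \<otimes>\<^bsub>G i\<^esub> h)]) \<in> fp_rel I G"
    using fp_rel.mult[of "[]" I G "[]" i g h] i g h by simp
  have "fp_rel I G `` {[(i, g), (i, h)]} = fp_rel I G `` {[(i, g \<otimes>\<^bsub>G i\<^esub> h)]}"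
    using equiv_fp_rel[of I G, OF G] rel by (rule equiv_class_eq)
  moreover have "fp_incl I G i g \<otimes>\<^bsub>free_product I G\<^esub> fp_incl I G i h
      = fp_rel I G `` {[(i, g)] @ [(i, h)]}"
    unfolding fp_incl_def by (rule free_product_mult) (use G i g h in auto)
  ultimately show "fp_incl I G i (g \<otimes>\<^bsub>G i\<^esub> h)
      = fp_incl I G i g \<otimes>\<^bsub>free_product I G\<^esub> fp_incl I G i h"
    by (simp add: fp_incl_def)
qed

text \<open>The universal property of the free product.\<close>

lemma free_product_extend:
  fixes H :: "('b, 'n) monoid_scheme"
  assumes G: "\<And>i. i \<in> I \<Longrightarrow> group (G i)" and H: "group H"
    and f: "\<And>i. i \<in> I \<Longrightarrow> f i \<in> hom (G i) H"
  shows "\<exists>\<phi>\<in>hom (free_product I G) H. \<forall>i\<in>I. \<forall>g\<in>carrier (G i). \<phi> (fp_incl I G i g) = f i g"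
proof -
  interpret H: group H by (rule H)
  define ev where "ev u = foldr (\<lambda>(i, g) x. f i g \<otimes>\<^bsub>H\<^esub> x) u \<one>\<^bsub>H\<^esub>" for u
  have f_closed: "f i g \<in> carrier H" if "i \<in> I" "g \<in> carrier (G i)" for i g
    using f[OF that(1)] that(2) by (rule hom_in_carrier)
  have ev_simps: "ev [] = \<one>\<^bsub>H\<^esub>" "ev ((i, g) # u) = f i g \<otimes>\<^bsub>H\<^esub> ev u" for i g u
    by (simp_all add: ev_def)
  have ev_closed: "ev u \<in> carrier H" if "u \<in> fp_words I G" for u
    using that by (induction u) (auto simp: ev_simps f_closed)
  have ev_append: "ev (u @ v) = ev u \<otimes>\<^bsub>H\<^esub> ev v"
    if "u \<in> fp_words I G" "v \<in> fp_words I G" for u v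
    using that(1) by (induction u) (auto simp: ev_simps f_closed ev_closed that(2) H.m_assoc)
  have ev_rel: "ev u = ev v" if "(u, v) \<in> fp_rel I G" for u v
    using that
  proof induction
    case (one u w i)
    then interpret Gi: group "G i" by (intro G)
    have "f i \<one>\<^bsub>G i\<^esub> = \<one>\<^bsub>H\<^esub>" by (rule hom_one[OF f[OF one(3)] Gi.is_group H])
    moreover have "\<one>\<^bsub>G i\<^esub> \<in> carrier (G i)" by simp
    ultimately show ?case using one by (simp add: ev_append ev_simps ev_closed)
  next
    case (mult u w i g h)
    then interpret Gi: group "G i" by (intro G)
    have "f i (g \<otimes>\<^bsub>G i\<^esub> h) = f i g \<otimes>\<^bsub>H\<^esub> f i h"
      by (rule hom_mult[OF f[OF mult(3)] mult(4,5)])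
    moreover have "g \<otimes>\<^bsub>G i\<^esub> h \<in> carrier (G i)" using mult by simp
    ultimately show ?case
      using mult by (simp add: ev_append ev_simps ev_closed f_closed H.m_assoc)
  qed auto
  define \<phi> where "\<phi> X = the_elem (ev ` X)" for X
  have \<phi>: "\<phi> (fp_rel I G `` {u}) = ev u" if "u \<in> fp_words I G" for u
  proof -
    have "ev ` (fp_rel I G `` {u}) = {ev u}"
    proof (intro equalityI subsetI)
      fix x assume "x \<in> ev ` (fp_rel I G `` {u})"
      then obtain v where "(u, v) \<in> fp_rel I G" "x = ev v" by blast
      then show "x \<in> {ev u}" using ev_rel[of u v] by simp
    next
      fix x assume "x \<in> {ev u}"
      then show "x \<in> ev ` (fp_rel I G `` {u})" using fp_rel.refl[OF that] by blast
    qed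
    then show ?thesis by (simp add: \<phi>_def)
  qed
  have "\<phi> \<in> hom (free_product I G) H"
  proof (rule homI)
    fix X assume "X \<in> carrier (free_product I G)"
    then obtain u where "u \<in> fp_words I G" "X = fp_rel I G `` {u}" by (rule free_product_carrierE)
    then show "\<phi> X \<in> carrier H" by (simp add: \<phi> ev_closed)
  next
    fix X Y assume X: "X \<in> carrier (free_product I G)" and Y: "Y \<in> carrier (free_product I G)"
    obtain u where u: "u \<in> fp_words I G" "X = fp_rel I G `` {u}"
      using X by (rule free_product_carrierE)
    obtain v where v: "v \<in> fp_words I G" "Y = fp_rel I G `` {v}"
      using Y by (rule free_product_carrierE)
    have "X \<otimes>\<^bsub>free_product I G\<^esub> Y = fp_rel I G `` {u @ v}"
      unfolding u(2) v(2) by (rule free_product_mult[OF G u(1) v(1)])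
    then show "\<phi> (X \<otimes>\<^bsub>free_product I G\<^esub> Y) = \<phi> X \<otimes>\<^bsub>H\<^esub> \<phi> Y"
      using u v by (simp add: \<phi> ev_append)
  qed
  moreover have "\<phi> (fp_incl I G i g) = f i g" if "i \<in> I" "g \<in> carrier (G i)" for i g
    using that by (simp add: fp_incl_def \<phi> ev_simps f_closed)
  ultimately show ?thesis by blast
qed

lemma normal_closure_normal:
  assumes "group G" "S \<subseteq> carrier G"
  shows "normal_closure G S \<lhd> G"
proof -
  interpret group G by fact
  have sub: "subgroup N G" if "N \<lhd> G" for N using that by (rule normal_imp_subgroup)
  have top: "carrier G \<lhd> G"
    by (rule normal_invI) (auto intro: subgroup_self)
  have "subgroup (normal_closure G S) G"
    unfolding normal_closure_def
    by (rule subgroups_Inter) (use sub top assms(2) in auto)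
  moreover have "x \<otimes>\<^bsub>G\<^esub> h \<otimes>\<^bsub>G\<^esub> inv\<^bsub>G\<^esub> x \<in> normal_closure G S"
    if "x \<in> carrier G" "h \<in> normal_closure G S" for x h
    using that unfolding normal_closure_def by (auto intro: normal.inv_op_closed2)
  ultimately show ?thesis by (rule normal_invI)
qed

lemma (in graph_of_groups) edge_relators_carrier:
  "edge_relators \<Gamma> G E t \<subseteq> carrier (free_product (verts \<Gamma>) G)"
proof
  let ?P = "free_product (verts \<Gamma>) G"
  interpret P: group ?P by (rule group_free_product) (rule vertex_group)
  have incl: "fp_incl (verts \<Gamma>) G v g \<in> carrier ?P" if "v \<in> verts \<Gamma>" "g \<in> carrier (G v)" for v g
    using fp_incl_hom[of "verts \<Gamma>" G v] that vertex_group by (auto intro: hom_in_carrier)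
  fix X assume "X \<in> edge_relators \<Gamma> G E t"
  then obtain e g where e: "e \<in> arcs \<Gamma>" and g: "g \<in> E e"
    and X: "X = fp_incl (verts \<Gamma>) G (tail \<Gamma> e) g \<otimes>\<^bsub>?P\<^esub>
      inv\<^bsub>?P\<^esub> (fp_incl (verts \<Gamma>) G (head \<Gamma> e) (t e g))"
    by (auto simp: edge_relators_def Let_def)
  have "g \<in> carrier (G (tail \<Gamma> e))" "t e g \<in> carrier (G (head \<Gamma> e))"
    using subgroup.mem_carrier[OF edge_group[OF e] g] edge_mon[OF e] g
    by (auto simp: mon_def hom_def)
  then show "X \<in> carrier ?P" using X e by (auto intro!: incl P.m_closed P.inv_closed)
qed

lemma (in graph_of_groups) group_tree_fundamental_group:
  "group (tree_fundamental_group \<Gamma> G E t)"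
  unfolding tree_fundamental_group_def
  by (intro normal.factorgroup_is_group normal_closure_normal group_free_product
      edge_relators_carrier vertex_group)

end

theory Submission
  imports Defs "HOL-Algebra.Bij"
begin

text \<open>
  The fundamental group acts on its Bass-Serre tree with quotient the tree \<open>\<Gamma>\<close>; vertex stabilizers are
  conjugates of the vertex groups, edge stabilizers are conjugates of the edge groups.  Two features
  make the action rigid.  Since \<open>\<Gamma>\<close> is itself a tree, the projection \<open>pr\<close> to \<open>\<Gamma>\<close> folds every path with
  distinct ends over the same vertex, that is, somewhere it maps two distinct neighbours \<open>y\<close>, \<open>z\<close> of a vertex
  \<open>x\<close> to the same vertex.  And since edge groups are malnormal in the vertex groups, a nontrivial
  element cannot fix \<open>x\<close>, \<open>y\<close> and \<open>z\<close>: some element of the stabilizer of \<open>x\<close> moves \<open>y\<close> to \<open>z\<close>, and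
  malnormality puts it into the stabilizer of \<open>y\<close>.  Hence \<open>pr\<close> is injective on the set of fixed points
  of a nontrivial element (\<open>pr_inj_on_fixed\<close>), and whatever preserves this set fixes all its points.

  The CSA property is equivalent to a condition on elements (\<open>CSA_group_iff_csa_condition\<close>): if
  \<open>a, b \<noteq> 1\<close> and \<open>a\<close> commutes with \<open>b\<close> and with \<open>c = x b x\<inverse>\<close>, then \<open>a\<close> commutes with \<open>x\<close>.
  If \<open>a\<close> fixes a vertex \<open>v\<close>, then \<open>b\<close> and \<open>c\<close> preserve the fixed points of \<open>a\<close>, so they fix \<open>v\<close> as well; then
  \<open>b\<close> fixes \<open>v\<close> and \<open>x\<inverse> v\<close>, these are equal by injectivity, and \<open>a\<close>, \<open>b\<close>, \<open>x\<close> are in the stabilizer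
  of \<open>v\<close> (\<open>csa_elliptic\<close>).  If \<open>a\<close> has no fixed vertex, it translates a line, and so
  do \<open>b\<close> and \<open>c\<close>, along the same line.  Then \<open>x\<close> maps the line to itself.  Either it shifts the line, and
  the commutator of \<open>a\<close> and \<open>x\<close> fixes two vertices with the same projection, hence is trivial; or it
  reverses the line, and \<open>x\<^sup>2 = 1\<close> for the same reason (\<open>csa_hyperbolic\<close>).  The latter is where elements of
  order two matter, and there are none: an element of order two fixes the midpoint of a
  path from \<open>v\<close> to its image, hence is conjugate to an element of a vertex group.

  The Bass-Serre tree comes from the normal form theorem.  An element is written along a path of \<open>\<Gamma>\<close>
  as \<open>k s\<^sub>1 \<dots> s\<^sub>n\<close>, where \<open>k\<close> is in the first vertex group and the \<open>s\<^sub>i\<close> are coset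
  representatives modulo edge groups, nontrivial wherever the path turns back.  Following van der Waerden, normal forms starting at adjacent
  vertices are in bijection (\<open>\<tau>_\<tau>\<close>), transport along \<open>\<Gamma>\<close> turns multiplication on the left by any
  vertex group into permutations of one set of normal forms, and the universal property
  assembles these to an action of the fundamental group (\<open>normal_form_exists\<close>).  A vertex of the
  Bass-Serre tree, a coset of a vertex group, is a normal form without its first entry \<open>k\<close>,
  that is, a list; the parent of a vertex is the tail of the list, so that this
  is a tree at once (\<open>list_tree\<close>).
\<close>

section \<open>The CSA property in terms of elements\<close>

text \<open>For \<open>a = b\<close>, an element that commutes with its conjugate by \<open>x\<close> commutes with \<open>x\<close>, as it must if its
  centralizer is malnormal.  For \<open>x\<close> commuting with \<open>b\<close>, commuting is transitive on nontrivial elements.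
  This avoids the maximal abelian subgroups of the ambient group.\<close>

definition csa_condition :: "('a, 'm) monoid_scheme \<Rightarrow> bool" where
  "csa_condition G \<longleftrightarrow>
     (\<forall>a\<in>carrier G. \<forall>b\<in>carrier G. \<forall>x\<in>carrier G.
        a \<noteq> \<one>\<^bsub>G\<^esub> \<longrightarrow> b \<noteq> \<one>\<^bsub>G\<^esub> \<longrightarrow> a \<otimes>\<^bsub>G\<^esub> b = b \<otimes>\<^bsub>G\<^esub> a \<longrightarrow>
        a \<otimes>\<^bsub>G\<^esub> (x \<otimes>\<^bsub>G\<^esub> b \<otimes>\<^bsub>G\<^esub> inv\<^bsub>G\<^esub> x) = (x \<otimes>\<^bsub>G\<^esub> b \<otimes>\<^bsub>G\<^esub> inv\<^bsub>G\<^esub> x) \<otimes>\<^bsub>G\<^esub> a \<longrightarrow>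
        a \<otimes>\<^bsub>G\<^esub> x = x \<otimes>\<^bsub>G\<^esub> a)"

lemma (in group) csa_conditionD:
  assumes "csa_condition G" "a \<in> carrier G" "b \<in> carrier G" "x \<in> carrier G"
    "a \<noteq> \<one>" "b \<noteq> \<one>" "a \<otimes> b = b \<otimes> a"
    "a \<otimes> (x \<otimes> b \<otimes> inv x) = (x \<otimes> b \<otimes> inv x) \<otimes> a"
  shows "a \<otimes> x = x \<otimes> a"
  using assms unfolding csa_condition_def by blast

lemma (in group) mem_conjugate_iff:
  assumes "H \<subseteq> carrier G" "x \<in> carrier G"
  shows "b \<in> (inv x <# H) #> x \<longleftrightarrow> b \<in> carrier G \<and> x \<otimes> b \<otimes> inv x \<in> H"
proof
  assume "b \<in> (inv x <# H) #> x"
  then obtain h where h: "h \<in> H" "b = inv x \<otimes> h \<otimes> x"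
    by (auto simp: l_coset_def r_coset_def)
  with assms have hc: "h \<in> carrier G" by auto
  have "x \<otimes> b = h \<otimes> x"
    using h(2) hc assms by (metis inv_closed inv_solve_left m_assoc m_closed)
  then have "x \<otimes> b \<otimes> inv x = h" using hc assms h(2) by (metis inv_closed inv_solve_right m_closed)
  with h hc assms show "b \<in> carrier G \<and> x \<otimes> b \<otimes> inv x \<in> H" by simp
next
  assume b: "b \<in> carrier G \<and> x \<otimes> b \<otimes> inv x \<in> H"
  have "inv x \<otimes> (x \<otimes> b) = b" using b assms by (simp add: m_assoc[symmetric])
  then have "inv x \<otimes> (x \<otimes> b \<otimes> inv x) \<otimes> x = b" using b assms by (simp add: m_assoc)
  then show "b \<in> (inv x <# H) #> x"
    using b unfolding l_coset_def r_coset_def by force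
qed

lemma (in group) malnormal_iff:
  "malnormal H G \<longleftrightarrow> subgroup H G \<and>
     (\<forall>x\<in>carrier G. \<forall>b\<in>H. b \<noteq> \<one> \<longrightarrow> x \<otimes> b \<otimes> inv x \<in> H \<longrightarrow> x \<in> H)"
proof (cases "subgroup H G")
  case True
  then have H: "H \<subseteq> carrier G" and one: "\<one> \<in> H"
    by (auto simp: subgroup.subset subgroup.one_closed)
  have "H \<inter> ((inv x <# H) #> x) = {\<one>} \<longleftrightarrow> (\<forall>b\<in>H. b \<noteq> \<one> \<longrightarrow> x \<otimes> b \<otimes> inv x \<notin> H)"
    if "x \<in> carrier G" for x
  proof -
    have "\<one> \<in> H \<inter> ((inv x <# H) #> x)"
      using that one H by (simp add: mem_conjugate_iff)
    then have "H \<inter> ((inv x <# H) #> x) = {\<one>} \<longleftrightarrow> (\<forall>b\<in>H. b \<in> (inv x <# H) #> x \<longrightarrow> b = \<one>)"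
      by auto
    also have "\<dots> \<longleftrightarrow> (\<forall>b\<in>H. b \<noteq> \<one> \<longrightarrow> x \<otimes> b \<otimes> inv x \<notin> H)"
      using mem_conjugate_iff[OF H that] H by auto
    finally show ?thesis .
  qed
  then show ?thesis using True unfolding malnormal_def by blast
qed (simp add: malnormal_def)

lemma (in group) abelian_subgroup_iff:
  "abelian_subgroup H G \<longleftrightarrow> subgroup H G \<and> (\<forall>x\<in>H. \<forall>y\<in>H. x \<otimes> y = y \<otimes> x)"
proof (cases "subgroup H G")
  case True
  then interpret H: group "G\<lparr>carrier := H\<rparr>" by (rule subgroup_imp_group)
  show ?thesis
    unfolding abelian_subgroup_def
    using True H.group_comm_groupI comm_groupE(4)[of "G\<lparr>carrier := H\<rparr>"] by force
qed (simp add: abelian_subgroup_def)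

lemma (in group) commute_mult:
  assumes "x \<in> carrier G" "y \<in> carrier G" "z \<in> carrier G"
    "x \<otimes> z = z \<otimes> x" "y \<otimes> z = z \<otimes> y"
  shows "(x \<otimes> y) \<otimes> z = z \<otimes> (x \<otimes> y)"
  using assms by (metis m_assoc)

lemma (in group) commute_inv:
  assumes "x \<in> carrier G" "z \<in> carrier G" "x \<otimes> z = z \<otimes> x"
  shows "inv x \<otimes> z = z \<otimes> inv x"
  using assms by (metis inv_closed inv_solve_left inv_solve_right m_assoc m_closed)

lemma (in group) conj_eq_iff_commute:
  assumes "x \<in> carrier G" "b \<in> carrier G"
  shows "x \<otimes> b \<otimes> inv x = b \<longleftrightarrow> b \<otimes> x = x \<otimes> b"
  using assms by (metis inv_closed inv_solve_right' m_closed)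

text \<open>Zorn's lemma is applied to sets of pairwise commuting elements instead of subgroups: a maximal such
  set is closed under products and inverses, because these commute with all its elements.\<close>

lemma (in group) maximal_abelian_containing:
  assumes S: "S \<subseteq> carrier G" "\<And>x y. x \<in> S \<Longrightarrow> y \<in> S \<Longrightarrow> x \<otimes> y = y \<otimes> x"
  obtains M where "maximal_abelian M G" "S \<subseteq> M"
proof -
  define \<A> where "\<A> = {X. S \<subseteq> X \<and> X \<subseteq> carrier G \<and> (\<forall>x\<in>X. \<forall>y\<in>X. x \<otimes> y = y \<otimes> x)}"
  have "\<exists>M\<in>\<A>. \<forall>X\<in>\<A>. M \<subseteq> X \<longrightarrow> X = M"
  proof (rule subset_Zorn_nonempty)
    show "\<A> \<noteq> {}" using S unfolding \<A>_def by blast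
    fix C assume C: "C \<noteq> {}" "subset.chain \<A> C"
    have sub: "X \<in> \<A>" if "X \<in> C" for X using C(2) that by (auto simp: subset.chain_def)
    have "x \<otimes> y = y \<otimes> x" if "x \<in> \<Union>C" "y \<in> \<Union>C" for x y
    proof -
      obtain X Y where XY: "x \<in> X" "X \<in> C" "y \<in> Y" "Y \<in> C" using \<open>x \<in> \<Union>C\<close> \<open>y \<in> \<Union>C\<close> by blast
      then have "X \<subseteq> Y \<or> Y \<subseteq> X" using C(2) by (auto simp: subset_chain_def)
      then obtain Z where "Z \<in> C" "x \<in> Z" "y \<in> Z" using XY by blast
      then show ?thesis using sub unfolding \<A>_def by blast
    qed
    moreover have "S \<subseteq> \<Union>C" "\<Union>C \<subseteq> carrier G" using C(1) sub unfolding \<A>_def by blast+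
    ultimately show "\<Union>C \<in> \<A>" unfolding \<A>_def by blast
  qed
  then obtain M where M: "M \<in> \<A>" "\<And>X. X \<in> \<A> \<Longrightarrow> M \<subseteq> X \<Longrightarrow> X = M" by blast
  then have Mc: "M \<subseteq> carrier G" and SM: "S \<subseteq> M"
    and comm: "\<And>x y. x \<in> M \<Longrightarrow> y \<in> M \<Longrightarrow> x \<otimes> y = y \<otimes> x"
    unfolding \<A>_def by auto
  have inM: "z \<in> M" if z: "z \<in> carrier G" "\<And>x. x \<in> M \<Longrightarrow> z \<otimes> x = x \<otimes> z" for z
  proof -
    have "z \<otimes> x = x \<otimes> z" if "x \<in> M" for x using z(2) that .
    then have "insert z M \<in> \<A>" unfolding \<A>_def using Mc SM comm z(1) by (auto simp: eq_commute)
    then show ?thesis using M(2) by blast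
  qed
  have "subgroup M G"
  proof (rule subgroupI)
    show "M \<subseteq> carrier G" by (rule Mc)
    have "\<one> \<in> M" by (rule inM) (use Mc in auto)
    then show "M \<noteq> {}" by blast
    show "inv a \<in> M" if "a \<in> M" for a
    proof (rule inM)
      show "inv a \<otimes> x = x \<otimes> inv a" if "x \<in> M" for x
        using commute_inv[of a x] that \<open>a \<in> M\<close> Mc comm by blast
    qed (use that Mc in auto)
    show "a \<otimes> b \<in> M" if "a \<in> M" "b \<in> M" for a b
    proof (rule inM)
      show "a \<otimes> b \<in> carrier G" using that Mc by auto
      show "a \<otimes> b \<otimes> x = x \<otimes> (a \<otimes> b)" if "x \<in> M" for x
        by (rule commute_mult) (use that \<open>a \<in> M\<close> \<open>b \<in> M\<close> Mc comm in auto)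
    qed
  qed
  then have ab: "abelian_subgroup M G" using comm by (simp add: abelian_subgroup_iff)
  have "K = M" if "abelian_subgroup K G" "M \<subseteq> K" for K
  proof (rule M(2))
    have "K \<subseteq> carrier G" "\<forall>x\<in>K. \<forall>y\<in>K. x \<otimes> y = y \<otimes> x"
      using that(1) by (auto simp: abelian_subgroup_iff dest: subgroup.mem_carrier)
    then show "K \<in> \<A>" unfolding \<A>_def using SM that(2) by blast
  qed (rule that(2))
  then show thesis using that ab SM unfolding maximal_abelian_def by blast
qed

text \<open>If \<open>A\<close> is maximal abelian and contains \<open>a\<close> and \<open>b\<close>, then \<open>c = x b x\<inverse>\<close> is in \<open>A\<close> because conjugation by
  \<open>c\<close> fixes \<open>a\<close>; as \<open>A\<close> meets its conjugate in \<open>c\<close>, it contains \<open>x\<close>.  Conversely, if \<open>b\<close> and \<open>x b x\<inverse>\<close> are in \<open>A\<close>,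
  every element of \<open>A\<close> commutes with both, hence with \<open>x\<close>, and \<open>x\<close> is in \<open>A\<close> by maximality.\<close>

lemma (in group) CSA_group_iff_csa_condition:
  "CSA_group G \<longleftrightarrow> csa_condition G"
proof -
  have "csa_condition G" if csa: "CSA_group G"
    unfolding csa_condition_def
  proof (intro ballI impI)
    fix a b x assume el: "a \<in> carrier G" "b \<in> carrier G" "x \<in> carrier G" "a \<noteq> \<one>" "b \<noteq> \<one>"
      and ab: "a \<otimes> b = b \<otimes> a" and ax: "a \<otimes> (x \<otimes> b \<otimes> inv x) = (x \<otimes> b \<otimes> inv x) \<otimes> a"
    obtain A where A: "maximal_abelian A G" "{a, b} \<subseteq> A"
      using maximal_abelian_containing[of "{a, b}"] el ab by (metis empty_iff empty_subsetI insert_iff insert_subset)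
    have mal: "malnormal A G" using csa A(1) by (simp add: CSA_group_def)
    then have malD: "y \<in> A" if "y \<in> carrier G" "c \<in> A" "c \<noteq> \<one>" "y \<otimes> c \<otimes> inv y \<in> A" for y c
      using that unfolding malnormal_iff by blast
    have comm: "u \<otimes> v = v \<otimes> u" if "u \<in> A" "v \<in> A" for u v
      using A(1) that by (auto simp: maximal_abelian_def abelian_subgroup_iff)
    have "x \<otimes> b \<otimes> inv x \<in> A"
    proof (rule malD[where c = a])
      have "(x \<otimes> b \<otimes> inv x) \<otimes> a \<otimes> inv (x \<otimes> b \<otimes> inv x) = a"
        using ax el by (subst conj_eq_iff_commute) auto
      then show "(x \<otimes> b \<otimes> inv x) \<otimes> a \<otimes> inv (x \<otimes> b \<otimes> inv x) \<in> A" using A(2) by simp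
    qed (use el A(2) in auto)
    then have "x \<in> A" using malD[of x b] el A(2) by blast
    then show "a \<otimes> x = x \<otimes> a" using comm A(2) by blast
  qed
  moreover have "CSA_group G" if cond: "csa_condition G"
    unfolding CSA_group_def
  proof (intro conjI allI impI)
    fix A assume A: "maximal_abelian A G"
    then have sub: "subgroup A G" and comm: "\<And>u v. u \<in> A \<Longrightarrow> v \<in> A \<Longrightarrow> u \<otimes> v = v \<otimes> u"
      by (auto simp: maximal_abelian_def abelian_subgroup_iff)
    then have Ac: "A \<subseteq> carrier G" by (simp add: subgroup.subset)
    show "malnormal A G"
      unfolding malnormal_iff
    proof (intro conjI sub ballI impI)
      fix x b assume x: "x \<in> carrier G" and b: "b \<in> A" "b \<noteq> \<one>" "x \<otimes> b \<otimes> inv x \<in> A"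
      have ax: "a \<otimes> x = x \<otimes> a" if "a \<in> A" for a
      proof (cases "a = \<one>")
        case False
        then show ?thesis
          by (intro csa_conditionD[OF cond, of a b x]) (use x b that Ac comm in auto)
      qed (use x in simp)
      then have "\<And>u v. u \<in> insert x A \<Longrightarrow> v \<in> insert x A \<Longrightarrow> u \<otimes> v = v \<otimes> u"
        using comm by auto
      then obtain M where M: "maximal_abelian M G" "insert x A \<subseteq> M"
        using maximal_abelian_containing[of "insert x A"] x Ac by blast
      then have "M = A" using A by (auto simp: maximal_abelian_def)
      then show "x \<in> A" using M by blast
    qed
  qed (rule is_group)
  ultimately show ?thesis by blast
qed

lemma (in group) ord_eq_2_iff:
  assumes "a \<in> carrier G"
  shows "ord a = 2 \<longleftrightarrow> a \<otimes> a = \<one> \<and> a \<noteq> \<one>"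
proof -
  have sq: "a \<otimes> a = \<one> \<longleftrightarrow> ord a dvd 2"
    using pow_eq_id[OF assms, of 2] assms by (simp add: numeral_2_eq_2)
  have "ord a dvd 2 \<longleftrightarrow> ord a = 1 \<or> ord a = 2"
  proof -
    have "ord a \<le> 2" "ord a \<noteq> 0" if "ord a dvd 2"
      using dvd_imp_le[OF that] that by (cases "ord a = 0"; simp)+
    then show ?thesis by force
  qed
  moreover have "ord a = 1 \<longleftrightarrow> a = \<one>" using ord_eq_1[OF assms] by simp
  ultimately show ?thesis using sq by auto
qed

lemma (in group) CSA_star_group_iff:
  "CSA_star_group G \<longleftrightarrow> csa_condition G \<and> (\<forall>a\<in>carrier G. a \<otimes> a = \<one> \<longrightarrow> a = \<one>)"
  unfolding CSA_star_group_def CSA_group_iff_csa_condition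
  using ord_eq_2_iff by blast

section \<open>Reduced walks and lines in trees\<close>

text \<open>Walks are lists of vertices; in a simple graph, a walk turns back on an edge iff it visits a vertex
  again two steps later.\<close>

definition walk :: "'x set \<Rightarrow> ('x \<Rightarrow> 'x \<Rightarrow> bool) \<Rightarrow> 'x list \<Rightarrow> bool" where
  "walk X adj xs \<longleftrightarrow> xs \<noteq> [] \<and> set xs \<subseteq> X \<and> successively adj xs"

definition nonbacktracking :: "'x list \<Rightarrow> bool" where
  "nonbacktracking xs \<longleftrightarrow> (\<forall>i. i + 2 < length xs \<longrightarrow> xs ! i \<noteq> xs ! (i + 2))"

definition reduced_walk :: "'x set \<Rightarrow> ('x \<Rightarrow> 'x \<Rightarrow> bool) \<Rightarrow> 'x list \<Rightarrow> bool" where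
  "reduced_walk X adj xs \<longleftrightarrow> walk X adj xs \<and> nonbacktracking xs"

lemma nonbacktracking_short: "length xs \<le> 2 \<Longrightarrow> nonbacktracking xs"
  by (simp add: nonbacktracking_def)

lemma nonbacktracking_Cons:
  "nonbacktracking (x # xs) \<longleftrightarrow> nonbacktracking xs \<and> (2 \<le> length xs \<longrightarrow> x \<noteq> xs ! 1)"
proof
  assume nb: "nonbacktracking (x # xs)"
  have "xs ! i \<noteq> xs ! (i + 2)" if "i + 2 < length xs" for i
    using nb[unfolded nonbacktracking_def, rule_format, of "Suc i"] that by simp
  moreover have "2 \<le> length xs \<longrightarrow> x \<noteq> xs ! 1"
    using nb[unfolded nonbacktracking_def, rule_format, of 0] by auto
  ultimately show "nonbacktracking xs \<and> (2 \<le> length xs \<longrightarrow> x \<noteq> xs ! 1)"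
    by (simp add: nonbacktracking_def)
next
  assume nb: "nonbacktracking xs \<and> (2 \<le> length xs \<longrightarrow> x \<noteq> xs ! 1)"
  show "nonbacktracking (x # xs)"
    unfolding nonbacktracking_def
  proof (intro allI impI)
    fix i assume "i + 2 < length (x # xs)"
    then show "(x # xs) ! i \<noteq> (x # xs) ! (i + 2)"
      using nb by (cases i) (auto simp: nonbacktracking_def)
  qed
qed

lemma nonbacktracking_rev [simp]: "nonbacktracking (rev xs) \<longleftrightarrow> nonbacktracking xs"
proof -
  have "nonbacktracking (rev xs)" if nb: "nonbacktracking xs" for xs :: "'a list"
    unfolding nonbacktracking_def
  proof (intro allI impI)
    fix i assume i: "i + 2 < length (rev xs)"
    then have "length xs - Suc i < length xs" by (intro diff_less) auto
    with i show "rev xs ! i \<noteq> rev xs ! (i + 2)"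
      using nb[unfolded nonbacktracking_def, rule_format, of "length xs - Suc (i + 2)"]
      by (auto simp: rev_nth Suc_diff_Suc)
  qed
  from this[of xs] this[of "rev xs"] show ?thesis by auto
qed

lemma nonbacktracking_appendD:
  assumes "nonbacktracking (xs @ ys)"
  shows "nonbacktracking xs" "nonbacktracking ys"
proof -
  have right: "nonbacktracking ys" if "nonbacktracking (xs @ ys)" for xs ys :: "'a list"
    using that by (induction xs) (auto simp: nonbacktracking_Cons)
  show "nonbacktracking ys" using right assms .
  have "nonbacktracking (rev ys @ rev xs)" using assms nonbacktracking_rev[of "xs @ ys"] by simp
  then show "nonbacktracking xs" using right by fastforce
qed

lemma nonbacktracking_join:
  assumes "nonbacktracking (xs @ [x])" "nonbacktracking (x # ys)"
    and "xs \<noteq> [] \<Longrightarrow> ys \<noteq> [] \<Longrightarrow> last xs \<noteq> hd ys"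
  shows "nonbacktracking (xs @ x # ys)"
  using assms
proof (induction xs)
  case (Cons a xs)
  have "nonbacktracking (xs @ x # ys)"
    using Cons by (cases xs) (auto simp: nonbacktracking_Cons)
  moreover have "a \<noteq> (xs @ x # ys) ! 1" if "2 \<le> length (xs @ x # ys)"
  proof (cases xs)
    case Nil
    then show ?thesis using that Cons.prems(3) by (cases ys) auto
  next
    case (Cons b xs')
    then show ?thesis using Cons.prems(1) by (cases xs') (auto simp: nonbacktracking_Cons)
  qed
  ultimately show ?case by (simp add: nonbacktracking_Cons)
qed simp

lemma not_nonbacktrackingE:
  assumes "\<not> nonbacktracking xs"
  obtains as x y bs where "xs = as @ x # y # x # bs"
proof -
  obtain i where i: "i + 2 < length xs" "xs ! i = xs ! (i + 2)"
    using assms by (auto simp: nonbacktracking_def)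
  have "drop i xs = xs ! i # xs ! (i + 1) # xs ! (i + 2) # drop (i + 3) xs"
    using i(1) Cons_nth_drop_Suc[of i xs] Cons_nth_drop_Suc[of "i + 1" xs] Cons_nth_drop_Suc[of "i + 2" xs]
    by (simp add: numeral_2_eq_2 numeral_3_eq_3)
  then have "xs = take i xs @ xs ! i # xs ! (i + 1) # xs ! (i + 2) # drop (i + 3) xs"
    by (metis append_take_drop_id)
  then show thesis using that i(2) by metis
qed

lemma walk_appendI:
  assumes "walk X adj (xs @ [x])" "walk X adj (x # ys)"
  shows "walk X adj (xs @ x # ys)"
  using assms by (auto simp: walk_def successively_append_iff successively_Cons)

text \<open>Cut out \<open>y, x\<close> from a piece \<open>x, y, x\<close> as long as there is one.\<close>

lemma walk_reduce:
  assumes "walk X adj xs"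
  obtains ys where "reduced_walk X adj ys" "hd ys = hd xs" "last ys = last xs"
    "set ys \<subseteq> set xs" "length ys \<le> length xs"
proof -
  have "\<exists>ys. reduced_walk X adj ys \<and> hd ys = hd xs \<and> last ys = last xs \<and>
      set ys \<subseteq> set xs \<and> length ys \<le> length xs"
    using assms
  proof (induction xs rule: length_induct)
    case (1 xs)
    show ?case
    proof (cases "nonbacktracking xs")
      case True
      then have "reduced_walk X adj xs" using 1(2) by (simp add: reduced_walk_def)
      then show ?thesis by blast
    next
      case False
      then obtain as x y bs where xs: "xs = as @ x # y # x # bs" by (rule not_nonbacktrackingE)
      let ?zs = "as @ x # bs"
      have "walk X adj ?zs"
        using 1(2) by (auto simp: xs walk_def successively_append_iff successively_Cons)
      moreover have "length ?zs < length xs" by (simp add: xs)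
      ultimately obtain ys where ys: "reduced_walk X adj ys" "hd ys = hd ?zs" "last ys = last ?zs"
        "set ys \<subseteq> set ?zs" "length ys \<le> length ?zs"
        using 1(1)[rule_format, of ?zs] by blast
      have "hd ys = hd xs" "last ys = last xs"
        using ys(2,3) by (cases as; simp add: xs)+
      moreover have "set ys \<subseteq> set xs" "length ys \<le> length xs"
        using ys(4,5) by (auto simp: xs)
      ultimately show ?thesis using ys(1) by blast
    qed
  qed
  then show thesis using that by blast
qed

lemma reduced_walk_ne: "reduced_walk X adj xs \<Longrightarrow> xs \<noteq> []"
  by (simp add: reduced_walk_def walk_def)

lemma reduced_walk_Nil [simp]: "\<not> reduced_walk X adj []"
  by (simp add: reduced_walk_def walk_def)

lemma reduced_walk_single [simp]: "reduced_walk X adj [x] \<longleftrightarrow> x \<in> X"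
  by (auto simp: reduced_walk_def walk_def nonbacktracking_short)

lemma reduced_walk_appendD:
  assumes "reduced_walk X adj (xs @ ys)"
  shows "xs \<noteq> [] \<Longrightarrow> reduced_walk X adj xs" "ys \<noteq> [] \<Longrightarrow> reduced_walk X adj ys"
  using assms nonbacktracking_appendD
  by (auto simp: reduced_walk_def walk_def successively_append_iff)

lemma reduced_walk_Cons:
  "reduced_walk X adj (x # y # xs) \<longleftrightarrow> reduced_walk X adj (y # xs) \<and> x \<in> X \<and> adj x y \<and>
     (xs \<noteq> [] \<longrightarrow> x \<noteq> hd xs)"
  by (cases xs) (auto simp: reduced_walk_def walk_def nonbacktracking_Cons)

text \<open>Acyclicity excludes loops, too: if \<open>x\<close> were adjacent to itself, \<open>[x, x]\<close> would be a closed reduced walk.\<close>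

locale tree_graph =
  fixes X :: "'x set" and adj :: "'x \<Rightarrow> 'x \<Rightarrow> bool"
  assumes adj_sym: "adj x y \<Longrightarrow> adj y x"
    and adj_in: "adj x y \<Longrightarrow> x \<in> X"
    and connected: "x \<in> X \<Longrightarrow> y \<in> X \<Longrightarrow> \<exists>xs. walk X adj xs \<and> hd xs = x \<and> last xs = y"
    and no_cycle: "reduced_walk X adj xs \<Longrightarrow> hd xs = last xs \<Longrightarrow> length xs = 1"
begin

lemma adj_in2: "adj x y \<Longrightarrow> y \<in> X"
  using adj_sym adj_in by blast

lemma not_adj_self: "\<not> adj x x"
proof
  assume "adj x x"
  then have "reduced_walk X adj [x, x]"
    by (auto simp: reduced_walk_def walk_def nonbacktracking_short adj_in)
  then show False using no_cycle[of "[x, x]"] by simp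
qed

lemma walk_rev: "walk X adj xs \<Longrightarrow> walk X adj (rev xs)"
  unfolding walk_def set_rev successively_rev rev_is_Nil_conv
  by (blast intro: successively_mono[of adj] adj_sym)

lemma reduced_walk_rev: "reduced_walk X adj xs \<Longrightarrow> reduced_walk X adj (rev xs)"
  by (simp add: reduced_walk_def walk_rev)

text \<open>Where two reduced walks with the same ends part, the reverse of the one followed by the other is
  a closed reduced walk.\<close>

lemma reduced_walk_unique:
  assumes "reduced_walk X adj p" "reduced_walk X adj q" "hd p = hd q" "last p = last q"
  shows "p = q"
  using assms
proof (induction p arbitrary: q)
  case Nil
  then have False by (simp only: reduced_walk_Nil)
  then show ?case ..
next
  case (Cons x p)
  then obtain q' where q: "q = x # q'" by (cases q) auto
  show ?case
  proof (cases "p = [] \<or> q' = []")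
    case True
    then have "last (x # p) = x \<or> last q = x" by (auto simp: q)
    then have "hd q = last q" "hd (x # p) = last (x # p)" using Cons.prems(3,4) by auto
    then have "length q = 1" "length (x # p) = 1"
      using no_cycle[OF Cons.prems(2)] no_cycle[OF Cons.prems(1)] by blast+
    then show ?thesis using q by simp
  next
    case False
    then have red: "reduced_walk X adj p" "reduced_walk X adj q'"
      using Cons.prems q reduced_walk_appendD(2)[of X adj "[x]" p]
        reduced_walk_appendD(2)[of X adj "[x]" q'] by simp_all
    show ?thesis
    proof (cases "hd p = hd q'")
      case True
      have "last p = last q'" using Cons.prems(4) q False by simp
      then have "p = q'" by (rule Cons.IH[OF red True])
      then show ?thesis using q by simp
    next
      case ne: False
      have "reduced_walk X adj (rev p @ [x])"
        using reduced_walk_rev[OF Cons.prems(1)] by simp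
      moreover have "last (rev p) \<noteq> hd q'" using ne False by (simp add: last_rev)
      ultimately have "reduced_walk X adj (rev p @ x # q')"
        using Cons.prems(2) walk_appendI[of X adj "rev p" x q'] nonbacktracking_join[of "rev p" x q']
        unfolding q reduced_walk_def by blast
      then have "length (rev p @ x # q') = 1"
        using False Cons.prems(4) q by (intro no_cycle) (auto simp: hd_append hd_rev)
      then show ?thesis using False by simp
    qed
  qed
qed

lemma reduced_walk_exists:
  assumes "x \<in> X" "y \<in> X"
  obtains p where "reduced_walk X adj p" "hd p = x" "last p = y"
proof -
  obtain xs where xs: "walk X adj xs" "hd xs = x" "last xs = y" using connected[OF assms] by blast
  show thesis by (rule walk_reduce[OF xs(1)]) (use xs that in auto)
qed

definition path :: "'x \<Rightarrow> 'x \<Rightarrow> 'x list" where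
  "path x y = (THE p. reduced_walk X adj p \<and> hd p = x \<and> last p = y)"

lemma path_eq: "reduced_walk X adj p \<Longrightarrow> path (hd p) (last p) = p"
  unfolding path_def using reduced_walk_unique by (intro the_equality) auto

lemma path_props:
  assumes "x \<in> X" "y \<in> X"
  shows "reduced_walk X adj (path x y)" "hd (path x y) = x" "last (path x y) = y"
proof -
  obtain p where p: "reduced_walk X adj p" "hd p = x" "last p = y"
    by (rule reduced_walk_exists[OF assms])
  then have "path x y = p" using path_eq[of p] by simp
  then show "reduced_walk X adj (path x y)" "hd (path x y) = x" "last (path x y) = y"
    using p by simp_all
qed

lemma path_self [simp]: "x \<in> X \<Longrightarrow> path x x = [x]"
  using path_eq[of "[x]"] by simp

text \<open>The path to \<open>r\<close> from one of two neighbours leads through the other one.  This is what makes it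
  possible to transport data along a tree in a consistent way.\<close>

lemma path_adj_cases:
  assumes "adj v w" "r \<in> X"
  shows "path w r = w # path v r \<or> path v r = v # path w r"
proof -
  have vw: "v \<in> X" "w \<in> X" using assms adj_in adj_in2 by blast+
  note P = path_props[OF vw(1) assms(2)]
  obtain p where p: "path v r = v # p" using P(2) reduced_walk_ne[OF P(1)] by (cases "path v r") auto
  show ?thesis
  proof (cases "p \<noteq> [] \<and> hd p = w")
    case True
    then have "path w r = p"
      using P p path_eq[of p] reduced_walk_appendD(2)[of X adj "[v]" p] by auto
    then show ?thesis using p by simp
  next
    case False
    then have "reduced_walk X adj (w # path v r)"
      using P(1) vw(2) adj_sym[OF assms(1)] unfolding p by (cases p) (auto simp: reduced_walk_Cons)
    then have "path w r = w # path v r"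
      using path_eq[of "w # path v r"] P(3) p by simp
    then show ?thesis ..
  qed
qed

lemma walk_contains_reduced:
  assumes "walk X adj xs" "reduced_walk X adj p" "hd xs = hd p" "last xs = last p"
  shows "set p \<subseteq> set xs" "length p \<le> length xs"
proof -
  obtain ys where ys: "reduced_walk X adj ys" "hd ys = hd xs" "last ys = last xs"
    "set ys \<subseteq> set xs" "length ys \<le> length xs"
    using walk_reduce[OF assms(1)] .
  then have "ys = p" using reduced_walk_unique[OF ys(1) assms(2)] assms(3,4) by simp
  then show "set p \<subseteq> set xs" "length p \<le> length xs" using ys by auto
qed

text \<open>A line is a two-sided infinite reduced walk; it plays the role of the axis of a translation.\<close>

definition line :: "(int \<Rightarrow> 'x) \<Rightarrow> bool" where
  "line y \<longleftrightarrow> (\<forall>i. adj (y i) (y (i + 1)) \<and> y i \<noteq> y (i + 2))"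

lemma line_in: "line y \<Longrightarrow> y i \<in> X"
  unfolding line_def using adj_in by blast

lemma reduced_walk_line_segment:
  assumes "line y" "i \<le> j"
  shows "reduced_walk X adj (map y [i..j])" "hd (map y [i..j]) = y i" "last (map y [i..j]) = y j"
proof -
  let ?p = "map y [i..j]"
  have len: "length [i..j] = nat (j - i + 1)" by simp
  have nth: "?p ! k = y (i + int k)" if "k < length ?p" for k
    using that assms(2) by simp
  have "successively adj ?p"
    unfolding successively_conv_nth
  proof (intro allI impI)
    fix k assume k: "Suc k < length ?p"
    have "adj (y (i + int k)) (y (i + int k + 1))" using assms(1) by (simp add: line_def)
    then show "adj (?p ! k) (?p ! Suc k)" using nth[of k] nth[of "Suc k"] k by (simp add: algebra_simps)
  qed
  moreover have "nonbacktracking ?p"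
    unfolding nonbacktracking_def
  proof (intro allI impI)
    fix k assume k: "k + 2 < length ?p"
    have "y (i + int k) \<noteq> y (i + int k + 2)" using assms(1) by (simp add: line_def)
    then show "?p ! k \<noteq> ?p ! (k + 2)" using nth[of k] nth[of "k + 2"] k by (simp add: algebra_simps)
  qed
  ultimately show "reduced_walk X adj ?p"
    using assms line_in[OF assms(1)] by (auto simp: reduced_walk_def walk_def)
  have ne: "[i..j] \<noteq> []" using assms(2) by simp
  show "hd ?p = y i" using ne assms(2) by (simp add: hd_map upto_rec1)
  show "last ?p = y j" using ne assms(2) by (simp add: last_map upto_rec2)
qed

lemma line_inj:
  assumes "line y" "y i = y j"
  shows "i = j"
proof -
  have "i = j" if "i \<le> j" "y i = y j" for i j
  proof -
    have "length (map y [i..j]) = 1"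
      by (rule no_cycle) (use reduced_walk_line_segment[OF assms(1) that(1)] that in auto)
    then show ?thesis using that(1) by simp
  qed
  from this[of i j] this[of j i] show ?thesis using assms(2) by (cases "i \<le> j") auto
qed

text \<open>Reducing a walk only removes vertices, and the reduced walk is the segment of the line.\<close>

lemma walk_between_line_points:
  assumes "line y" "walk X adj xs" "hd xs = y i" "last xs = y j"
  shows "i \<le> k \<Longrightarrow> k \<le> j \<Longrightarrow> y k \<in> set xs" "\<bar>i - j\<bar> < int (length xs)"
proof -
  show "y k \<in> set xs" if "i \<le> k" "k \<le> j"
  proof -
    have "i \<le> j" using that by simp
    note seg = reduced_walk_line_segment[OF assms(1) this]
    have "set (map y [i..j]) \<subseteq> set xs"
      using walk_contains_reduced(1)[OF assms(2) seg(1)] seg assms(3,4) by simp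
    then show ?thesis using that by auto
  qed
  have long: "j - i < int (length xs)" if "walk X adj xs" "hd xs = y i" "last xs = y j" "i \<le> j" for i j xs
  proof -
    note seg = reduced_walk_line_segment[OF assms(1) that(4)]
    show ?thesis
      using walk_contains_reduced(2)[OF that(1) seg(1)] seg that by simp
  qed
  have "walk X adj (rev xs)" "hd (rev xs) = y j" "last (rev xs) = y i"
    using walk_rev assms by (auto simp: hd_rev last_rev)
  from long[OF this] long[OF assms(2-4)] show "\<bar>i - j\<bar> < int (length xs)"
    by (cases "i \<le> j") auto
qed


lemma line_adj:
  assumes "line y" "adj (y i) (y j)"
  shows "j = i + 1 \<or> j = i - 1"
proof -
  have w: "walk X adj [y i, y j]"
    using assms(2) adj_in[OF assms(2)] adj_in2[OF assms(2)] by (simp add: walk_def)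
  have "\<bar>i - j\<bar> < int (length [y i, y j])"
    by (rule walk_between_line_points(2)[OF assms(1) w]) simp_all
  then have "\<bar>i - j\<bar> < 2" by simp
  moreover have "i \<noteq> j" using assms(2) not_adj_self by auto
  ultimately show ?thesis by linarith
qed

lemma walk_concat:
  assumes "walk X adj p" "walk X adj q" "last p = hd q"
  obtains r where "walk X adj r" "hd r = hd p" "last r = last q" "set r \<subseteq> set p \<union> set q"
proof -
  obtain p' x where p: "p = p' @ [x]" using assms(1) by (cases p rule: rev_cases) (auto simp: walk_def)
  obtain q' where q: "q = x # q'" using assms(2,3) p by (cases q) (auto simp: walk_def)
  show thesis
  proof (rule that)
    show "walk X adj (p' @ x # q')" using assms(1,2) unfolding p q by (rule walk_appendI)
  qed (auto simp: p q hd_append)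
qed

lemma line_walk:
  assumes "line y"
  obtains w where "walk X adj w" "hd w = y i" "last w = y j" "set w \<subseteq> range y"
proof (cases "i \<le> j")
  case True
  note seg = reduced_walk_line_segment[OF assms True]
  show thesis
    by (rule that[of "map y [i..j]"]) (use seg in \<open>auto simp: reduced_walk_def\<close>)
next
  case False
  then have "j \<le> i" by simp
  note seg = reduced_walk_line_segment[OF assms this]
  show thesis
  proof (rule that)
    show "walk X adj (rev (map y [j..i]))"
      by (rule walk_rev) (use seg(1) in \<open>simp add: reduced_walk_def\<close>)
    show "hd (rev (map y [j..i])) = y i" "last (rev (map y [j..i])) = y j"
      unfolding hd_rev last_rev by (rule seg)+
  qed auto
qed

text \<open>Go from a far point of \<open>y\<close> to \<open>z\<close>, along \<open>z\<close>, and back to a far point of \<open>y\<close> on the other side.  This walk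
  visits every point of \<open>y\<close> in between, but a fixed point of \<open>y\<close> is too far away to be met on
  the two short pieces outside \<open>z\<close>.\<close>

lemma lines_fellow_travel:
  assumes y: "line y" and z: "line z"
    and fellow: "\<And>N. \<exists>i j k l p q. i \<le> - N \<and> N \<le> j \<and> length p \<le> D \<and> length q \<le> D \<and>
      walk X adj p \<and> hd p = y i \<and> last p = z k \<and> walk X adj q \<and> hd q = y j \<and> last q = z l"
  shows "range y \<subseteq> range z"
proof
  fix v assume "v \<in> range y"
  then obtain m where v: "v = y m" by blast
  obtain i j k l p q where ij: "i \<le> - (\<bar>m\<bar> + int D)" "\<bar>m\<bar> + int D \<le> j"
    and len: "length p \<le> D" "length q \<le> D"
    and p: "walk X adj p" "hd p = y i" "last p = z k"
    and q: "walk X adj q" "hd q = y j" "last q = z l"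
    using fellow[of "\<bar>m\<bar> + int D"] by metis
  have far: "y m \<notin> set w" if w: "walk X adj w" "hd w = y n" "length w \<le> D" "int D \<le> \<bar>n - m\<bar>" for w n
  proof
    assume "y m \<in> set w"
    then obtain w1 w2 where w12: "w = w1 @ y m # w2" by (meson split_list)
    have "walk X adj (w1 @ [y m])"
      using w(1) by (auto simp: w12 walk_def successively_append_iff)
    moreover have "hd (w1 @ [y m]) = y n" using w(2) by (cases w1) (auto simp: w12)
    ultimately have "\<bar>n - m\<bar> < int (length (w1 @ [y m]))"
      by (intro walk_between_line_points(2)[OF y]) auto
    then show False using w(3,4) by (simp add: w12)
  qed
  obtain w where w: "walk X adj w" "hd w = z k" "last w = z l" "set w \<subseteq> range z"
    by (rule line_walk[OF z])
  have "last p = hd w" using p(3) w(2) by simp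
  then obtain r1 where r1: "walk X adj r1" "hd r1 = hd p" "last r1 = last w"
    "set r1 \<subseteq> set p \<union> set w"
    by (rule walk_concat[OF p(1) w(1)])
  have "walk X adj (rev q)" "last r1 = hd (rev q)"
    using walk_rev[OF q(1)] q(3) r1(3) w(3) by (simp_all add: hd_rev)
  then obtain r where r: "walk X adj r" "hd r = hd r1" "last r = last (rev q)"
    "set r \<subseteq> set r1 \<union> set (rev q)"
    by (rule walk_concat[OF r1(1)])
  have ends: "hd r = y i" "last r = y j" using r(2,3) r1(2) p(2) q(2) by (simp_all add: last_rev)
  have "y m \<in> set r"
    by (rule walk_between_line_points(1)[OF y r(1) ends]) (use ij in linarith)+
  moreover have "y m \<notin> set p" by (rule far[OF p(1,2) len(1)]) (use ij in linarith)
  moreover have "y m \<notin> set q" by (rule far[OF q(1,2) len(2)]) (use ij in linarith)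
  ultimately show "v \<in> range z" using r(4) r1(4) w(4) v by auto
qed

text \<open>The parameter of \<open>z\<close> in terms of \<open>y\<close> moves by one in each step, and it cannot turn around.\<close>

lemma line_reparametrize:
  assumes y: "line y" and z: "line z" and sub: "range z \<subseteq> range y"
  obtains k where "\<And>i. z i = y (k + i)" | k where "\<And>i. z i = y (k - i)"
proof -
  have "\<forall>i. \<exists>j. z i = y j" using sub by blast
  then obtain \<sigma> where \<sigma>: "\<And>i. z i = y (\<sigma> i)" by metis
  have step: "\<sigma> (i + 1) = \<sigma> i + 1 \<or> \<sigma> (i + 1) = \<sigma> i - 1" for i
  proof (rule line_adj[OF y])
    show "adj (y (\<sigma> i)) (y (\<sigma> (i + 1)))" using z unfolding line_def \<sigma>[symmetric] by blast
  qed
  have turn: "\<sigma> (i + 2) \<noteq> \<sigma> i" for i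
  proof
    assume "\<sigma> (i + 2) = \<sigma> i"
    then have "z (i + 2) = z i" unfolding \<sigma> by simp
    then show False using z unfolding line_def by metis
  qed
  define d where "d i = \<sigma> (i + 1) - \<sigma> i" for i
  have dd: "d (i + 1) = d i" for i
    using step[of i] step[of "i + 1"] turn[of i] by (auto simp: d_def add.assoc)
  have d: "d i = d 0" for i
  proof (induction i rule: int_induct[where k = 0])
    case (step1 i)
    show ?case unfolding dd by (rule step1)
  next
    case (step2 i)
    then show ?case using dd[of "i - 1"] by simp
  qed simp
  have s: "\<sigma> i = \<sigma> 0 + d 0 * i" for i
  proof (induction i rule: int_induct[where k = 0])
    case (step1 i)
    then show ?case using d[of i] by (simp add: d_def algebra_simps)
  next
    case (step2 i)
    then show ?case using d[of "i - 1"] by (simp add: d_def algebra_simps)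
  qed simp
  have "d 0 = 1 \<or> d 0 = -1" using step[of 0] by (auto simp: d_def)
  then show thesis
  proof
    assume "d 0 = 1"
    then have "z i = y (\<sigma> 0 + i)" for i using s[of i] \<sigma>[of i] by simp
    then show thesis by (rule that(1))
  next
    assume "d 0 = -1"
    then have "z i = y (\<sigma> 0 - i)" for i using s[of i] \<sigma>[of i] by simp
    then show thesis by (rule that(2))
  qed
qed

end

section \<open>Groups acting on trees\<close>

text \<open>The map \<open>pr\<close> stands for the projection to the quotient graph, which is assumed to be a tree.
  The last axiom says that the fixed points of a nontrivial element are not folded by \<open>pr\<close>; it holds
  for amalgams along malnormal edge groups.\<close>

locale tree_action = group P + T: tree_graph X adj + B: tree_graph V badj
  for P :: "('g, 'm) monoid_scheme" (structure)
    and X :: "'x set" and adj :: "'x \<Rightarrow> 'x \<Rightarrow> bool"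
    and V :: "'v set" and badj :: "'v \<Rightarrow> 'v \<Rightarrow> bool" +
  fixes act :: "'g \<Rightarrow> 'x \<Rightarrow> 'x" and pr :: "'x \<Rightarrow> 'v"
  assumes nonempty: "X \<noteq> {}"
    and pr_in: "x \<in> X \<Longrightarrow> pr x \<in> V"
    and act_in: "g \<in> carrier P \<Longrightarrow> x \<in> X \<Longrightarrow> act g x \<in> X"
    and act_one: "x \<in> X \<Longrightarrow> act \<one> x = x"
    and act_mult: "g \<in> carrier P \<Longrightarrow> h \<in> carrier P \<Longrightarrow> x \<in> X \<Longrightarrow> act (g \<otimes> h) x = act g (act h x)"
    and act_adj: "g \<in> carrier P \<Longrightarrow> adj x y \<Longrightarrow> adj (act g x) (act g y)"
    and pr_adj: "adj x y \<Longrightarrow> badj (pr x) (pr y)"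
    and pr_act: "g \<in> carrier P \<Longrightarrow> x \<in> X \<Longrightarrow> pr (act g x) = pr x"
    and fixed_neighbours: "\<lbrakk>h \<in> carrier P; h \<noteq> \<one>; adj x y; adj x z; pr y = pr z;
      act h x = x; act h y = y; act h z = z\<rbrakk> \<Longrightarrow> y = z"
begin

lemma act_inv: "g \<in> carrier P \<Longrightarrow> x \<in> X \<Longrightarrow> act (inv g) (act g x) = x"
  by (simp add: act_one flip: act_mult)

lemma act_inv_eq: "g \<in> carrier P \<Longrightarrow> x \<in> X \<Longrightarrow> act g x = y \<Longrightarrow> act (inv g) y = x"
  using act_inv by blast

lemma act_eq_iff: "g \<in> carrier P \<Longrightarrow> x \<in> X \<Longrightarrow> y \<in> X \<Longrightarrow> act g x = act g y \<longleftrightarrow> x = y"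
  using act_inv by metis

lemma walk_act:
  assumes "g \<in> carrier P" "walk X adj q"
  shows "walk X adj (map (act g) q)"
  using assms act_in act_adj
  by (auto simp: walk_def successively_map elim: successively_mono)

lemma reduced_walk_act:
  assumes g: "g \<in> carrier P" and q: "reduced_walk X adj q"
  shows "reduced_walk X adj (map (act g) q)"
proof -
  have qX: "q ! i \<in> X" if "i < length q" for i
    using q that by (auto simp: reduced_walk_def walk_def)
  have "nonbacktracking (map (act g) q)"
    unfolding nonbacktracking_def
  proof (intro allI impI)
    fix i assume "i + 2 < length (map (act g) q)"
    then show "map (act g) q ! i \<noteq> map (act g) q ! (i + 2)"
      using q act_eq_iff[OF g qX[of i] qX[of "i + 2"]]
      by (simp add: reduced_walk_def nonbacktracking_def)
  qed
  then show ?thesis using walk_act[OF g] q by (simp add: reduced_walk_def)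
qed

lemma reduced_walk_between:
  assumes "x \<in> X" "y \<in> X"
  obtains q where "reduced_walk X adj q" "q \<noteq> []" "hd q = x" "last q = y" "set q \<subseteq> X"
proof -
  obtain q where q: "reduced_walk X adj q" "hd q = x" "last q = y"
    by (rule T.reduced_walk_exists[OF assms])
  show thesis by (rule that[OF q(1) _ q(2,3)]) (use q(1) in \<open>auto simp: reduced_walk_def walk_def\<close>)
qed

lemma fixes_reduced_walk:
  assumes h: "h \<in> carrier P" and q: "reduced_walk X adj q"
    and ends: "act h (hd q) = hd q" "act h (last q) = last q"
    and v: "v \<in> set q"
  shows "act h v = v"
proof -
  have ne: "q \<noteq> []" using q by auto
  have "map (act h) q = q"
    by (rule T.reduced_walk_unique[OF reduced_walk_act[OF h q] q])
      (use ne ends in \<open>simp_all add: hd_map last_map\<close>)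
  then show ?thesis using v by (metis in_set_conv_nth nth_map)
qed

text \<open>A path between two fixed points with the same image consists of fixed points.  Its image is closed,
  so if it is longer than one vertex, it turns back at some vertex, which contradicts the axiom
  \<open>fixed_neighbours\<close>.\<close>

lemma pr_inj_on_fixed:
  assumes h: "h \<in> carrier P" "h \<noteq> \<one>" and xy: "x \<in> X" "y \<in> X"
    and fx: "act h x = x" "act h y = y" and pr: "pr x = pr y"
  shows "x = y"
proof -
  obtain q where q: "reduced_walk X adj q" "q \<noteq> []" "hd q = x" "last q = y" "set q \<subseteq> X"
    by (rule reduced_walk_between[OF xy])
  have fixq: "act h v = v" if "v \<in> set q" for v
    by (rule fixes_reduced_walk[OF h(1) q(1)]) (use q fx that in auto)
  have adjq: "adj (q ! i) (q ! (i + 1))" if "i + 1 < length q" for i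
    using q(1) that successively_nth[of adj q i] by (auto simp: reduced_walk_def walk_def)
  have "nonbacktracking (map pr q)"
  proof (rule ccontr)
    assume "\<not> nonbacktracking (map pr q)"
    then obtain i where i: "i + 2 < length q" "pr (q ! i) = pr (q ! (i + 2))"
      by (auto simp: nonbacktracking_def)
    have "q ! i = q ! (i + 2)"
    proof (rule fixed_neighbours[OF h _ _ i(2)])
      show "adj (q ! (i + 1)) (q ! i)" by (rule T.adj_sym) (use adjq[of i] i(1) in simp)
      show "adj (q ! (i + 1)) (q ! (i + 2))" using adjq[of "i + 1"] i(1) by simp
    qed (use i(1) in \<open>auto intro!: fixq\<close>)
    then show False using q(1) i(1) by (simp add: reduced_walk_def nonbacktracking_def)
  qed
  moreover have "walk V badj (map pr q)"
  proof -
    have "successively (\<lambda>x y. badj (pr x) (pr y)) q"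
      using q(1) pr_adj unfolding reduced_walk_def walk_def
      by (blast intro: successively_mono[of adj])
    moreover have "pr ` set q \<subseteq> V" using q(5) pr_in by blast
    ultimately show ?thesis using q(2) by (auto simp: walk_def successively_map)
  qed
  ultimately have "length (map pr q) = 1"
    using q pr by (intro B.no_cycle) (auto simp: reduced_walk_def hd_map last_map)
  then show ?thesis using q(2-4) by (cases q) auto
qed

text \<open>The centralizer permutes the fixed points of \<open>a\<close> and preserves their projections.\<close>

lemma commuting_fixes:
  assumes "a \<in> carrier P" "a \<noteq> \<one>" "b \<in> carrier P" "a \<otimes> b = b \<otimes> a" "x \<in> X" "act a x = x"
  shows "act b x = x"
proof (rule pr_inj_on_fixed[OF assms(1,2)])
  show "act a (act b x) = act b x"
    using assms by (metis act_mult)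
qed (use assms act_in pr_act in auto)

text \<open>An involution reverses the path from \<open>x\<close> to its image, so it fixes the vertex in the middle.  There is
  such a vertex: otherwise the two middle vertices are exchanged, hence have the same
  projection, which is then adjacent to itself.\<close>

lemma involution_fixes:
  assumes g: "g \<in> carrier P" "g \<otimes> g = \<one>"
  obtains x where "x \<in> X" "act g x = x"
proof -
  obtain x where x: "x \<in> X" using nonempty by blast
  have gg: "act g (act g v) = v" if "v \<in> X" for v
    using that g act_one by (simp flip: act_mult)
  obtain q where q: "reduced_walk X adj q" "q \<noteq> []" "hd q = x" "last q = act g x" "set q \<subseteq> X"
    using reduced_walk_between[OF x act_in[OF g(1) x]] .
  have rev: "map (act g) q = rev q"
    by (rule T.reduced_walk_unique[OF reduced_walk_act[OF g(1) q(1)] T.reduced_walk_rev[OF q(1)]])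
      (use q(2-4) gg x in \<open>simp_all add: hd_map last_map hd_rev last_rev\<close>)
  have flip: "act g (q ! i) = q ! (length q - Suc i)" if "i < length q" for i
    using arg_cong[OF rev, of "\<lambda>r. r ! i"] that by (simp add: rev_nth)
  show thesis
  proof (cases "even (length q)")
    case True
    define i where "i = length q div 2 - 1"
    have i: "i + 1 < length q" "length q - Suc i = i + 1"
      using True q(2) unfolding i_def by (auto elim!: evenE simp: neq_Nil_conv)
    have "adj (q ! i) (act g (q ! i))"
      using successively_nth[of adj q i] q(1) i flip[of i] by (auto simp: reduced_walk_def walk_def)
    then have "badj (pr (q ! i)) (pr (act g (q ! i)))" by (rule pr_adj)
    moreover have "q ! i \<in> X" using q(5) i(1) by (auto simp: subset_iff)
    ultimately show thesis using B.not_adj_self pr_act[OF g(1)] by simp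
  next
    case False
    define i where "i = length q div 2"
    have i: "i < length q" "length q - Suc i = i"
      using False unfolding i_def by (auto elim!: oddE)
    show thesis by (rule that[of "q ! i"]) (use i flip[of i] q(5) in auto)
  qed
qed

text \<open>Choose \<open>x\<close> such that its path to \<open>g x\<close> is as short as possible.  The translates of this path form a line:
  if they turned back where two of them meet, the second vertex of the path would be moved less
  than \<open>x\<close>.\<close>

lemma axis_exists:
  assumes g: "g \<in> carrier P" and free: "\<And>x. x \<in> X \<Longrightarrow> act g x \<noteq> x"
  obtains y m where "T.line y" "m \<noteq> 0" "\<And>i. y (i + m) = act g (y i)"
proof -
  define len where "len v = length (T.path v (act g v))" for v
  obtain x where x: "x \<in> X" and least: "\<And>v. v \<in> X \<Longrightarrow> len x \<le> len v"
    using ex_has_least_nat[of "\<lambda>v. v \<in> X" _ len] nonempty by blast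
  define q where "q = T.path x (act g x)"
  note q = T.path_props[OF x act_in[OF g x], folded q_def]
  have qX: "q ! i \<in> X" if "i < length q" for i
    using q(1) that by (auto simp: reduced_walk_def walk_def)
  have qadj: "adj (q ! i) (q ! Suc i)" if "Suc i < length q" for i
    using q(1) that successively_nth[of adj q i] by (auto simp: reduced_walk_def walk_def)
  have ne: "q \<noteq> []" using q(1) by auto
  define l where "l = length q - 1"
  have len: "length q = Suc l" using ne by (simp add: l_def)
  have q0: "q ! 0 = x" and ql: "q ! l = act g x"
    using q(2,3) ne by (simp_all add: hd_conv_nth last_conv_nth l_def)
  have "l \<noteq> 0" using q0 ql free[OF x] by (metis)
  have "l \<noteq> 1"
  proof
    assume "l = 1"
    then have "adj x (act g x)" using qadj[of 0] q0 ql len by simp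
    from pr_adj[OF this] show False using pr_act[OF g x] B.not_adj_self by simp
  qed
  with \<open>l \<noteq> 0\<close> have l2: "l \<ge> 2" by simp
  have turn: "q ! (l - 1) \<noteq> act g (q ! 1)"
  proof
    assume eq: "q ! (l - 1) = act g (q ! 1)"
    define w where "w = drop 1 (take l q)"
    have lw: "length w = l - 1" by (simp add: w_def len)
    have "q = take 1 q @ w @ drop l q"
      using l2 unfolding w_def
      by (metis append_assoc append_take_drop_id drop_take le_add_diff_inverse one_le_numeral
          order_trans take_add)
    then have "reduced_walk X adj (take 1 q @ w @ drop l q)" using q(1) by simp
    then have "reduced_walk X adj (w @ drop l q)"
      by (rule reduced_walk_appendD(2)) (use lw l2 in auto)
    then have "reduced_walk X adj w"
      by (rule reduced_walk_appendD(1)) (use lw l2 in auto)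
    moreover have "hd w = q ! 1"
      using l2 len lw by (subst hd_conv_nth) (auto simp: w_def)
    moreover have "last w = q ! (l - 1)"
    proof -
      obtain n where "l = Suc (Suc n)" using l2 by (metis add_2_eq_Suc le_Suc_ex)
      then show ?thesis using len lw by (subst last_conv_nth) (auto simp: w_def)
    qed
    ultimately have "T.path (q ! 1) (act g (q ! 1)) = w" using eq T.path_eq[of w] by simp
    then have "len (q ! 1) = l - 1" using lw by (simp add: len_def)
    moreover have "len x = Suc l" using len by (simp add: len_def q_def)
    moreover have "q ! 1 \<in> X" using qX len l2 by simp
    ultimately show False using least[of "q ! 1"] by simp
  qed
  define L where "L = int l"
  have L: "L \<ge> 2" using l2 by (simp add: L_def)
  define y where "y i = act (g [^] (i div L)) (q ! nat (i mod L))" for i :: int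
  have pow: "act (g [^] (k + 1)) v = act (g [^] k) (act g v)" "act (g [^] (k + 1)) v = act g (act (g [^] k) v)"
    if "v \<in> X" for k :: int and v
  proof -
    have "g [^] (k + 1) = g [^] k \<otimes> g" using g int_pow_mult[OF g, of k 1] by simp
    then show "act (g [^] (k + 1)) v = act (g [^] k) (act g v)" using that g by (simp add: act_mult)
    have "g [^] (1 + k) = g \<otimes> g [^] k" using g int_pow_mult[OF g, of 1 k] by simp
    then show "act (g [^] (k + 1)) v = act g (act (g [^] k) v)" using that g by (simp add: act_mult add.commute)
  qed
  have yq: "y (k * L + int r) = act (g [^] k) (q ! r)" if "r \<le> l" for k r
  proof (cases "r = l")
    case True
    then have "y (k * L + int r) = act (g [^] (k + 1)) (q ! 0)"
      using L by (simp add: y_def L_def)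
    then show ?thesis using pow(1)[OF x, of k] True q0 ql by simp
  next
    case False
    then show ?thesis using that L by (simp add: y_def L_def)
  qed
  show thesis
  proof (rule that[of y L])
    show "L \<noteq> 0" using L by simp
    show "y (i + L) = act g (y i)" for i
    proof -
      have "i mod L < int (length q)" using L len pos_mod_bound[of L i] unfolding L_def by linarith
      then have "nat (i mod L) < length q" using L by (simp add: nat_less_iff)
      then show ?thesis using L pow(2)[OF qX] by (simp add: y_def)
    qed
    show "T.line y"
      unfolding T.line_def
    proof (intro allI conjI)
      fix i
      define k r where "k = i div L" and "r = nat (i mod L)"
      have i: "i = k * L + int r" and r: "r < l"
        using L pos_mod_bound[of L i] by (simp_all add: k_def r_def L_def nat_less_iff)
      have gk: "g [^] k \<in> carrier P" using g by simp
      have "y (i + 1) = act (g [^] k) (q ! Suc r)"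
        using yq[of "Suc r" k] r by (simp add: i ac_simps)
      then show "adj (y i) (y (i + 1))"
        using yq[of r k] r qadj[of r] act_adj[OF gk] len by (simp add: i)
      show "y i \<noteq> y (i + 2)"
      proof (cases "r + 2 \<le> l")
        case True
        then have "y (i + 2) = act (g [^] k) (q ! (r + 2))"
          using yq[of "r + 2" k] by (simp add: i ac_simps)
        moreover have "q ! r \<noteq> q ! (r + 2)"
          using q(1) True len by (simp add: reduced_walk_def nonbacktracking_def)
        ultimately show ?thesis
          using yq[of r k] r True act_eq_iff[OF gk qX[of r] qX[of "r + 2"]] len by (simp add: i)
      next
        case False
        then have rl: "r = l - 1" using r by simp
        have "i + 2 = (k + 1) * L + int 1" using r l2 by (simp add: i rl L_def algebra_simps of_nat_diff)
        then have "y (i + 2) = act (g [^] (k + 1)) (q ! 1)" using yq[of 1 "k + 1"] l2 by (simp only:)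
        also have "\<dots> = act (g [^] k) (act g (q ! 1))" using pow(1) qX len l2 by simp
        finally have "y (i + 2) = act (g [^] k) (act g (q ! 1))" .
        moreover have "y i = act (g [^] k) (q ! (l - 1))" using yq[of r k] r by (simp add: i rl)
        ultimately show ?thesis
          using turn act_eq_iff[OF gk qX[of "l - 1"] act_in[OF g qX[of 1]]] len l2 by simp
      qed
    qed
  qed
qed


definition translates :: "'g \<Rightarrow> int \<Rightarrow> (int \<Rightarrow> 'x) \<Rightarrow> bool" where
  "translates g m y \<longleftrightarrow> (\<forall>i. act g (y i) = y (i + m))"

lemma line_act: "g \<in> carrier P \<Longrightarrow> T.line y \<Longrightarrow> T.line (\<lambda>i. act g (y i))"
  using act_adj act_eq_iff T.line_in unfolding T.line_def by metis

lemma translates_inv: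
  assumes "g \<in> carrier P" "T.line y" "translates g m y"
  shows "translates (inv g) (- m) y"
  unfolding translates_def
proof
  fix i
  have "act g (y (i - m)) = y i" using assms(3) by (simp add: translates_def)
  from act_inv_eq[OF assms(1) T.line_in[OF assms(2)] this]
  show "act (inv g) (y i) = y (i + - m)" by simp
qed

text \<open>The powers of \<open>g\<close> move a walk from \<open>y\<close> to \<open>z\<close> arbitrarily far along both lines without changing
  its length.\<close>

lemma translated_lines_subset:
  assumes g: "g \<in> carrier P" and y: "T.line y" "translates g m y" "m \<noteq> 0"
    and z: "T.line z" "translates g n z"
  shows "range y \<subseteq> range z"
proof -
  have power: "\<exists>h\<in>carrier P. translates h (k * m) y \<and> translates h (k * n) z" for k :: int
  proof (induction k rule: int_induct[where k = 0])
    case base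
    show ?case
      using act_one T.line_in[OF y(1)] T.line_in[OF z(1)]
      by (intro bexI[of _ \<one>]) (auto simp: translates_def)
  next
    case (step1 k)
    then obtain h where h: "h \<in> carrier P" "translates h (k * m) y" "translates h (k * n) z" by blast
    then show ?case
      using g y z T.line_in[OF y(1)] T.line_in[OF z(1)]
      by (intro bexI[of _ "g \<otimes> h"]) (auto simp: translates_def act_mult algebra_simps)
  next
    case (step2 k)
    then obtain h where h: "h \<in> carrier P" "translates h (k * m) y" "translates h (k * n) z" by blast
    have "translates (inv g) (- m) y" "translates (inv g) (- n) z"
      using translates_inv g y z by blast+
    then show ?case
      using h g T.line_in[OF y(1)] T.line_in[OF z(1)]
      by (intro bexI[of _ "inv g \<otimes> h"]) (auto simp: translates_def act_mult algebra_simps)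
  qed
  obtain w where w: "reduced_walk X adj w" "w \<noteq> []" "hd w = y 0" "last w = z 0" "set w \<subseteq> X"
    by (rule reduced_walk_between[OF T.line_in[OF y(1)] T.line_in[OF z(1)]])
  have moved: "\<exists>p. length p \<le> length w \<and> walk X adj p \<and> hd p = y (k * m) \<and> last p = z (k * n)" for k
  proof -
    obtain h where h: "h \<in> carrier P" "translates h (k * m) y" "translates h (k * n) z"
      using power by blast
    then show ?thesis
      using w walk_act[OF h(1), of w]
      by (intro exI[of _ "map (act h) w"])
        (auto simp: hd_map last_map translates_def reduced_walk_def)
  qed
  show ?thesis
  proof (rule T.lines_fellow_travel[OF y(1) z(1), where D = "length w"])
    fix N :: int
    define k where "k = \<bar>N\<bar> * sgn m"
    have "1 \<le> \<bar>m\<bar>" using y(3) by linarith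
    then have "\<bar>N\<bar> \<le> \<bar>N\<bar> * \<bar>m\<bar>" by (simp add: mult_le_cancel_left1)
    also have "\<dots> = k * m" by (simp add: k_def abs_sgn mult.assoc mult.commute[of m])
    finally have "N \<le> k * m" "(- k) * m \<le> - N" by auto
    then show "\<exists>i j k l p q. i \<le> - N \<and> N \<le> j \<and> length p \<le> length w \<and> length q \<le> length w \<and>
      walk X adj p \<and> hd p = y i \<and> last p = z k \<and> walk X adj q \<and> hd q = y j \<and> last q = z l"
      using moved[of "- k"] moved[of k] by blast
  qed
qed

text \<open>The line contains the points \<open>y 0\<close> and \<open>y m = g (y 0)\<close>, which have the same projection.\<close>

lemma pointwise_fixed_line:
  assumes g: "g \<in> carrier P" "T.line y" "translates g m y" "m \<noteq> 0"
    and h: "h \<in> carrier P" "\<And>i. act h (y i) = y i"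
  shows "h = \<one>"
proof (rule ccontr)
  assume "h \<noteq> \<one>"
  have "y m = act g (y 0)" using g(3) by (simp add: translates_def)
  then have "pr (y 0) = pr (y m)" using pr_act[OF g(1)] T.line_in[OF g(2)] by simp
  then have "y 0 = y m"
    using pr_inj_on_fixed[OF h(1) \<open>h \<noteq> \<one>\<close>] T.line_in[OF g(2)] h(2) by blast
  then show False using T.line_inj[OF g(2)] g(4) by blast
qed

text \<open>The image of \<open>y\<close> under \<open>b\<close> is translated by \<open>a\<close>, so it is \<open>y\<close> up to the parameter.  A reversal of \<open>y\<close> by \<open>b\<close>
  would turn the translation by \<open>m\<close> into one by \<open>-m\<close>.\<close>

lemma commuting_translates:
  assumes a: "a \<in> carrier P" "T.line y" "translates a m y" "m \<noteq> 0"
    and b: "b \<in> carrier P" "a \<otimes> b = b \<otimes> a"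
  obtains k where "translates b k y"
proof -
  let ?z = "\<lambda>i. act b (y i)"
  have yX: "y i \<in> X" for i by (rule T.line_in[OF a(2)])
  have ab: "act a (act b v) = act b (act a v)" if "v \<in> X" for v
    using a b that by (metis act_mult)
  have z: "T.line ?z" by (rule line_act[OF b(1) a(2)])
  have tz: "translates a m ?z"
    using ab yX a(3) by (simp add: translates_def)
  have sub: "range ?z \<subseteq> range y"
    by (rule translated_lines_subset[OF a(1) z tz a(4) a(2,3)])
  show thesis
  proof (rule T.line_reparametrize[OF a(2) z sub])
    fix k assume "\<And>i. ?z i = y (k + i)"
    then show thesis by (intro that[of k]) (simp add: translates_def add.commute)
  next
    fix k assume k: "\<And>i. ?z i = y (k - i)"
    have "act a (?z 0) = ?z m" using tz by (simp add: translates_def)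
    then have "y (k + m) = y (k - m)" using a(3) by (simp add: k translates_def)
    then have "k + m = k - m" by (rule T.line_inj[OF a(2)])
    then show thesis using a(4) by simp
  qed
qed

end

locale csa_tree_action = tree_action P X adj V badj act pr
  for P :: "('g, 'm) monoid_scheme" (structure)
    and X :: "'x set" and adj :: "'x \<Rightarrow> 'x \<Rightarrow> bool"
    and V :: "'v set" and badj :: "'v \<Rightarrow> 'v \<Rightarrow> bool"
    and act :: "'g \<Rightarrow> 'x \<Rightarrow> 'x" and pr :: "'x \<Rightarrow> 'v" +
  assumes stab_csa: "\<lbrakk>v \<in> X; a \<in> carrier P; b \<in> carrier P; x \<in> carrier P;
      act a v = v; act b v = v; act x v = v; a \<noteq> \<one>; b \<noteq> \<one>; a \<otimes> b = b \<otimes> a;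
      a \<otimes> (x \<otimes> b \<otimes> inv x) = (x \<otimes> b \<otimes> inv x) \<otimes> a\<rbrakk> \<Longrightarrow> a \<otimes> x = x \<otimes> a"
    and stab_no_involution: "\<lbrakk>v \<in> X; a \<in> carrier P; act a v = v; a \<otimes> a = \<one>\<rbrakk> \<Longrightarrow> a = \<one>"
begin

lemma no_involution:
  assumes "g \<in> carrier P" "g \<otimes> g = \<one>"
  shows "g = \<one>"
  by (rule involution_fixes[OF assms]) (use assms stab_no_involution in blast)

text \<open>All fixed points of \<open>a\<close> are fixed by \<open>b\<close> and \<open>c = x b x\<inverse>\<close>.  Hence \<open>b\<close> fixes both \<open>v\<close> and \<open>x\<inverse> v\<close>, these points
  are equal, and the claim holds in the stabilizer of \<open>v\<close>.\<close>

lemma csa_elliptic: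
  assumes el: "a \<in> carrier P" "b \<in> carrier P" "x \<in> carrier P" "a \<noteq> \<one>" "b \<noteq> \<one>"
    and ab: "a \<otimes> b = b \<otimes> a"
    and ac: "a \<otimes> (x \<otimes> b \<otimes> inv x) = (x \<otimes> b \<otimes> inv x) \<otimes> a"
    and v: "v \<in> X" "act a v = v"
  shows "a \<otimes> x = x \<otimes> a"
proof -
  let ?c = "x \<otimes> b \<otimes> inv x"
  have bv: "act b v = v" by (rule commuting_fixes[OF el(1,4,2) ab v])
  have cv: "act ?c v = v" by (rule commuting_fixes[OF el(1,4) _ ac v]) (use el in simp)
  have ix: "inv x \<in> carrier P" using el by simp
  let ?w = "act (inv x) v"
  have w: "?w \<in> X" using act_in[OF ix v(1)] .
  have "act b ?w = act (inv x) (act ?c v)"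
    using el v w ix act_in by (simp add: act_mult act_inv)
  then have "act b ?w = ?w" by (simp only: cv)
  then have "v = ?w"
    by (rule pr_inj_on_fixed[OF el(2,5) v(1) w bv]) (rule pr_act[OF ix v(1), symmetric])
  then have "act (inv (inv x)) v = v" using act_inv_eq[OF ix v(1) HOL.refl] by simp
  then have "act x v = v" using el by simp
  then show ?thesis using stab_csa[OF v(1) el(1-3) v(2) bv] el ab ac by blast
qed

text \<open>On the axis \<open>y\<close> of \<open>a\<close>, both \<open>b\<close> and \<open>c = x b x\<inverse>\<close> act as translations, and \<open>c\<close> also translates the image of \<open>y\<close>
  under \<open>x\<close>.  So \<open>x\<close> maps \<open>y\<close> to itself, as a shift or as a reversal.\<close>

lemma csa_hyperbolic:
  assumes el: "a \<in> carrier P" "b \<in> carrier P" "x \<in> carrier P" "a \<noteq> \<one>" "b \<noteq> \<one>"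
    and ab: "a \<otimes> b = b \<otimes> a"
    and ac: "a \<otimes> (x \<otimes> b \<otimes> inv x) = (x \<otimes> b \<otimes> inv x) \<otimes> a"
    and free: "\<And>v. v \<in> X \<Longrightarrow> act a v \<noteq> v"
  shows "a \<otimes> x = x \<otimes> a"
proof -
  let ?c = "x \<otimes> b \<otimes> inv x"
  have c: "?c \<in> carrier P" "?c \<noteq> \<one>"
    using el by (auto simp: inv_solve_right')
  have bfree: "act b v \<noteq> v" if "v \<in> X" for v
    using commuting_fixes[OF el(2,5,1) ab[symmetric] that] free[OF that] by blast
  have cfree: "act ?c v \<noteq> v" if "v \<in> X" for v
    using commuting_fixes[OF c el(1) ac[symmetric] that] free[OF that] by blast
  obtain y m where y: "T.line y" and m: "m \<noteq> 0" and am: "translates a m y"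
    using axis_exists[OF el(1) free] unfolding translates_def by metis
  have yX: "y i \<in> X" for i by (rule T.line_in[OF y])
  obtain k where k: "translates b k y"
    by (rule commuting_translates[OF el(1) y am m el(2) ab])
  obtain l where l: "translates ?c l y"
    by (rule commuting_translates[OF el(1) y am m c(1) ac])
  have k0: "k \<noteq> 0" using k bfree[OF yX[of 0]] by (auto simp: translates_def)
  let ?z = "\<lambda>i. act x (y i)"
  have z: "T.line ?z" by (rule line_act[OF el(3) y])
  have cz: "translates ?c k ?z"
    unfolding translates_def
  proof
    fix i
    have "act ?c (?z i) = act x (act b (act (inv x) (act x (y i))))"
      using el yX act_in by (simp add: act_mult)
    also have "\<dots> = ?z (i + k)" using el yX k by (simp add: act_inv translates_def)
    finally show "act ?c (?z i) = ?z (i + k)" .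
  qed
  have sub: "range ?z \<subseteq> range y"
    by (rule translated_lines_subset[OF c(1) z cz k0 y l])
  show ?thesis
  proof (rule T.line_reparametrize[OF y z sub])
    fix n assume n: "\<And>i. ?z i = y (n + i)"
    let ?h = "inv (x \<otimes> a) \<otimes> (a \<otimes> x)"
    have "act (a \<otimes> x) (y i) = act (x \<otimes> a) (y i)" for i
      using el yX n am by (simp add: act_mult translates_def add.assoc)
    then have "act ?h (y i) = y i" for i
      using el yX[of i] act_inv[of "x \<otimes> a" "y i"] by (simp add: act_mult[of "inv (x \<otimes> a)"])
    then have "?h = \<one>"
      by (intro pointwise_fixed_line[OF el(1) y am m]) (use el in auto)
    then show ?thesis using el by (simp add: inv_solve_left')
  next
    fix n assume n: "\<And>i. ?z i = y (n - i)"
    have "act (x \<otimes> x) (y i) = y i" for i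
      using el yX n by (simp add: act_mult)
    then have "x \<otimes> x = \<one>"
      by (intro pointwise_fixed_line[OF el(1) y am m]) (use el in auto)
    then have "x = \<one>" by (rule no_involution[OF el(3)])
    then show ?thesis using el by simp
  qed
qed

theorem CSA_star_group_tree_action: "CSA_star_group P"
  unfolding CSA_star_group_iff csa_condition_def
proof (intro conjI ballI impI)
  fix a b x
  assume "a \<in> carrier P" "b \<in> carrier P" "x \<in> carrier P" "a \<noteq> \<one>" "b \<noteq> \<one>" "a \<otimes> b = b \<otimes> a"
    "a \<otimes> (x \<otimes> b \<otimes> inv x) = (x \<otimes> b \<otimes> inv x) \<otimes> a"
  then show "a \<otimes> x = x \<otimes> a"
    using csa_elliptic csa_hyperbolic by metis
qed (rule no_involution)

end

section \<open>Normal forms in a tree of groups\<close>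

text \<open>A tree has at most one edge between two vertices, so that an oriented edge is a pair of adjacent
  vertices: \<open>D u v\<close> is the edge group as a subgroup of \<open>G u\<close>, and \<open>\<theta> u v\<close> identifies it with the subgroup
  \<open>D v u\<close> of \<open>G v\<close>.\<close>

locale simple_tree_of_groups = tree_graph V adj
  for V :: "'v set" and adj :: "'v \<Rightarrow> 'v \<Rightarrow> bool" +
  fixes G :: "'v \<Rightarrow> ('a, 'm) monoid_scheme"
    and D :: "'v \<Rightarrow> 'v \<Rightarrow> 'a set"
    and \<theta> :: "'v \<Rightarrow> 'v \<Rightarrow> 'a \<Rightarrow> 'a"
    and root :: 'v
  assumes root: "root \<in> V"
    and vertex_group: "v \<in> V \<Longrightarrow> group (G v)"
    and D_subgroup: "adj u v \<Longrightarrow> subgroup (D u v) (G u)"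
    and \<theta>_in: "adj u v \<Longrightarrow> g \<in> D u v \<Longrightarrow> \<theta> u v g \<in> D v u"
    and \<theta>_mult: "adj u v \<Longrightarrow> g \<in> D u v \<Longrightarrow> h \<in> D u v \<Longrightarrow>
      \<theta> u v (g \<otimes>\<^bsub>G u\<^esub> h) = \<theta> u v g \<otimes>\<^bsub>G v\<^esub> \<theta> u v h"
    and \<theta>_\<theta>: "adj u v \<Longrightarrow> g \<in> D u v \<Longrightarrow> \<theta> v u (\<theta> u v g) = g"
begin

lemma D_in: "adj u v \<Longrightarrow> g \<in> D u v \<Longrightarrow> g \<in> carrier (G u)"
  by (rule subgroup.mem_carrier[OF D_subgroup])

lemma \<theta>_carrier: "adj u v \<Longrightarrow> g \<in> D u v \<Longrightarrow> \<theta> u v g \<in> carrier (G v)"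
  using \<theta>_in D_in adj_sym by blast

text \<open>A transversal of the right cosets of \<open>D u v\<close> in \<open>G u\<close> in which the trivial coset is represented by \<open>1\<close>.\<close>

definition rep :: "'v \<Rightarrow> 'v \<Rightarrow> 'a \<Rightarrow> 'a" where
  "rep u v g = (if g \<in> D u v then \<one>\<^bsub>G u\<^esub> else (SOME s. s \<in> D u v #>\<^bsub>G u\<^esub> g))"

lemma rep_rcos:
  assumes "adj u v" "g \<in> carrier (G u)"
  shows "rep u v g \<in> D u v #>\<^bsub>G u\<^esub> g"
proof -
  interpret group "G u" using vertex_group adj_in assms(1) by blast
  note D = D_subgroup[OF assms(1)]
  show ?thesis
  proof (cases "g \<in> D u v")
    case True
    then have "D u v #>\<^bsub>G u\<^esub> g = D u v" by (rule coset_join2[OF assms(2) D])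
    then show ?thesis using True subgroup.one_closed[OF D] by (simp add: rep_def)
  next
    case False
    then show ?thesis using rcos_self[OF assms(2) D] someI_ex[of "\<lambda>s. s \<in> D u v #>\<^bsub>G u\<^esub> g"]
      by (auto simp: rep_def)
  qed
qed

lemma rep_in:
  assumes "adj u v" "g \<in> carrier (G u)"
  shows "rep u v g \<in> carrier (G u)"
proof -
  interpret group "G u" using vertex_group adj_in assms(1) by blast
  show ?thesis
    using rep_rcos[OF assms] r_coset_subset_G[OF subgroup.subset[OF D_subgroup[OF assms(1)]] assms(2)]
    by blast
qed

lemma rcos_eq_iff:
  assumes "adj u v" "g \<in> carrier (G u)" "h \<in> carrier (G u)"
  shows "D u v #>\<^bsub>G u\<^esub> g = D u v #>\<^bsub>G u\<^esub> h \<longleftrightarrow> g \<otimes>\<^bsub>G u\<^esub> inv\<^bsub>G u\<^esub> h \<in> D u v"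
proof -
  interpret group "G u" using vertex_group adj_in assms(1) by blast
  note D = D_subgroup[OF assms(1)]
  show ?thesis
    using subgroup.rcos_module[OF D is_group assms(3,2)] repr_independence[OF _ assms(3) D]
      rcos_self[OF assms(2) D] by metis
qed

lemma rep_eq_iff:
  assumes "adj u v" "g \<in> carrier (G u)" "h \<in> carrier (G u)"
  shows "rep u v g = rep u v h \<longleftrightarrow> g \<otimes>\<^bsub>G u\<^esub> inv\<^bsub>G u\<^esub> h \<in> D u v"
proof -
  interpret group "G u" using vertex_group adj_in assms(1) by blast
  note D = D_subgroup[OF assms(1)]
  have self: "D u v #>\<^bsub>G u\<^esub> k = D u v #>\<^bsub>G u\<^esub> rep u v k" if "k \<in> carrier (G u)" for k
    using repr_independence[OF rep_rcos[OF assms(1) that] that D] .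
  have "rep u v g = rep u v h" if eq: "D u v #>\<^bsub>G u\<^esub> g = D u v #>\<^bsub>G u\<^esub> h"
  proof -
    have "g \<in> D u v \<longleftrightarrow> h \<in> D u v"
      using eq rcos_self[OF assms(2) D] rcos_self[OF assms(3) D] coset_join2[OF _ D] assms(2,3)
      by metis
    then show ?thesis using eq by (simp add: rep_def)
  qed
  then show ?thesis using self assms(2,3) rcos_eq_iff[OF assms] by metis
qed

lemma rep_D:
  assumes "adj u v" "g \<in> carrier (G u)"
  shows "g \<otimes>\<^bsub>G u\<^esub> inv\<^bsub>G u\<^esub> rep u v g \<in> D u v"
proof -
  interpret group "G u" using vertex_group adj_in assms(1) by blast
  note D = D_subgroup[OF assms(1)]
  have "D u v #>\<^bsub>G u\<^esub> g = D u v #>\<^bsub>G u\<^esub> rep u v g"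
    using repr_independence[OF rep_rcos[OF assms] assms(2) D] .
  then show ?thesis using rcos_eq_iff[OF assms rep_in[OF assms]] by simp
qed

lemma rep_rep: "adj u v \<Longrightarrow> g \<in> carrier (G u) \<Longrightarrow> rep u v (rep u v g) = rep u v g"
  using rep_eq_iff[of u v g "rep u v g"] rep_D rep_in by simp

lemma rep_eq_one_iff:
  assumes "adj u v" "g \<in> carrier (G u)"
  shows "rep u v g = \<one>\<^bsub>G u\<^esub> \<longleftrightarrow> g \<in> D u v"
proof -
  interpret group "G u" using vertex_group adj_in assms(1) by blast
  show ?thesis
    using rep_D[OF assms] assms(2) by (auto simp: rep_def)
qed

lemma rep_mult_D:
  assumes "adj u v" "g \<in> carrier (G u)" "d \<in> D u v"
  shows "rep u v (d \<otimes>\<^bsub>G u\<^esub> g) = rep u v g"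
proof -
  interpret group "G u" using vertex_group adj_in assms(1) by blast
  have "d \<in> carrier (G u)" using D_in assms by blast
  then show ?thesis using assms by (subst rep_eq_iff) (auto simp: m_assoc)
qed

text \<open>The list \<open>[(u\<^sub>1, s\<^sub>1), \<dots>, (u\<^sub>n, s\<^sub>n)]\<close> describes the path \<open>u\<^sub>1, \<dots>, u\<^sub>n, root\<close> and carries the entry \<open>s\<^sub>i\<close>
  of the group at the vertex that follows \<open>u\<^sub>i\<close>.  The empty list is the path that stays at the root.\<close>

definition start :: "('v \<times> 'a) list \<Rightarrow> 'v" where
  "start l = (case l of [] \<Rightarrow> root | (u, s) # _ \<Rightarrow> u)"

lemma start_simps [simp]: "start [] = root" "start ((u, s) # l) = u"
  by (simp_all add: start_def)

text \<open>Every entry represents a coset of the edge group through which the path has come.  The path may turn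
  back only after a nontrivial entry.  In the last clause, \<open>start (tl l)\<close> is the vertex two steps after
  \<open>u\<close>; for \<open>l = []\<close> it is the root, which is adjacent to \<open>u\<close> and thus different from it.\<close>

fun valid :: "('v \<times> 'a) list \<Rightarrow> bool" where
  "valid [] \<longleftrightarrow> True"
| "valid ((u, s) # l) \<longleftrightarrow> valid l \<and> adj u (start l) \<and> s \<in> carrier (G (start l)) \<and>
     rep (start l) u s = s \<and> (s = \<one>\<^bsub>G (start l)\<^esub> \<longrightarrow> start (tl l) \<noteq> u)"

text \<open>Normal forms that start at \<open>v\<close> have a further entry of \<open>G v\<close>, which is not restricted, so that \<open>G v\<close>
  acts on them by multiplication.\<close>

definition NF :: "'v \<Rightarrow> ('a \<times> ('v \<times> 'a) list) set" where
  "NF v = {(k, l). k \<in> carrier (G v) \<and> valid l \<and> start l = v}"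

definition lmul :: "'v \<Rightarrow> 'a \<Rightarrow> 'a \<times> ('v \<times> 'a) list \<Rightarrow> 'a \<times> ('v \<times> 'a) list" where
  "lmul v h \<omega> = (h \<otimes>\<^bsub>G v\<^esub> fst \<omega>, snd \<omega>)"

text \<open>The normal form at a neighbour \<open>u\<close> of \<open>v\<close>: split \<open>k = d s\<close> with \<open>d \<in> D v u\<close> and \<open>s\<close> a representative, and move
  \<open>d\<close> across the edge.  What remains is an extended list, unless \<open>s = 1\<close> and the path goes to \<open>u\<close> anyway; in
  this case the two steps cancel.\<close>

definition \<tau> :: "'v \<Rightarrow> 'v \<Rightarrow> 'a \<times> ('v \<times> 'a) list \<Rightarrow> 'a \<times> ('v \<times> 'a) list" where
  "\<tau> u v \<omega> = (let k = fst \<omega>; l = snd \<omega>; s = rep v u k; c = \<theta> v u (k \<otimes>\<^bsub>G v\<^esub> inv\<^bsub>G v\<^esub> s)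
     in if s = \<one>\<^bsub>G v\<^esub> \<and> start (tl l) = u then (c \<otimes>\<^bsub>G u\<^esub> snd (hd l), tl l) else (c, (u, s) # l))"

lemma start_in: "valid l \<Longrightarrow> start l \<in> V"
  using root adj_in by (induction l rule: valid.induct) auto

lemma \<tau>_cases:
  assumes uv: "adj u v" and \<omega>: "\<omega> \<in> NF v"
  obtains (cancel) c s l where "\<omega> = (c, (v, s) # l)" "c \<in> D v u" "start l = u" "valid ((v, s) # l)"
      "\<tau> u v \<omega> = (\<theta> v u c \<otimes>\<^bsub>G u\<^esub> s, l)"
    | (extend) c s l where "\<omega> = (c \<otimes>\<^bsub>G v\<^esub> s, l)" "c \<in> D v u" "s \<in> carrier (G v)" "rep v u s = s"
      "start l = v" "valid ((u, s) # l)" "\<tau> u v \<omega> = (\<theta> v u c, (u, s) # l)"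
proof -
  obtain k l where kl: "\<omega> = (k, l)" "k \<in> carrier (G v)" "valid l" "start l = v"
    using \<omega> by (auto simp: NF_def)
  have vu: "adj v u" using uv by (rule adj_sym)
  interpret group "G v" using vertex_group adj_in vu by blast
  define s where "s = rep v u k"
  have s: "s \<in> carrier (G v)" "rep v u s = s" and D: "k \<otimes>\<^bsub>G v\<^esub> inv\<^bsub>G v\<^esub> s \<in> D v u"
    using rep_in[OF vu kl(2)] rep_rep[OF vu kl(2)] rep_D[OF vu kl(2)] by (simp_all add: s_def)
  show thesis
  proof (cases "s = \<one>\<^bsub>G v\<^esub> \<and> start (tl l) = u")
    case True
    have "l \<noteq> []" using True kl(4) uv not_adj_self by auto
    then obtain s' l' where l: "l = (v, s') # l'" using kl(4) by (cases l) auto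
    have "k \<in> D v u" using rep_eq_one_iff[OF vu kl(2)] True by (simp add: s_def)
    then show thesis
      using cancel[of k s' l'] True kl l s_def by (simp add: \<tau>_def Let_def)
  next
    case False
    have "k = (k \<otimes>\<^bsub>G v\<^esub> inv\<^bsub>G v\<^esub> s) \<otimes>\<^bsub>G v\<^esub> s" using kl(2) s(1) by (simp add: m_assoc)
    moreover have "valid ((u, s) # l)" using kl(3,4) uv s False by auto
    moreover have "\<tau> u v \<omega> = (\<theta> v u (k \<otimes>\<^bsub>G v\<^esub> inv\<^bsub>G v\<^esub> s), (u, s) # l)"
      using False by (auto simp: \<tau>_def Let_def kl(1) s_def)
    ultimately show thesis
      using extend[of "k \<otimes>\<^bsub>G v\<^esub> inv\<^bsub>G v\<^esub> s" s l] kl(1,4) s D by simp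
  qed
qed

lemma \<tau>_extend:
  assumes vu: "adj v u" and c: "c \<in> D v u" and v: "valid ((u, s) # l)" "start l = v"
  shows "\<tau> u v (c \<otimes>\<^bsub>G v\<^esub> s, l) = (\<theta> v u c, (u, s) # l)"
proof -
  interpret group "G v" using vertex_group adj_in vu by blast
  have s: "s \<in> carrier (G v)" "rep v u s = s" using v by auto
  have "rep v u (c \<otimes>\<^bsub>G v\<^esub> s) = s" using rep_mult_D[OF vu s(1) c] s(2) by simp
  moreover have "c \<otimes>\<^bsub>G v\<^esub> s \<otimes>\<^bsub>G v\<^esub> inv\<^bsub>G v\<^esub> s = c" using s(1) D_in[OF vu c] by (simp add: m_assoc)
  moreover have "\<not> (s = \<one>\<^bsub>G v\<^esub> \<and> start (tl l) = u)" using v by auto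
  ultimately show ?thesis by (auto simp: \<tau>_def Let_def)
qed

lemma \<tau>_cancel:
  assumes vu: "adj v u" and c: "c \<in> D v u" and u: "start l = u"
  shows "\<tau> u v (c, (v, s) # l) = (\<theta> v u c \<otimes>\<^bsub>G u\<^esub> s, l)"
proof -
  interpret group "G v" using vertex_group adj_in vu by blast
  have "rep v u c = \<one>\<^bsub>G v\<^esub>" using rep_eq_one_iff[OF vu D_in[OF vu c]] c by simp
  then show ?thesis using u D_in[OF vu c] by (simp add: \<tau>_def Let_def)
qed

lemma \<tau>_in:
  assumes uv: "adj u v" and \<omega>: "\<omega> \<in> NF v"
  shows "\<tau> u v \<omega> \<in> NF u"
  using uv \<omega>
proof (cases rule: \<tau>_cases)
  case (cancel c s l)
  interpret group "G u" using vertex_group adj_in uv by blast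
  show ?thesis
    using cancel \<theta>_carrier[OF adj_sym[OF uv] cancel(2)] by (auto simp: NF_def)
next
  case (extend c s l)
  then show ?thesis
    using \<theta>_carrier[OF adj_sym[OF uv] extend(2)] by (auto simp: NF_def)
qed

text \<open>Moving forth and back: a cancellation is undone by an extension and vice versa.\<close>

lemma \<tau>_\<tau>:
  assumes uv: "adj u v" and \<omega>: "\<omega> \<in> NF v"
  shows "\<tau> v u (\<tau> u v \<omega>) = \<omega>"
  using uv \<omega>
proof (cases rule: \<tau>_cases)
  note vu = adj_sym[OF uv]
  case (cancel c s l)
  have "\<tau> v u (\<theta> v u c \<otimes>\<^bsub>G u\<^esub> s, l) = (\<theta> u v (\<theta> v u c), (v, s) # l)"
    by (rule \<tau>_extend[OF uv \<theta>_in[OF vu cancel(2)] cancel(4,3)])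
  then show ?thesis using cancel \<theta>_\<theta>[OF vu] by simp
next
  note vu = adj_sym[OF uv]
  case (extend c s l)
  have "\<tau> v u (\<theta> v u c, (u, s) # l) = (\<theta> u v (\<theta> v u c) \<otimes>\<^bsub>G v\<^esub> s, l)"
    by (rule \<tau>_cancel[OF uv \<theta>_in[OF vu extend(2)] extend(5)])
  then show ?thesis using extend \<theta>_\<theta>[OF vu] by simp
qed

lemma lmul_in: "v \<in> V \<Longrightarrow> h \<in> carrier (G v) \<Longrightarrow> \<omega> \<in> NF v \<Longrightarrow> lmul v h \<omega> \<in> NF v"
  using monoid.m_closed[OF group.is_monoid[OF vertex_group]] by (auto simp: NF_def lmul_def)

lemma lmul_mult:
  assumes "v \<in> V" "g \<in> carrier (G v)" "h \<in> carrier (G v)" "\<omega> \<in> NF v"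
  shows "lmul v (g \<otimes>\<^bsub>G v\<^esub> h) \<omega> = lmul v g (lmul v h \<omega>)"
  using assms monoid.m_assoc[OF group.is_monoid[OF vertex_group]] by (auto simp: NF_def lmul_def)

lemma lmul_one: "v \<in> V \<Longrightarrow> \<omega> \<in> NF v \<Longrightarrow> lmul v \<one>\<^bsub>G v\<^esub> \<omega> = \<omega>"
  using monoid.l_one[OF group.is_monoid[OF vertex_group]] by (auto simp: NF_def lmul_def)

lemma \<tau>_lmul:
  assumes uv: "adj u v" and h: "h \<in> D v u" and \<omega>: "\<omega> \<in> NF v"
  shows "\<tau> u v (lmul v h \<omega>) = lmul u (\<theta> v u h) (\<tau> u v \<omega>)"
  using uv \<omega>
proof (cases rule: \<tau>_cases)
  note vu = adj_sym[OF uv]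
  interpret v: group "G v" using vertex_group adj_in vu by blast
  interpret u: group "G u" using vertex_group adj_in uv by blast
  case (cancel c s l)
  have hc: "h \<otimes>\<^bsub>G v\<^esub> c \<in> D v u" using subgroup.m_closed[OF D_subgroup[OF vu] h cancel(2)] .
  show ?thesis
    using cancel \<tau>_cancel[OF vu hc cancel(3), of s] \<theta>_mult[OF vu h cancel(2)] u.m_assoc
      \<theta>_carrier[OF vu h] \<theta>_carrier[OF vu cancel(2)] by (simp add: lmul_def)
next
  note vu = adj_sym[OF uv]
  interpret v: group "G v" using vertex_group adj_in vu by blast
  case (extend c s l)
  have hc: "h \<otimes>\<^bsub>G v\<^esub> c \<in> D v u" using subgroup.m_closed[OF D_subgroup[OF vu] h extend(2)] .
  show ?thesis
    using extend(1,7) \<tau>_extend[OF vu hc extend(6,5)] \<theta>_mult[OF vu h extend(2)]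
      v.m_assoc[OF D_in[OF vu h] D_in[OF vu extend(2)] extend(3)] by (simp add: lmul_def)
qed

text \<open>An extended and a shortened list differ in length, so equality is decided by the representatives.
  In terms of the Bass-Serre tree, this determines the stabilizers of edges.\<close>

lemma snd_\<tau>_eq_iff:
  assumes uv: "adj u v" and \<omega>: "\<omega> \<in> NF v" "\<omega>' \<in> NF v" "snd \<omega> = snd \<omega>'"
  shows "snd (\<tau> u v \<omega>) = snd (\<tau> u v \<omega>') \<longleftrightarrow> fst \<omega> \<otimes>\<^bsub>G v\<^esub> inv\<^bsub>G v\<^esub> fst \<omega>' \<in> D v u"
proof -
  have vu: "adj v u" using uv by (rule adj_sym)
  have k: "fst \<omega> \<in> carrier (G v)" "fst \<omega>' \<in> carrier (G v)" using \<omega>(1,2) by (auto simp: NF_def)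
  have ne: "tl (snd \<omega>') \<noteq> (u, s) # snd \<omega>'" for s
  proof
    assume "tl (snd \<omega>') = (u, s) # snd \<omega>'"
    then have "length (tl (snd \<omega>')) = Suc (length (snd \<omega>'))" by simp
    then show False by simp
  qed
  have "snd (\<tau> u v \<omega>) = snd (\<tau> u v \<omega>') \<longleftrightarrow> rep v u (fst \<omega>) = rep v u (fst \<omega>')"
    using \<omega>(3) ne ne[symmetric] by (auto simp: \<tau>_def Let_def)
  then show ?thesis using rep_eq_iff[OF vu k] by simp
qed

end

section \<open>The fundamental group acts on normal forms\<close>

context simple_tree_of_groups
begin

text \<open>Composition of the maps \<open>\<tau>\<close> along a list of vertices, from the end of the list to its head.\<close>

fun transport :: "'v list \<Rightarrow> 'a \<times> ('v \<times> 'a) list \<Rightarrow> 'a \<times> ('v \<times> 'a) list" where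
  "transport (u # v # us) \<omega> = \<tau> u v (transport (v # us) \<omega>)"
| "transport _ \<omega> = \<omega>"

definition \<sigma> :: "'v \<Rightarrow> 'a \<times> ('v \<times> 'a) list \<Rightarrow> 'a \<times> ('v \<times> 'a) list" where
  "\<sigma> v = transport (path v root)"

lemma \<tau>_bij:
  assumes "adj u v"
  shows "bij_betw (\<tau> u v) (NF v) (NF u)"
  by (rule bij_betw_byWitness[where f' = "\<tau> v u"])
    (use \<tau>_\<tau>[OF assms] \<tau>_\<tau>[OF adj_sym[OF assms]] \<tau>_in[OF assms] \<tau>_in[OF adj_sym[OF assms]] in auto)

lemma transport_bij: "walk V adj p \<Longrightarrow> bij_betw (transport p) (NF (last p)) (NF (hd p))"
proof (induction p)
  case (Cons u p)
  show ?case
  proof (cases p)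
    case Nil
    then show ?thesis by (simp add: bij_betw_def)
  next
    case p: (Cons v us)
    have "walk V adj p" and uv: "adj u v"
      using Cons.prems by (auto simp: p walk_def)
    then have "bij_betw (transport p) (NF (last p)) (NF v)" using Cons.IH by (simp add: p)
    from bij_betw_trans[OF this \<tau>_bij[OF uv]]
    have "bij_betw (\<tau> u v \<circ> transport p) (NF (last p)) (NF u)" .
    moreover have "transport (u # p) = \<tau> u v \<circ> transport p" by (auto simp: p fun_eq_iff)
    moreover have "last (u # p) = last p" "hd (u # p) = u" by (simp_all add: p)
    ultimately show ?thesis by (simp only:)
  qed
qed (simp add: walk_def)

lemma \<sigma>_bij:
  assumes "v \<in> V"
  shows "bij_betw (\<sigma> v) (NF root) (NF v)"
  using transport_bij[of "path v root"] path_props[OF assms root]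
  by (simp add: \<sigma>_def reduced_walk_def)

lemma \<sigma>_in: "v \<in> V \<Longrightarrow> \<omega> \<in> NF root \<Longrightarrow> \<sigma> v \<omega> \<in> NF v"
  using \<sigma>_bij bij_betw_apply by metis

lemma \<sigma>_root [simp]: "\<sigma> root \<omega> = \<omega>"
  using root by (simp add: \<sigma>_def)

text \<open>Here it matters that the graph is a tree: around a cycle, transport might be nontrivial.\<close>

lemma \<sigma>_adj:
  assumes uv: "adj u v" and \<omega>: "\<omega> \<in> NF root"
  shows "\<sigma> u \<omega> = \<tau> u v (\<sigma> v \<omega>)"
proof -
  have step: "\<sigma> w \<omega> = \<tau> w x (\<sigma> x \<omega>)" if h: "path w root = w # path x root" "x \<in> V" for w x
  proof -
    obtain us where "path x root = x # us"
      using path_props[OF h(2) root] by (cases "path x root") auto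
    then show ?thesis using h(1) by (simp add: \<sigma>_def)
  qed
  have V: "u \<in> V" "v \<in> V" using adj_in adj_in2 uv by auto
  from path_adj_cases[OF adj_sym[OF uv] root] show ?thesis
  proof
    assume "path v root = v # path u root"
    from step[OF this V(1)] have "\<sigma> v \<omega> = \<tau> v u (\<sigma> u \<omega>)" .
    then show ?thesis using \<tau>_\<tau>[OF adj_sym[OF uv] \<sigma>_in[OF V(1) \<omega>]] by simp
  qed (use step V in auto)
qed

text \<open>All vertex groups act on the normal forms at the root: \<open>\<sigma> v\<close> carries these to the ones at \<open>v\<close>, on which
  \<open>G v\<close> acts by multiplication.\<close>

definition NF_act :: "'v \<Rightarrow> 'a \<Rightarrow> 'a \<times> ('v \<times> 'a) list \<Rightarrow> 'a \<times> ('v \<times> 'a) list" where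
  "NF_act v h = restrict (\<lambda>\<omega>. inv_into (NF root) (\<sigma> v) (lmul v h (\<sigma> v \<omega>))) (NF root)"

lemma NF_act:
  assumes "v \<in> V" "h \<in> carrier (G v)" "\<omega> \<in> NF root"
  shows "NF_act v h \<omega> \<in> NF root" "\<sigma> v (NF_act v h \<omega>) = lmul v h (\<sigma> v \<omega>)"
proof -
  have "lmul v h (\<sigma> v \<omega>) \<in> \<sigma> v ` NF root"
    using \<sigma>_bij[OF assms(1)] lmul_in[OF assms(1,2) \<sigma>_in[OF assms(1,3)]] by (simp add: bij_betw_def)
  then show "NF_act v h \<omega> \<in> NF root" "\<sigma> v (NF_act v h \<omega>) = lmul v h (\<sigma> v \<omega>)"
    using assms(3) by (auto simp: NF_act_def intro: inv_into_into f_inv_into_f)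
qed

lemma \<sigma>_eq_iff: "v \<in> V \<Longrightarrow> \<omega> \<in> NF root \<Longrightarrow> \<omega>' \<in> NF root \<Longrightarrow> \<sigma> v \<omega> = \<sigma> v \<omega>' \<longleftrightarrow> \<omega> = \<omega>'"
  using \<sigma>_bij unfolding bij_betw_def inj_on_def by blast

lemma NF_act_mult:
  assumes "v \<in> V" "g \<in> carrier (G v)" "h \<in> carrier (G v)" "\<omega> \<in> NF root"
  shows "NF_act v (g \<otimes>\<^bsub>G v\<^esub> h) \<omega> = NF_act v g (NF_act v h \<omega>)"
proof -
  have gh: "g \<otimes>\<^bsub>G v\<^esub> h \<in> carrier (G v)"
    using assms monoid.m_closed[OF group.is_monoid[OF vertex_group]] by blast
  have h: "NF_act v h \<omega> \<in> NF root" using NF_act(1) assms by blast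
  have "\<sigma> v (NF_act v (g \<otimes>\<^bsub>G v\<^esub> h) \<omega>) = \<sigma> v (NF_act v g (NF_act v h \<omega>))"
    using NF_act(2)[OF assms(1) gh assms(4)] NF_act(2)[OF assms(1,2) h]
      NF_act(2)[OF assms(1,3,4)] lmul_mult[OF assms(1-3) \<sigma>_in[OF assms(1,4)]] by simp
  then show ?thesis
    using \<sigma>_eq_iff[OF assms(1) NF_act(1)[OF assms(1) gh assms(4)] NF_act(1)[OF assms(1,2) h]] by simp
qed

lemma NF_act_one:
  assumes "v \<in> V" "\<omega> \<in> NF root"
  shows "NF_act v \<one>\<^bsub>G v\<^esub> \<omega> = \<omega>"
proof -
  have one: "\<one>\<^bsub>G v\<^esub> \<in> carrier (G v)"
    using monoid.one_closed[OF group.is_monoid[OF vertex_group[OF assms(1)]]] .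
  show ?thesis
    using NF_act[OF assms(1) one assms(2)] lmul_one[OF assms(1) \<sigma>_in[OF assms]]
      \<sigma>_eq_iff[OF assms(1)] assms(2) by metis
qed

lemma NF_act_hom:
  assumes v: "v \<in> V"
  shows "NF_act v \<in> hom (G v) (BijGroup (NF root))"
proof -
  interpret group "G v" by (rule vertex_group[OF v])
  have Bij: "NF_act v g \<in> Bij (NF root)" if g: "g \<in> carrier (G v)" for g
  proof -
    have cancel: "NF_act v h (NF_act v g \<omega>) = \<omega>"
      if "h \<otimes>\<^bsub>G v\<^esub> g = \<one>\<^bsub>G v\<^esub>" "h \<in> carrier (G v)" "g \<in> carrier (G v)" "\<omega> \<in> NF root" for g h \<omega>
      using NF_act_mult[OF v that(2,3,4)] NF_act_one[OF v that(4)] that(1) by simp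
    have "bij_betw (NF_act v g) (NF root) (NF root)"
      by (rule bij_betw_byWitness[where f' = "NF_act v (inv\<^bsub>G v\<^esub> g)"])
        (use cancel g NF_act(1)[OF v] in auto)
    then show ?thesis by (simp add: Bij_def NF_act_def)
  qed
  show ?thesis
  proof (rule homI)
    show "NF_act v g \<in> carrier (BijGroup (NF root))" if "g \<in> carrier (G v)" for g
      using Bij[OF that] by (simp add: BijGroup_def)
    show "NF_act v (g \<otimes>\<^bsub>G v\<^esub> h) = NF_act v g \<otimes>\<^bsub>BijGroup (NF root)\<^esub> NF_act v h"
      if "g \<in> carrier (G v)" "h \<in> carrier (G v)" for g h
    proof
      fix \<omega>
      show "NF_act v (g \<otimes>\<^bsub>G v\<^esub> h) \<omega> = (NF_act v g \<otimes>\<^bsub>BijGroup (NF root)\<^esub> NF_act v h) \<omega>"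
        using NF_act_mult[OF v that] Bij[OF that(1)] Bij[OF that(2)]
        by (cases "\<omega> \<in> NF root") (auto simp: BijGroup_def compose_def NF_act_def)
    qed
  qed
qed

lemma NF_act_glue:
  assumes uv: "adj u v" and g: "g \<in> D u v"
  shows "NF_act v (\<theta> u v g) = NF_act u g"
proof
  fix \<omega>
  have vu: "adj v u" by (rule adj_sym[OF uv])
  have V: "u \<in> V" "v \<in> V" using adj_in adj_in2 uv by auto
  note gu = D_in[OF uv g] and gv = \<theta>_carrier[OF uv g]
  show "NF_act v (\<theta> u v g) \<omega> = NF_act u g \<omega>"
  proof (cases "\<omega> \<in> NF root")
    case True
    have "\<sigma> u (NF_act v (\<theta> u v g) \<omega>) = \<tau> u v (\<sigma> v (NF_act v (\<theta> u v g) \<omega>))"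
      by (rule \<sigma>_adj[OF uv NF_act(1)[OF V(2) gv True]])
    also have "\<dots> = \<tau> u v (lmul v (\<theta> u v g) (\<sigma> v \<omega>))"
      by (simp only: NF_act(2)[OF V(2) gv True])
    also have "\<dots> = lmul u (\<theta> v u (\<theta> u v g)) (\<tau> u v (\<sigma> v \<omega>))"
      by (rule \<tau>_lmul[OF uv \<theta>_in[OF uv g] \<sigma>_in[OF V(2) True]])
    also have "\<dots> = \<sigma> u (NF_act u g \<omega>)"
      using NF_act(2)[OF V(1) gu True] \<theta>_\<theta>[OF uv g] \<sigma>_adj[OF uv True] by simp
    finally show ?thesis
      using \<sigma>_eq_iff[OF V(1) NF_act(1)[OF V(2) gv True] NF_act(1)[OF V(1) gu True]] by simp
  next
    case False
    then show ?thesis by (simp add: NF_act_def)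
  qed
qed

end

text \<open>The group \<open>P\<close> is the colimit of the tree of groups.  The universal property is stated for groups of
  permutations of pairs as they occur as normal forms, since the type of the target is fixed in a
  locale.\<close>

locale tree_amalgam = simple_tree_of_groups V adj G D \<theta> root + group P
  for V :: "'v set" and adj :: "'v \<Rightarrow> 'v \<Rightarrow> bool"
    and G :: "'v \<Rightarrow> ('a, 'm) monoid_scheme"
    and D :: "'v \<Rightarrow> 'v \<Rightarrow> 'a set"
    and \<theta> :: "'v \<Rightarrow> 'v \<Rightarrow> 'a \<Rightarrow> 'a"
    and root :: 'v
    and P :: "('p, 'n) monoid_scheme" (structure) +
  fixes \<iota> :: "'v \<Rightarrow> 'a \<Rightarrow> 'p"
  assumes \<iota>_hom: "v \<in> V \<Longrightarrow> \<iota> v \<in> hom (G v) P"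
    and \<iota>_glue: "adj u v \<Longrightarrow> g \<in> D u v \<Longrightarrow> \<iota> v (\<theta> u v g) = \<iota> u g"
    and generated: "\<lbrakk>x \<in> carrier P; Q \<one>;
      \<And>v g y. v \<in> V \<Longrightarrow> g \<in> carrier (G v) \<Longrightarrow> y \<in> carrier P \<Longrightarrow> Q y \<Longrightarrow> Q (\<iota> v g \<otimes> y)\<rbrakk> \<Longrightarrow> Q x"
    and universal: "\<lbrakk>\<And>v. v \<in> V \<Longrightarrow> f v \<in> hom (G v) (BijGroup (\<Omega> :: ('a \<times> ('v \<times> 'a) list) set));
      \<And>u v g. adj u v \<Longrightarrow> g \<in> D u v \<Longrightarrow> f v (\<theta> u v g) = f u g\<rbrakk>
      \<Longrightarrow> \<exists>\<psi>\<in>hom P (BijGroup \<Omega>). \<forall>v\<in>V. \<forall>g\<in>carrier (G v). \<psi> (\<iota> v g) = f v g"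
begin

lemma \<iota>_closed: "v \<in> V \<Longrightarrow> g \<in> carrier (G v) \<Longrightarrow> \<iota> v g \<in> carrier P"
  using \<iota>_hom hom_in_carrier by metis

lemma \<iota>_mult: "v \<in> V \<Longrightarrow> g \<in> carrier (G v) \<Longrightarrow> h \<in> carrier (G v) \<Longrightarrow>
    \<iota> v (g \<otimes>\<^bsub>G v\<^esub> h) = \<iota> v g \<otimes> \<iota> v h"
  using \<iota>_hom hom_mult by metis

lemma \<iota>_one: "v \<in> V \<Longrightarrow> \<iota> v \<one>\<^bsub>G v\<^esub> = \<one>"
  using \<iota>_hom hom_one vertex_group is_group by metis

lemma \<iota>_inv: "v \<in> V \<Longrightarrow> g \<in> carrier (G v) \<Longrightarrow> \<iota> v (inv\<^bsub>G v\<^esub> g) = inv (\<iota> v g)"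
  using group_hom.hom_inv[of "G v" P "\<iota> v" g] \<iota>_hom vertex_group is_group
  by (simp add: group_hom_def group_hom_axioms_def)

text \<open>The product of the entries in \<open>P\<close>; the steps along edges have no factor in an amalgam over a tree.\<close>

fun evl :: "('v \<times> 'a) list \<Rightarrow> 'p" where
  "evl [] = \<one>"
| "evl ((u, s) # l) = \<iota> (start l) s \<otimes> evl l"

definition ev :: "'v \<Rightarrow> 'a \<times> ('v \<times> 'a) list \<Rightarrow> 'p" where
  "ev v \<omega> = \<iota> v (fst \<omega>) \<otimes> evl (snd \<omega>)"

lemma evl_closed: "valid l \<Longrightarrow> evl l \<in> carrier P"
  by (induction l rule: valid.induct) (auto intro: \<iota>_closed start_in)

lemma ev_lmul: "v \<in> V \<Longrightarrow> h \<in> carrier (G v) \<Longrightarrow> \<omega> \<in> NF v \<Longrightarrow> ev v (lmul v h \<omega>) = \<iota> v h \<otimes> ev v \<omega>"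
  by (auto simp: ev_def NF_def lmul_def \<iota>_mult m_assoc \<iota>_closed evl_closed)

text \<open>The element \<open>d\<close> that \<open>\<tau>\<close> moves across the edge has the same image in \<open>P\<close> on both sides.\<close>

lemma ev_\<tau>:
  assumes uv: "adj u v" and \<omega>: "\<omega> \<in> NF v"
  shows "ev u (\<tau> u v \<omega>) = ev v \<omega>"
  using uv \<omega>
proof (cases rule: \<tau>_cases)
  note vu = adj_sym[OF uv]
  have V: "u \<in> V" "v \<in> V" using adj_in uv vu by auto
  {
    case (cancel c s l)
    then have "s \<in> carrier (G u)" "valid l" by auto
    then show ?thesis
      using cancel V D_in[OF vu cancel(2)] \<theta>_carrier[OF vu cancel(2)] \<iota>_glue[OF vu cancel(2)]
      by (simp add: ev_def \<iota>_mult m_assoc \<iota>_closed evl_closed)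
  next
    case (extend c s l)
    then have "valid l" by auto
    then show ?thesis
      using extend V D_in[OF vu extend(2)] \<iota>_glue[OF vu extend(2)]
      by (simp add: ev_def \<iota>_mult m_assoc \<iota>_closed evl_closed)
  }
qed

lemma ev_transport: "walk V adj p \<Longrightarrow> \<omega> \<in> NF (last p) \<Longrightarrow> ev (hd p) (transport p \<omega>) = ev (last p) \<omega>"
proof (induction p)
  case (Cons u p)
  show ?case
  proof (cases p)
    case p: (Cons v us)
    have w: "walk V adj p" and uv: "adj u v"
      using Cons.prems by (auto simp: p walk_def)
    have "transport p \<omega> \<in> NF v"
      using bij_betw_apply[OF transport_bij[OF w], of \<omega>] Cons.prems(2) by (simp add: p)
    then show ?thesis using ev_\<tau>[OF uv, of "transport p \<omega>"] Cons.IH[OF w] Cons.prems(2) by (simp add: p)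
  qed simp
qed (simp add: walk_def)

lemma ev_\<sigma>: "v \<in> V \<Longrightarrow> \<omega> \<in> NF root \<Longrightarrow> ev v (\<sigma> v \<omega>) = ev root \<omega>"
  using ev_transport[of "path v root" \<omega>] path_props[OF _ root, of v]
  by (simp add: \<sigma>_def reduced_walk_def)

text \<open>The equations determine \<open>f\<close>: starting from the last one, those for multiplication and for change of the
  vertex compute the normal forms of all products of elements of vertex groups.\<close>

definition normal_form :: "('v \<Rightarrow> 'p \<Rightarrow> 'a \<times> ('v \<times> 'a) list) \<Rightarrow> bool" where
  "normal_form f \<longleftrightarrow>
     (\<forall>v\<in>V. \<forall>x\<in>carrier P. f v x \<in> NF v \<and> ev v (f v x) = x) \<and>
     (\<forall>v\<in>V. \<forall>h\<in>carrier (G v). \<forall>x\<in>carrier P. f v (\<iota> v h \<otimes> x) = lmul v h (f v x)) \<and>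
     (\<forall>u v. adj u v \<longrightarrow> (\<forall>x\<in>carrier P. f u x = \<tau> u v (f v x))) \<and>
     f root \<one> = (\<one>\<^bsub>G root\<^esub>, [])"

text \<open>Let \<open>P\<close> act on the normal forms at the root.  An element \<open>x\<close> maps the normal form of \<open>1\<close> to one whose product
  is \<open>x\<close>, by induction on a representation of \<open>x\<close> as a product of elements of vertex groups; the other
  vertices are reached by transport.\<close>

lemma normal_form_exists: "\<exists>f. normal_form f"
proof -
  obtain \<psi> where \<psi>: "\<psi> \<in> hom P (BijGroup (NF root))"
    and \<psi>\<iota>: "\<And>v g. v \<in> V \<Longrightarrow> g \<in> carrier (G v) \<Longrightarrow> \<psi> (\<iota> v g) = NF_act v g"
    using universal[of NF_act "NF root", OF NF_act_hom NF_act_glue] by blast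
  let ?\<omega> = "(\<one>\<^bsub>G root\<^esub>, []) :: 'a \<times> ('v \<times> 'a) list"
  have base: "?\<omega> \<in> NF root"
    using monoid.one_closed[OF group.is_monoid[OF vertex_group[OF root]]] by (simp add: NF_def)
  have Bij: "\<psi> x \<in> Bij (NF root)" if "x \<in> carrier P" for x
    using hom_in_carrier[OF \<psi> that] by (simp add: BijGroup_def)
  have \<psi>_in: "\<psi> x ?\<omega> \<in> NF root" if "x \<in> carrier P" for x
    using Bij[OF that] base bij_betw_apply by (auto simp: Bij_def)
  have step: "\<psi> (\<iota> v h \<otimes> x) ?\<omega> = NF_act v h (\<psi> x ?\<omega>)"
    if "v \<in> V" "h \<in> carrier (G v)" "x \<in> carrier P" for v h x
    using hom_mult[OF \<psi> \<iota>_closed[OF that(1,2)] that(3)] Bij[OF that(3)] Bij[OF \<iota>_closed[OF that(1,2)]]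
      \<psi>\<iota>[OF that(1,2)] base
    by (simp add: BijGroup_def compose_def)
  have one: "\<psi> \<one> ?\<omega> = ?\<omega>"
    using hom_one[OF \<psi> is_group group_BijGroup] base by (simp add: BijGroup_def)
  have ev: "ev root (\<psi> x ?\<omega>) = x" if "x \<in> carrier P" for x
    using that
  proof (rule generated)
    show "ev root (\<psi> \<one> ?\<omega>) = \<one>" using one \<iota>_one[OF root] by (simp add: ev_def)
    fix v g y assume v: "v \<in> V" "g \<in> carrier (G v)" "y \<in> carrier P" and IH: "ev root (\<psi> y ?\<omega>) = y"
    note y = \<psi>_in[OF v(3)]
    have "ev root (NF_act v g (\<psi> y ?\<omega>)) = ev v (\<sigma> v (NF_act v g (\<psi> y ?\<omega>)))"
      using ev_\<sigma>[OF v(1) NF_act(1)[OF v(1,2) y]] by simp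
    also have "\<dots> = \<iota> v g \<otimes> ev v (\<sigma> v (\<psi> y ?\<omega>))"
      using NF_act(2)[OF v(1,2) y] ev_lmul[OF v(1,2) \<sigma>_in[OF v(1) y]] by simp
    also have "\<dots> = \<iota> v g \<otimes> y" using ev_\<sigma>[OF v(1) y] IH by simp
    finally show "ev root (\<psi> (\<iota> v g \<otimes> y) ?\<omega>) = \<iota> v g \<otimes> y" using step[OF v] by simp
  qed
  have "normal_form (\<lambda>v x. \<sigma> v (\<psi> x ?\<omega>))"
    unfolding normal_form_def
  proof (intro conjI ballI allI impI)
    fix v x assume v: "v \<in> V" and x: "x \<in> carrier P"
    show "\<sigma> v (\<psi> x ?\<omega>) \<in> NF v" by (rule \<sigma>_in[OF v \<psi>_in[OF x]])
    show "ev v (\<sigma> v (\<psi> x ?\<omega>)) = x" using ev_\<sigma>[OF v \<psi>_in[OF x]] ev[OF x] by simp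
    fix h assume h: "h \<in> carrier (G v)"
    show "\<sigma> v (\<psi> (\<iota> v h \<otimes> x) ?\<omega>) = lmul v h (\<sigma> v (\<psi> x ?\<omega>))"
      using step[OF v h x] NF_act(2)[OF v h \<psi>_in[OF x]] by simp
  next
    fix u v x assume "adj u v" "x \<in> carrier P"
    then show "\<sigma> u (\<psi> x ?\<omega>) = \<tau> u v (\<sigma> v (\<psi> x ?\<omega>))" using \<sigma>_adj \<psi>_in by blast
  next
    show "\<sigma> root (\<psi> \<one> ?\<omega>) = ?\<omega>" using one by simp
  qed
  then show ?thesis by blast
qed

definition nf :: "'v \<Rightarrow> 'p \<Rightarrow> 'a \<times> ('v \<times> 'a) list" where
  "nf = (SOME f. normal_form f)"

lemma nf_in: "v \<in> V \<Longrightarrow> x \<in> carrier P \<Longrightarrow> nf v x \<in> NF v"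
  and ev_nf: "v \<in> V \<Longrightarrow> x \<in> carrier P \<Longrightarrow> ev v (nf v x) = x"
  and nf_\<iota>: "v \<in> V \<Longrightarrow> h \<in> carrier (G v) \<Longrightarrow> x \<in> carrier P \<Longrightarrow> nf v (\<iota> v h \<otimes> x) = lmul v h (nf v x)"
  and nf_adj: "adj u v \<Longrightarrow> x \<in> carrier P \<Longrightarrow> nf u x = \<tau> u v (nf v x)"
  and nf_root_one: "nf root \<one> = (\<one>\<^bsub>G root\<^esub>, [])"
proof -
  have nf: "normal_form nf" unfolding nf_def by (rule someI_ex[OF normal_form_exists])
  show "v \<in> V \<Longrightarrow> x \<in> carrier P \<Longrightarrow> nf v x \<in> NF v"
    and "v \<in> V \<Longrightarrow> x \<in> carrier P \<Longrightarrow> ev v (nf v x) = x"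
    and "v \<in> V \<Longrightarrow> h \<in> carrier (G v) \<Longrightarrow> x \<in> carrier P \<Longrightarrow> nf v (\<iota> v h \<otimes> x) = lmul v h (nf v x)"
    and "adj u v \<Longrightarrow> x \<in> carrier P \<Longrightarrow> nf u x = \<tau> u v (nf v x)"
    and "nf root \<one> = (\<one>\<^bsub>G root\<^esub>, [])"
    using nf unfolding normal_form_def by blast+
qed

text \<open>Normal forms are unique: a valid list is the normal form of its product.\<close>

lemma nf_evl: "valid l \<Longrightarrow> nf (start l) (evl l) = (\<one>\<^bsub>G (start l)\<^esub>, l)"
proof (induction l)
  case Nil
  then show ?case by (simp add: nf_root_one)
next
  case (Cons a l)
  obtain u s where a: "a = (u, s)" by force
  let ?v = "start l"
  have v: "valid l" "adj u ?v" "s \<in> carrier (G ?v)" using Cons.prems by (auto simp: a)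
  have V: "?v \<in> V" by (rule start_in[OF v(1)])
  interpret v: group "G ?v" by (rule vertex_group[OF V])
  interpret u: group "G u" by (rule vertex_group[OF adj_in[OF v(2)]])
  have vu: "adj ?v u" by (rule adj_sym[OF v(2)])
  note one = subgroup.one_closed[OF D_subgroup[OF vu]]
  have "nf ?v (evl (a # l)) = (\<one>\<^bsub>G ?v\<^esub> \<otimes>\<^bsub>G ?v\<^esub> s, l)"
    using nf_\<iota>[OF V v(3) evl_closed[OF v(1)]] Cons.IH[OF v(1)] v(3) by (simp add: a lmul_def)
  then have "nf u (evl (a # l)) = \<tau> u ?v (\<one>\<^bsub>G ?v\<^esub> \<otimes>\<^bsub>G ?v\<^esub> s, l)"
    using nf_adj[OF v(2) evl_closed[OF Cons.prems]] by simp
  also have "\<dots> = (\<theta> ?v u \<one>\<^bsub>G ?v\<^esub>, a # l)"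
    using \<tau>_extend[OF vu one] Cons.prems by (simp add: a)
  also have "\<theta> ?v u \<one>\<^bsub>G ?v\<^esub> = \<one>\<^bsub>G u\<^esub>"
  proof -
    have c: "\<theta> ?v u \<one>\<^bsub>G ?v\<^esub> \<in> carrier (G u)" by (rule \<theta>_carrier[OF vu one])
    have "\<theta> ?v u \<one>\<^bsub>G ?v\<^esub> = \<theta> ?v u \<one>\<^bsub>G ?v\<^esub> \<otimes>\<^bsub>G u\<^esub> \<theta> ?v u \<one>\<^bsub>G ?v\<^esub>"
      using \<theta>_mult[OF vu one one] by simp
    then show ?thesis using c u.r_cancel_one' by metis
  qed
  finally show ?case by (simp add: a)
qed

text \<open>Elements of \<open>G v\<close> are told apart by how they multiply the first entry of the normal form of \<open>1\<close> at \<open>v\<close>.\<close>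

lemma \<iota>_inj: "v \<in> V \<Longrightarrow> inj_on (\<iota> v) (carrier (G v))"
proof (rule inj_onI)
  fix g h assume v: "v \<in> V" and g: "g \<in> carrier (G v)" and h: "h \<in> carrier (G v)" and eq: "\<iota> v g = \<iota> v h"
  interpret v: group "G v" by (rule vertex_group[OF v])
  have "fst (nf v \<one>) \<in> carrier (G v)" using nf_in[OF v one_closed] by (auto simp: NF_def)
  moreover have "lmul v g (nf v \<one>) = lmul v h (nf v \<one>)"
    using nf_\<iota>[OF v g one_closed] nf_\<iota>[OF v h one_closed] eq by simp
  ultimately show "g = h" using g h by (simp add: lmul_def)
qed

end

section \<open>The Bass-Serre tree of normal forms\<close>

text \<open>Lists that satisfy a predicate \<open>Q\<close> form a tree with root \<open>[]\<close> if \<open>Q\<close> is inherited by tails: the parent of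
  a list is its tail.\<close>

definition list_adj :: "('b list \<Rightarrow> bool) \<Rightarrow> 'b list \<Rightarrow> 'b list \<Rightarrow> bool" where
  "list_adj Q l m \<longleftrightarrow> Q l \<and> Q m \<and> (l \<noteq> [] \<and> m = tl l \<or> m \<noteq> [] \<and> l = tl m)"

lemma list_adj_sym: "list_adj Q l m \<Longrightarrow> list_adj Q m l"
  by (auto simp: list_adj_def)

text \<open>A list has one parent only, so a reduced walk that goes up once can never go down again.\<close>

lemma reduced_walk_ascending:
  assumes "reduced_walk X (list_adj Q) (a # b # zs)" "b \<noteq> []" "a = tl b"
  shows "length a < length (last (a # b # zs))"
  using assms
proof (induction zs arbitrary: a b)
  case Nil
  then show ?case by (cases b) auto
next
  case (Cons c zs)
  have red: "reduced_walk X (list_adj Q) (b # c # zs)" and ne: "a \<noteq> c"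
    using Cons.prems(1) by (auto simp: reduced_walk_Cons)
  have "list_adj Q b c" using red by (simp add: reduced_walk_Cons)
  then have "c \<noteq> []" "b = tl c" using ne Cons.prems(3) by (auto simp: list_adj_def)
  then have "length b < length (last (b # c # zs))" by (rule Cons.IH[OF red])
  then show ?case using Cons.prems(2,3) by (cases b) auto
qed

text \<open>In a closed reduced walk, the first step and, read backwards, the last step must descend.  Both lead to
  the same list, and what is left between them is a shorter closed reduced walk.\<close>

lemma list_tree_no_cycle:
  assumes "reduced_walk X (list_adj Q) xs" "hd xs = last xs"
  shows "length xs = 1"
  using assms
proof (induction "length xs" arbitrary: xs rule: less_induct)
  case less
  have descend: "b = tl a \<and> a \<noteq> []"
    if "reduced_walk X (list_adj Q) (a # b # zs)" "last (a # b # zs) = a" for a b zs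
  proof -
    have "list_adj Q a b" using that(1) by (simp add: reduced_walk_Cons)
    moreover have "\<not> (b \<noteq> [] \<and> a = tl b)"
      using reduced_walk_ascending[OF that(1)] that(2) by auto
    ultimately show ?thesis by (auto simp: list_adj_def)
  qed
  have revred: "reduced_walk X (list_adj Q) (rev ys)" if "reduced_walk X (list_adj Q) ys" for ys
    using that unfolding reduced_walk_def walk_def nonbacktracking_rev set_rev successively_rev
      rev_is_Nil_conv
    by (blast intro: successively_mono[of "list_adj Q"] list_adj_sym)
  show ?case
  proof (rule ccontr)
    assume "length xs \<noteq> 1"
    then obtain a b zs where xs: "xs = a # b # zs"
      using less.prems(1) by (cases xs rule: remdups_adj.cases) auto
    have last: "last (b # zs) = a" using less.prems(2) by (simp add: xs)
    obtain c ws where c: "rev (b # zs) = a # ws" "rev xs = a # ws @ [a]"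
      using last by (cases "b # zs" rule: rev_cases) (auto simp: xs)
    have b: "b = tl a" "a \<noteq> []" using descend[of a b zs] less.prems(1) last by (auto simp: xs)
    show False
    proof (cases ws)
      case Nil
      then have "b = a" using c(1) by simp
      then show False using b by (cases a) auto
    next
      case (Cons d ws')
      have "reduced_walk X (list_adj Q) (a # d # ws' @ [a])"
        using revred[OF less.prems(1)] c(2) Cons by simp
      then have "d = tl a" using descend[of a d "ws' @ [a]"] by simp
      have mid: "b # zs = rev ws @ [a]" using c(1) by (metis rev.simps(2) rev_rev_ident)
      have red: "reduced_walk X (list_adj Q) (rev ws)"
        using less.prems(1) mid Cons reduced_walk_appendD(2)[of X "list_adj Q" "[a]" "rev ws @ [a]"]
          reduced_walk_appendD(1)[of X "list_adj Q" "rev ws" "[a]"] by (simp add: xs)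
      have "hd (rev ws) = b" using mid Cons by (metis hd_append2 list.discI list.sel(1) rev_is_Nil_conv)
      moreover have "last (rev ws) = d" using Cons by simp
      moreover have "length (rev ws) < length xs"
        using arg_cong[OF mid, of length] by (simp add: xs)
      ultimately have "length (rev ws) = 1"
        using less.hyps[OF _ red] b \<open>d = tl a\<close> by simp
      then have "b # zs = [b, a]" using mid by (cases ws) auto
      then show False using less.prems(1) by (simp add: xs reduced_walk_Cons)
    qed
  qed
qed

lemma list_tree:
  assumes "Q []" and tl: "\<And>l. Q l \<Longrightarrow> Q (tl l)"
  shows "tree_graph {l. Q l} (list_adj Q)"
proof
  fix x y assume xy: "x \<in> {l. Q l}" "y \<in> {l. Q l}"
  have down: "\<exists>w. walk {l. Q l} (list_adj Q) w \<and> hd w = l \<and> last w = []" if "Q l" for l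
    using that
  proof (induction l)
    case Nil
    then show ?case by (intro exI[of _ "[[]]"]) (simp add: walk_def)
  next
    case (Cons a l)
    have "Q l" using tl[OF Cons.prems] by simp
    then obtain w where w: "walk {l. Q l} (list_adj Q) w" "hd w = l" "last w = []"
      using Cons.IH by blast
    then obtain w' where w': "w = l # w'" by (cases w) (auto simp: walk_def)
    have "list_adj Q (a # l) l" using Cons.prems \<open>Q l\<close> by (simp add: list_adj_def)
    then show ?case using w Cons.prems
      by (intro exI[of _ "(a # l) # w"]) (auto simp: walk_def w')
  qed
  obtain u where u: "walk {l. Q l} (list_adj Q) u" "hd u = x" "last u = []" using down xy by blast
  obtain v where v: "walk {l. Q l} (list_adj Q) v" "hd v = y" "last v = []" using down xy by blast
  obtain u' where u': "u = u' @ [[]]" using u by (cases u rule: rev_cases) (auto simp: walk_def)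
  have "walk {l. Q l} (list_adj Q) (rev v)"
    using v(1) unfolding walk_def set_rev successively_rev rev_is_Nil_conv
    by (blast intro: successively_mono[of "list_adj Q"] list_adj_sym)
  moreover obtain v' where v': "rev v = [] # v'"
    using v by (cases v rule: rev_cases) (auto simp: walk_def)
  ultimately have "walk {l. Q l} (list_adj Q) (u' @ [] # v')"
    using u(1) walk_appendI[of "{l. Q l}" "list_adj Q" u' "[]" v'] by (simp add: u')
  moreover have "hd (u' @ [] # v') = x" using u(2) by (cases u') (auto simp: u')
  moreover have "last (u' @ [] # v') = y"
    using arg_cong[OF v', of last] v(1,2) by (simp add: last_rev walk_def)
  ultimately show "\<exists>xs. walk {l. Q l} (list_adj Q) xs \<and> hd xs = x \<and> last xs = y" by blast
next
  show "length xs = 1" if "reduced_walk {l. Q l} (list_adj Q) xs" "hd xs = last xs" for xs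
    by (rule list_tree_no_cycle[OF that])
qed (auto simp: list_adj_def)

lemma csa_condition_transfer:
  assumes G: "group G" "csa_condition G" and P: "group P"
    and f: "f \<in> hom G P" "inj_on f (carrier G)"
    and el: "a \<in> f ` carrier G" "b \<in> f ` carrier G" "x \<in> f ` carrier G"
      "a \<noteq> \<one>\<^bsub>P\<^esub>" "b \<noteq> \<one>\<^bsub>P\<^esub>" "a \<otimes>\<^bsub>P\<^esub> b = b \<otimes>\<^bsub>P\<^esub> a"
      "a \<otimes>\<^bsub>P\<^esub> (x \<otimes>\<^bsub>P\<^esub> b \<otimes>\<^bsub>P\<^esub> inv\<^bsub>P\<^esub> x) = (x \<otimes>\<^bsub>P\<^esub> b \<otimes>\<^bsub>P\<^esub> inv\<^bsub>P\<^esub> x) \<otimes>\<^bsub>P\<^esub> a"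
  shows "a \<otimes>\<^bsub>P\<^esub> x = x \<otimes>\<^bsub>P\<^esub> a"
proof -
  interpret f: group_hom G P f using G P f by (simp add: group_hom_def group_hom_axioms_def)
  obtain a' b' x' where c: "a' \<in> carrier G" "b' \<in> carrier G" "x' \<in> carrier G"
    and im: "a = f a'" "b = f b'" "x = f x'"
    using el by blast
  have "a' \<noteq> \<one>\<^bsub>G\<^esub>" "b' \<noteq> \<one>\<^bsub>G\<^esub>" using el(4,5) im by auto
  moreover have "f (a' \<otimes>\<^bsub>G\<^esub> b') = f (b' \<otimes>\<^bsub>G\<^esub> a')" using el(6) im c by simp
  then have "a' \<otimes>\<^bsub>G\<^esub> b' = b' \<otimes>\<^bsub>G\<^esub> a'" by (rule inj_onD[OF f(2)]) (use c in auto)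
  moreover have "f (a' \<otimes>\<^bsub>G\<^esub> (x' \<otimes>\<^bsub>G\<^esub> b' \<otimes>\<^bsub>G\<^esub> inv\<^bsub>G\<^esub> x')) = f ((x' \<otimes>\<^bsub>G\<^esub> b' \<otimes>\<^bsub>G\<^esub> inv\<^bsub>G\<^esub> x') \<otimes>\<^bsub>G\<^esub> a')"
    using el(7) im c by simp
  then have "a' \<otimes>\<^bsub>G\<^esub> (x' \<otimes>\<^bsub>G\<^esub> b' \<otimes>\<^bsub>G\<^esub> inv\<^bsub>G\<^esub> x') = (x' \<otimes>\<^bsub>G\<^esub> b' \<otimes>\<^bsub>G\<^esub> inv\<^bsub>G\<^esub> x') \<otimes>\<^bsub>G\<^esub> a'"
    by (rule inj_onD[OF f(2)]) (use c in auto)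
  ultimately have "a' \<otimes>\<^bsub>G\<^esub> x' = x' \<otimes>\<^bsub>G\<^esub> a'"
    by (intro group.csa_conditionD[OF G c])
  then show ?thesis using im c by (metis f.hom_mult)
qed

context tree_amalgam
begin

text \<open>The list \<open>l\<close> with \<open>start l = v\<close> stands for the coset \<open>G v \<cdot> evl l\<close>, on which \<open>g\<close> acts by multiplication with
  \<open>g\<inverse>\<close> on the right.\<close>

definition act :: "'p \<Rightarrow> ('v \<times> 'a) list \<Rightarrow> ('v \<times> 'a) list" where
  "act g l = snd (nf (start l) (evl l \<otimes> inv g))"

lemma snd_nf: "v \<in> V \<Longrightarrow> x \<in> carrier P \<Longrightarrow> valid (snd (nf v x)) \<and> start (snd (nf v x)) = v"
  using nf_in by (fastforce simp: NF_def)

lemma nf_eq: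
  assumes "v \<in> V" "x \<in> carrier P"
  obtains k where "k \<in> carrier (G v)" "nf v x = (k, snd (nf v x))" "x = \<iota> v k \<otimes> evl (snd (nf v x))"
  using that[of "fst (nf v x)"] nf_in[OF assms] ev_nf[OF assms] by (auto simp: NF_def ev_def)

text \<open>The coset \<open>G v \<cdot> x\<close> corresponds to the list \<open>snd (nf v x)\<close>, whatever representative \<open>x\<close> is used.\<close>

lemma act_snd_nf:
  assumes v: "v \<in> V" and x: "x \<in> carrier P" and g: "g \<in> carrier P"
  shows "act g (snd (nf v x)) = snd (nf v (x \<otimes> inv g))"
proof -
  interpret v: group "G v" by (rule vertex_group[OF v])
  obtain k where k: "k \<in> carrier (G v)" "x = \<iota> v k \<otimes> evl (snd (nf v x))"
    using nf_eq[OF v x] by metis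
  let ?l = "snd (nf v x)"
  have l: "valid ?l" "start ?l = v" using snd_nf[OF v x] by auto
  have e: "evl ?l \<in> carrier P" by (rule evl_closed[OF l(1)])
  have "x \<otimes> inv g = \<iota> v k \<otimes> (evl ?l \<otimes> inv g)"
    using k e g v \<iota>_closed by (metis inv_closed m_assoc)
  then have "nf v (x \<otimes> inv g) = lmul v k (nf v (evl ?l \<otimes> inv g))"
    using nf_\<iota>[OF v k(1), of "evl ?l \<otimes> inv g"] e g by simp
  then show ?thesis by (simp add: act_def l lmul_def)
qed

lemma list_as_snd_nf: "valid l \<Longrightarrow> snd (nf (start l) (evl l)) = l"
  using nf_evl by simp

lemma list_adj_snd_nf:
  assumes uv: "adj u v" and x: "x \<in> carrier P"
  shows "list_adj valid (snd (nf u x)) (snd (nf v x))"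
proof -
  have V: "u \<in> V" "v \<in> V" using adj_in adj_in2 uv by auto
  note valid = snd_nf[OF V(1) x] snd_nf[OF V(2) x]
  from uv nf_in[OF V(2) x] show ?thesis
  proof (cases rule: \<tau>_cases)
    case (cancel c s l)
    then show ?thesis using valid nf_adj[OF uv x] by (simp add: list_adj_def)
  next
    case (extend c s l)
    then show ?thesis using valid nf_adj[OF uv x] by (simp add: list_adj_def)
  qed
qed

text \<open>Two adjacent vertices of the Bass-Serre tree are cosets of one element \<open>x\<close>; namely of the product of the
  longer list.\<close>

lemma list_adj_common:
  assumes "list_adj valid l m"
  obtains u v x where "adj u v" "x \<in> carrier P" "l = snd (nf u x)" "m = snd (nf v x)"
proof -
  have child: "\<exists>x\<in>carrier P. l = snd (nf (start l) x) \<and> m = snd (nf (start m) x) \<and> adj (start l) (start m)"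
    if l: "valid l" "l \<noteq> []" "m = tl l" for l m
  proof -
    obtain u s where us: "l = (u, s) # m" using l(2,3) by (cases l) auto
    have m: "valid m" "adj u (start m)" "s \<in> carrier (G (start m))" using l(1) by (auto simp: us)
    have "nf (start m) (evl l) = lmul (start m) s (nf (start m) (evl m))"
      using nf_\<iota>[OF start_in[OF m(1)] m(3) evl_closed[OF m(1)]] by (simp add: us)
    then have "snd (nf (start m) (evl l)) = m" using list_as_snd_nf[OF m(1)] by (simp add: lmul_def)
    then show ?thesis
      using list_as_snd_nf[OF l(1)] evl_closed[OF l(1)] m(2) by (intro bexI[of _ "evl l"]) (auto simp: us)
  qed
  have "valid l" "valid m" "l \<noteq> [] \<and> m = tl l \<or> m \<noteq> [] \<and> l = tl m"
    using assms by (auto simp: list_adj_def)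
  then show thesis using child[of l m] child[of m l] that adj_sym by metis
qed

text \<open>If \<open>h\<close> fixes the coset \<open>G v \<cdot> x\<close>, then \<open>x h\<inverse>\<close> is in this coset.\<close>

lemma stabilizer:
  assumes v: "v \<in> V" and x: "x \<in> carrier P" and h: "h \<in> carrier P"
    and fix_l: "act h (snd (nf v x)) = snd (nf v x)"
  obtains c where "c \<in> carrier (G v)" "x \<otimes> inv h = \<iota> v c \<otimes> x"
proof -
  interpret v: group "G v" by (rule vertex_group[OF v])
  have xh: "x \<otimes> inv h \<in> carrier P" using x h by simp
  have eq: "snd (nf v (x \<otimes> inv h)) = snd (nf v x)" using act_snd_nf[OF v x h] fix_l by simp
  let ?e = "evl (snd (nf v x))"
  have e: "?e \<in> carrier P" using evl_closed snd_nf[OF v x] by blast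
  obtain k where k: "k \<in> carrier (G v)" "x = \<iota> v k \<otimes> ?e"
    using nf_eq[OF v x] by metis
  obtain k' where k': "k' \<in> carrier (G v)" "x \<otimes> inv h = \<iota> v k' \<otimes> ?e"
    using nf_eq[OF v xh] eq by metis
  have "\<iota> v (k' \<otimes>\<^bsub>G v\<^esub> inv\<^bsub>G v\<^esub> k) \<otimes> x = \<iota> v (k' \<otimes>\<^bsub>G v\<^esub> inv\<^bsub>G v\<^esub> k) \<otimes> (\<iota> v k \<otimes> ?e)"
    using k(2) by simp
  also have "\<dots> = \<iota> v (k' \<otimes>\<^bsub>G v\<^esub> inv\<^bsub>G v\<^esub> k \<otimes>\<^bsub>G v\<^esub> k) \<otimes> ?e"
    using k(1) k'(1) v e by (simp add: \<iota>_mult \<iota>_closed m_assoc)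
  also have "\<dots> = x \<otimes> inv h" using k(1) k' by (simp add: v.m_assoc)
  finally show thesis using that[of "k' \<otimes>\<^bsub>G v\<^esub> inv\<^bsub>G v\<^esub> k"] k(1) k'(1) by simp
qed

end

locale csa_tree_amalgam = tree_amalgam +
  assumes vertex_csa: "v \<in> V \<Longrightarrow> csa_condition (G v)"
    and vertex_no_involution: "v \<in> V \<Longrightarrow> g \<in> carrier (G v) \<Longrightarrow> g \<otimes>\<^bsub>G v\<^esub> g = \<one>\<^bsub>G v\<^esub> \<Longrightarrow> g = \<one>\<^bsub>G v\<^esub>"
    and D_malnormal: "adj u v \<Longrightarrow> malnormal (D u v) (G u)"
begin

text \<open>The vertex \<open>l\<close> is \<open>G v \<cdot> x\<close> and its neighbours \<open>m\<close>, \<open>m'\<close> are \<open>G u \<cdot> x\<close> and \<open>G u \<cdot> b x\<close> for some \<open>b\<close> in \<open>G v\<close>.  With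
  \<open>x h\<inverse> = c x\<close>, both \<open>c\<close> and \<open>b c b\<inverse>\<close> are in \<open>D v u\<close> as \<open>h\<close> fixes \<open>m\<close> and \<open>m'\<close>.  Malnormality puts \<open>b\<close> into \<open>D v u\<close>,
  and therefore \<open>m = m'\<close>.\<close>

lemma fixed_neighbours_eq:
  assumes h: "h \<in> carrier P" "h \<noteq> \<one>"
    and adj: "list_adj valid l m" "list_adj valid l m'" and start: "start m = start m'"
    and fixed: "act h l = l" "act h m = m" "act h m' = m'"
  shows "m = m'"
proof -
  obtain v u x where x: "adj v u" "x \<in> carrier P" "l = snd (nf v x)" "m = snd (nf u x)"
    using list_adj_common[OF adj(1)] .
  obtain v' u' x' where x': "adj v' u'" "x' \<in> carrier P" "l = snd (nf v' x')" "m' = snd (nf u' x')"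
    using list_adj_common[OF adj(2)] .
  have V: "v \<in> V" "u \<in> V" "v' \<in> V" "u' \<in> V" using x(1) x'(1) adj_in adj_in2 by auto
  have "v' = v" "u' = u"
    using snd_nf[OF V(1) x(2)] snd_nf[OF V(2) x(2)] snd_nf[OF V(3) x'(2)] snd_nf[OF V(4) x'(2)]
      x x' start by auto
  note x' = x'[unfolded this]
  have uv: "adj u v" by (rule adj_sym[OF x(1)])
  interpret v: group "G v" by (rule vertex_group[OF V(1)])
  obtain c where c: "c \<in> carrier (G v)" "x \<otimes> inv h = \<iota> v c \<otimes> x"
    using stabilizer[OF V(1) x(2) h(1)] fixed(1) x(3) by metis
  obtain k where k: "k \<in> carrier (G v)" "nf v x = (k, l)" "x = \<iota> v k \<otimes> evl l"
    using nf_eq[OF V(1) x(2)] x(3) by metis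
  obtain k' where k': "k' \<in> carrier (G v)" "nf v x' = (k', l)" "x' = \<iota> v k' \<otimes> evl l"
    using nf_eq[OF V(1) x'(2)] x'(3) by metis
  have e: "evl l \<in> carrier P" using adj(1) evl_closed by (auto simp: list_adj_def)
  \<comment> \<open>for both pairs \<open>x, c\<close> and \<open>b x, b c b\<inverse>\<close>: fixing the coset of \<open>u\<close> means to be in the edge group\<close>
  have inD: "c \<in> D v u" if y: "y \<in> carrier P" "nf v y = (p, l)" "p \<in> carrier (G v)"
      "act h (snd (nf u y)) = snd (nf u y)" "y \<otimes> inv h = \<iota> v c \<otimes> y" "c \<in> carrier (G v)" for y p c
  proof -
    have yh: "y \<otimes> inv h \<in> carrier P" using y(1) h(1) by simp
    have nfy: "nf v (y \<otimes> inv h) = (c \<otimes>\<^bsub>G v\<^esub> p, l)"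
      using nf_\<iota>[OF V(1) y(6,1)] y(2,5) by (simp add: lmul_def)
    have "snd (nf u (y \<otimes> inv h)) = snd (nf u y)" using act_snd_nf[OF V(2) y(1) h(1)] y(4) by simp
    then have "snd (\<tau> u v (nf v (y \<otimes> inv h))) = snd (\<tau> u v (nf v y))"
      using nf_adj[OF uv yh] nf_adj[OF uv y(1)] by simp
    then have "(c \<otimes>\<^bsub>G v\<^esub> p) \<otimes>\<^bsub>G v\<^esub> inv\<^bsub>G v\<^esub> p \<in> D v u"
      using snd_\<tau>_eq_iff[OF uv nf_in[OF V(1) yh] nf_in[OF V(1) y(1)]] nfy y(2) by simp
    then show ?thesis using y(3,6) by (simp add: v.m_assoc)
  qed
  define b where "b = k' \<otimes>\<^bsub>G v\<^esub> inv\<^bsub>G v\<^esub> k"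
  have b: "b \<in> carrier (G v)" using k(1) k'(1) by (simp add: b_def)
  have "\<iota> v b \<otimes> x = \<iota> v (b \<otimes>\<^bsub>G v\<^esub> k) \<otimes> evl l"
    using k(1,3) b V(1) e by (metis \<iota>_mult \<iota>_closed m_assoc)
  also have "b \<otimes>\<^bsub>G v\<^esub> k = k'" using k(1) k'(1) by (simp add: b_def v.m_assoc)
  finally have bx: "x' = \<iota> v b \<otimes> x" using k'(3) by simp
  let ?d = "b \<otimes>\<^bsub>G v\<^esub> c \<otimes>\<^bsub>G v\<^esub> inv\<^bsub>G v\<^esub> b"
  have "\<iota> v ?d \<otimes> x' = \<iota> v (?d \<otimes>\<^bsub>G v\<^esub> b) \<otimes> x"
    using b c(1) V(1) x(2) by (simp add: bx \<iota>_mult \<iota>_closed m_assoc)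
  also have "?d \<otimes>\<^bsub>G v\<^esub> b = b \<otimes>\<^bsub>G v\<^esub> c" using b c(1) by (simp add: v.m_assoc)
  also have "\<iota> v (b \<otimes>\<^bsub>G v\<^esub> c) \<otimes> x = \<iota> v b \<otimes> (x \<otimes> inv h)"
    using b c V(1) x(2) by (simp add: \<iota>_mult \<iota>_closed m_assoc)
  also have "\<dots> = x' \<otimes> inv h"
    using b V(1) x(2) h(1) by (simp add: bx \<iota>_closed m_assoc)
  finally have x'h: "x' \<otimes> inv h = \<iota> v ?d \<otimes> x'" by simp
  have cD: "c \<in> D v u" by (rule inD[OF x(2) k(2,1) _ c(2,1)]) (use fixed(2) x(4) in simp)
  have dD: "?d \<in> D v u"
    by (rule inD[OF x'(2) k'(2,1) _ x'h]) (use fixed(3) x'(4) b c(1) in simp_all)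
  have "c \<noteq> \<one>\<^bsub>G v\<^esub>"
  proof
    assume "c = \<one>\<^bsub>G v\<^esub>"
    then have "x \<otimes> inv h = x" using c(2) \<iota>_one[OF V(1)] x(2) by simp
    then have "inv h = \<one>" using x(2) h(1) by simp
    then show False using h by simp
  qed
  then have "b \<in> D v u"
    using D_malnormal[OF x(1)] b cD dD unfolding v.malnormal_iff by blast
  then have "snd (\<tau> u v (nf v x')) = snd (\<tau> u v (nf v x))"
    using snd_\<tau>_eq_iff[OF uv nf_in[OF V(1) x'(2)] nf_in[OF V(1) x(2)]] k(2) k'(2) by (simp add: b_def)
  then show ?thesis using nf_adj[OF uv x(2)] nf_adj[OF uv x'(2)] x(4) x'(4) by simp
qed

lemma stabilizer_conj:
  assumes l: "valid l" and h: "h \<in> carrier P" "act h l = l"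
  shows "h \<in> (\<lambda>g. inv (evl l) \<otimes> \<iota> (start l) g \<otimes> evl l) ` carrier (G (start l))"
proof -
  let ?v = "start l" and ?e = "evl l"
  have V: "?v \<in> V" by (rule start_in[OF l])
  interpret v: group "G ?v" by (rule vertex_group[OF V])
  have e: "?e \<in> carrier P" by (rule evl_closed[OF l])
  obtain c where c: "c \<in> carrier (G ?v)" "?e \<otimes> inv h = \<iota> ?v c \<otimes> ?e"
    using stabilizer[OF V e h(1)] list_as_snd_nf[OF l] h(2) by metis
  have i: "\<iota> ?v c \<in> carrier P" using \<iota>_closed[OF V c(1)] .
  have "inv h = inv ?e \<otimes> (\<iota> ?v c \<otimes> ?e)" using c(2) e h(1) i by (simp add: inv_solve_left)
  then have "inv (inv h) = inv (inv ?e \<otimes> (\<iota> ?v c \<otimes> ?e))" by simp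
  then have "h = inv ?e \<otimes> \<iota> ?v (inv\<^bsub>G ?v\<^esub> c) \<otimes> ?e"
    using e h(1) i c(1) V by (simp add: inv_mult_group \<iota>_inv m_assoc)
  then show ?thesis using c(1) by blast
qed

lemma conj_\<iota>_hom:
  assumes v: "v \<in> V" and e: "e \<in> carrier P"
  shows "(\<lambda>g. inv e \<otimes> \<iota> v g \<otimes> e) \<in> hom (G v) P" "inj_on (\<lambda>g. inv e \<otimes> \<iota> v g \<otimes> e) (carrier (G v))"
proof -
  show "(\<lambda>g. inv e \<otimes> \<iota> v g \<otimes> e) \<in> hom (G v) P"
  proof (rule homI)
    fix g h assume gh: "g \<in> carrier (G v)" "h \<in> carrier (G v)"
    have c: "\<iota> v g \<in> carrier P" "\<iota> v h \<in> carrier P" using gh \<iota>_closed v by auto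
    show "inv e \<otimes> \<iota> v g \<otimes> e \<in> carrier P" using c e by simp
    have "e \<otimes> (inv e \<otimes> (\<iota> v h \<otimes> e)) = \<iota> v h \<otimes> e" using c e by (simp flip: m_assoc)
    then show "inv e \<otimes> \<iota> v (g \<otimes>\<^bsub>G v\<^esub> h) \<otimes> e = inv e \<otimes> \<iota> v g \<otimes> e \<otimes> (inv e \<otimes> \<iota> v h \<otimes> e)"
      using c e gh v by (simp add: \<iota>_mult m_assoc)
  qed
  show "inj_on (\<lambda>g. inv e \<otimes> \<iota> v g \<otimes> e) (carrier (G v))"
  proof (rule inj_onI)
    fix g h assume gh: "g \<in> carrier (G v)" "h \<in> carrier (G v)"
      and eq: "inv e \<otimes> \<iota> v g \<otimes> e = inv e \<otimes> \<iota> v h \<otimes> e"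
    then have "\<iota> v g = \<iota> v h" using \<iota>_closed[OF v] e by simp
    then show "g = h" using \<iota>_inj[OF v] gh by (simp add: inj_on_eq_iff)
  qed
qed

theorem CSA_star_group_amalgam: "CSA_star_group P"
proof -
  interpret T: tree_graph "{l. valid l}" "list_adj valid"
  proof (rule list_tree)
    show "valid (tl l)" if "valid l" for l using that by (cases l rule: valid.cases) auto
  qed simp
  interpret csa_tree_action P "{l. valid l}" "list_adj valid" V adj act start
  proof
    show "{l. valid l} \<noteq> {}" by (auto intro: exI[of _ "[]"])
    fix x assume "x \<in> {l. valid l}"
    then have x: "valid x" by simp
    then have sx: "start x \<in> V" and ex: "evl x \<in> carrier P" and nfx: "snd (nf (start x) (evl x)) = x"
      using start_in evl_closed list_as_snd_nf by auto
    show "start x \<in> V" by (rule sx)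
    show "act \<one> x = x" using ex nfx by (simp add: act_def)
    fix g assume g: "g \<in> carrier P"
    have eg: "evl x \<otimes> inv g \<in> carrier P" using ex g by simp
    show "act g x \<in> {l. valid l}" "start (act g x) = start x"
      using snd_nf[OF sx eg] by (simp_all add: act_def)
    show "act (h \<otimes> g) x = act h (act g x)" if h: "h \<in> carrier P" for h
    proof -
      have "act h (act g x) = snd (nf (start x) (evl x \<otimes> inv g \<otimes> inv h))"
        using act_snd_nf[OF sx eg h] by (simp add: act_def)
      then show ?thesis using ex g h by (simp add: act_def inv_mult_group m_assoc)
    qed
  next
    fix g l m assume g: "g \<in> carrier P" and "list_adj valid l m"
    then obtain u v x where x: "adj u v" "x \<in> carrier P" "l = snd (nf u x)" "m = snd (nf v x)"
      using list_adj_common by metis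
    have "u \<in> V" "v \<in> V" using x(1) adj_in adj_in2 by auto
    then show "list_adj valid (act g l) (act g m)"
      using list_adj_snd_nf[OF x(1), of "x \<otimes> inv g"] act_snd_nf x g by simp
  next
    fix l m assume "list_adj valid l m"
    then obtain u v x where x: "adj u v" "x \<in> carrier P" "l = snd (nf u x)" "m = snd (nf v x)"
      using list_adj_common by metis
    have "u \<in> V" "v \<in> V" using x(1) adj_in adj_in2 by auto
    then show "adj (start l) (start m)" using snd_nf x by simp
  next
    fix l a b x
    assume l: "l \<in> {l. valid l}" and el: "a \<in> carrier P" "b \<in> carrier P" "x \<in> carrier P"
      and fixed: "act a l = l" "act b l = l" "act x l = l" and rest: "a \<noteq> \<one>" "b \<noteq> \<one>" "a \<otimes> b = b \<otimes> a"
      "a \<otimes> (x \<otimes> b \<otimes> inv x) = x \<otimes> b \<otimes> inv x \<otimes> a"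
    have v: "valid l" and V: "start l \<in> V" using l start_in by auto
    note hom = conj_\<iota>_hom[OF V evl_closed[OF v]]
    show "a \<otimes> x = x \<otimes> a"
      by (rule csa_condition_transfer[OF vertex_group[OF V] vertex_csa[OF V] is_group hom
          stabilizer_conj[OF v el(1) fixed(1)] stabilizer_conj[OF v el(2) fixed(2)]
          stabilizer_conj[OF v el(3) fixed(3)] rest])
  next
    fix l a assume l: "l \<in> {l. valid l}" and a: "a \<in> carrier P" "act a l = l" "a \<otimes> a = \<one>"
    have v: "valid l" and V: "start l \<in> V" using l start_in by auto
    interpret v: group "G (start l)" by (rule vertex_group[OF V])
    note hom = conj_\<iota>_hom[OF V evl_closed[OF v]]
    let ?f = "\<lambda>g. inv (evl l) \<otimes> \<iota> (start l) g \<otimes> evl l"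
    interpret f: group_hom "G (start l)" P ?f
      using hom(1) by (simp add: group_hom_def group_hom_axioms_def v.is_group is_group)
    obtain g where g: "g \<in> carrier (G (start l))" "a = ?f g" using stabilizer_conj[OF v a(1,2)] by blast
    have "?f (g \<otimes>\<^bsub>G (start l)\<^esub> g) = ?f \<one>\<^bsub>G (start l)\<^esub>"
      using f.hom_mult[OF g(1,1)] f.hom_one a(3) g(2) by metis
    then have "g \<otimes>\<^bsub>G (start l)\<^esub> g = \<one>\<^bsub>G (start l)\<^esub>"
      by (rule inj_onD[OF hom(2)]) (use g(1) in auto)
    then have "g = \<one>\<^bsub>G (start l)\<^esub>" by (rule vertex_no_involution[OF V g(1)])
    then show "a = \<one>" using g(2) f.hom_one by simp
  qed (rule fixed_neighbours_eq)
  show ?thesis by (rule CSA_star_group_tree_action)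
qed

end

section \<open>Oriented trees of groups\<close>

context wf_digraph
begin

definition uadj :: "'a \<Rightarrow> 'a \<Rightarrow> bool" where
  "uadj u v \<longleftrightarrow> (\<exists>e\<in>arcs G. (tail G e = u \<and> head G e = v) \<or> (tail G e = v \<and> head G e = u))"

lemma uadj_sym: "uadj u v \<Longrightarrow> uadj v u"
  by (auto simp: uadj_def)

lemma uadj_in: "uadj u v \<Longrightarrow> u \<in> verts G"
  by (auto simp: uadj_def)

lemma uadj_dart:
  "uadj u v \<longleftrightarrow>
     (\<exists>d\<in>arcs (double_graph G). tail (double_graph G) d = u \<and> head (double_graph G) d = v)"
proof
  assume "uadj u v"
  then obtain e where "e \<in> arcs G" "tail G e = u \<and> head G e = v \<or> tail G e = v \<and> head G e = u"
    unfolding uadj_def by blast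
  then show "\<exists>d\<in>arcs (double_graph G). tail (double_graph G) d = u \<and> head (double_graph G) d = v"
    by (intro bexI[of _ "(e, tail G e = u \<and> head G e = v)"]) (auto simp: double_graph_def)
qed (auto simp: uadj_def double_graph_def split: if_splits)

text \<open>A dart is an edge of the double graph, that is, an edge together with a direction.\<close>

definition dart :: "'a \<Rightarrow> 'a \<Rightarrow> 'b \<times> bool" where
  "dart u v = (SOME d. d \<in> arcs (double_graph G) \<and> tail (double_graph G) d = u \<and> head (double_graph G) d = v)"

lemma dart:
  assumes "uadj u v"
  shows "dart u v \<in> arcs (double_graph G)" "tail (double_graph G) (dart u v) = u"
    "head (double_graph G) (dart u v) = v"
  using someI_ex[of "\<lambda>d. d \<in> arcs (double_graph G) \<and> tail (double_graph G) d = u \<and> head (double_graph G) d = v"]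
    assms unfolding uadj_dart dart_def by blast+

fun darts :: "'a list \<Rightarrow> ('b \<times> bool) list" where
  "darts (u # v # us) = dart u v # darts (v # us)"
| "darts _ = []"

lemma length_darts: "length (darts us) = length us - 1"
  by (induction us rule: darts.induct) auto

lemma nth_darts: "i + 1 < length us \<Longrightarrow> darts us ! i = dart (us ! i) (us ! (i + 1))"
proof (induction us arbitrary: i rule: darts.induct)
  case (1 u v us)
  then show ?case by (cases i) auto
qed auto

lemma darts_walk:
  assumes "walk (verts G) uadj us"
  shows "pre_digraph.awalk (double_graph G) (hd us) (darts us) (last us)"
    "pre_digraph.awalk_verts (double_graph G) (hd us) (darts us) = us"
proof -
  have "pre_digraph.cas (double_graph G) (hd us) (darts us) (last us) \<and>
      pre_digraph.awalk_verts (double_graph G) (hd us) (darts us) = us \<and>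
      set (darts us) \<subseteq> arcs (double_graph G)"
    using assms
  proof (induction us rule: darts.induct)
    case (1 u v us)
    then have "walk (verts G) uadj (v # us)" "uadj u v" by (auto simp: walk_def)
    then show ?case
      using 1 dart[of u v] by (simp add: pre_digraph.cas.simps pre_digraph.awalk_verts.simps)
  qed (auto simp: walk_def pre_digraph.cas.simps pre_digraph.awalk_verts.simps)
  moreover have "hd us \<in> verts (double_graph G)"
    using assms by (cases us) (auto simp: walk_def double_graph_def)
  ultimately show "pre_digraph.awalk (double_graph G) (hd us) (darts us) (last us)"
    "pre_digraph.awalk_verts (double_graph G) (hd us) (darts us) = us"
    by (auto simp: pre_digraph.awalk_def)
qed

lemma fst_dart_eq:
  assumes "uadj u v" "uadj x y" "fst (dart u v) = fst (dart x y)"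
  shows "u = x \<and> v = y \<or> u = y \<and> v = x"
  using dart[OF assms(1)] dart[OF assms(2)] assms(3)
  by (cases "dart u v"; cases "dart x y") (auto simp: double_graph_def split: if_splits)

end

locale oriented_tree_graph = wf_digraph G for G :: "('v, 'e) pre_digraph" +
  assumes connected: "connected G"
    and no_cycle: "\<And>p. pre_digraph.cycle (double_graph G) p \<Longrightarrow> \<not> distinct (map fst p)"
begin

text \<open>A shortest closed reduced walk of positive length visits no vertex twice, apart from its ends.  If it
  used an edge twice, it would do so in opposite directions in two successive steps, which a reduced
  walk never does.  So its darts form a cycle of the double graph with distinct edges.\<close>

lemma uadj_no_cycle:
  assumes "reduced_walk (verts G) uadj xs" "hd xs = last xs"
  shows "length xs = 1"
  using assms
proof (induction "length xs" arbitrary: xs rule: less_induct)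
  case less
  have ne: "xs \<noteq> []" using less.prems(1) by auto
  have w: "walk (verts G) uadj xs" and nb: "nonbacktracking xs"
    using less.prems(1) by (auto simp: reduced_walk_def)
  show ?case
  proof (rule ccontr)
    assume "length xs \<noteq> 1"
    then have len: "length xs \<ge> 2" using ne by (cases xs rule: remdups_adj.cases) auto
    have dist: "i = j" if "1 \<le> i" "i \<le> j" "j < length xs" "xs ! i = xs ! j" for i j
    proof -
      let ?ys = "drop i (take (Suc j) xs)"
      have "reduced_walk (verts G) uadj (take i xs @ ?ys @ drop (Suc j) xs)"
        using less.prems(1) that(2)
        by (metis append_assoc append_take_drop_id le_Suc_eq min.absorb1 take_take)
      then have "reduced_walk (verts G) uadj (?ys @ drop (Suc j) xs)"
        by (rule reduced_walk_appendD(2)) (use that in auto)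
      then have red: "reduced_walk (verts G) uadj ?ys"
        by (rule reduced_walk_appendD(1)) (use that in auto)
      have "hd ?ys = xs ! i"
        using that by (subst hd_drop_conv_nth) auto
      moreover have "last ?ys = xs ! j"
        using that by (simp add: last_drop last_conv_nth)
      ultimately have "length ?ys = 1"
        using less.hyps[OF _ red] that by simp
      then show ?thesis using that by simp
    qed
    have "distinct (map fst (darts xs))"
      unfolding distinct_conv_nth
    proof (intro allI impI)
      fix i j assume ij: "i < length (map fst (darts xs))" "j < length (map fst (darts xs))" "i \<noteq> j"
      then have l: "i + 1 < length xs" "j + 1 < length xs" by (simp_all add: length_darts)
      have a: "uadj (xs ! k) (xs ! (k + 1))" if "k + 1 < length xs" for k
        using w that successively_nth[of uadj xs k] by (simp add: walk_def)
      show "map fst (darts xs) ! i \<noteq> map fst (darts xs) ! j"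
      proof
        assume "map fst (darts xs) ! i = map fst (darts xs) ! j"
        then have "fst (dart (xs ! i) (xs ! (i + 1))) = fst (dart (xs ! j) (xs ! (j + 1)))"
          using ij l by (simp add: nth_darts)
        from fst_dart_eq[OF a[OF l(1)] a[OF l(2)] this] show False
        proof
          assume "xs ! i = xs ! j \<and> xs ! (i + 1) = xs ! (j + 1)"
          then have "i + 1 = j + 1"
            using dist[of "i + 1" "j + 1"] dist[of "j + 1" "i + 1"] l by (cases "i \<le> j") auto
          then show False using ij by simp
        next
          assume eq: "xs ! i = xs ! (j + 1) \<and> xs ! (i + 1) = xs ! j"
          show False
          proof (cases "i < j")
            case True
            then have "i + 1 = j" using dist[of "i + 1" j] l eq by simp
            then show False using nb eq l by (auto simp: nonbacktracking_def)
          next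
            case False
            then have "j + 1 = i" using dist[of "j + 1" i] l eq ij(3) by simp
            then show False using nb eq l by (auto simp: nonbacktracking_def)
          qed
        qed
      qed
    qed
    moreover have "pre_digraph.cycle (double_graph G) (darts xs)"
      unfolding pre_digraph.cycle_def
    proof (intro exI conjI)
      show "pre_digraph.awalk (double_graph G) (hd xs) (darts xs) (hd xs)"
        using darts_walk(1)[OF w] less.prems(2) by simp
      have "distinct (tl xs)"
        unfolding distinct_conv_nth
      proof (intro allI impI)
        fix i j assume "i < length (tl xs)" "j < length (tl xs)" "i \<noteq> j"
        then show "tl xs ! i \<noteq> tl xs ! j"
          using dist[of "Suc i" "Suc j"] dist[of "Suc j" "Suc i"] by (auto simp: nth_tl le_Suc_eq) linarith+
      qed
      then show "distinct (tl (pre_digraph.awalk_verts (double_graph G) (hd xs) (darts xs)))"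
        using darts_walk(2)[OF w] by simp
      show "darts xs \<noteq> []" using length_darts[of xs] len by auto
    qed
    ultimately show False using no_cycle by blast
  qed
qed

lemma uadj_connected:
  assumes "u \<in> verts G" "v \<in> verts G"
  shows "\<exists>xs. walk (verts G) uadj xs \<and> hd xs = u \<and> last xs = v"
proof -
  have "(u, v) \<in> rtrancl_on (verts G) (arcs_ends (with_proj (mk_symmetric G)))"
    using connected assms unfolding connected_def strongly_connected_def reachable_def by simp
  then show ?thesis
  proof (induction rule: rtrancl_on_induct)
    case base
    then show ?case by (intro exI[of _ "[u]"]) (simp add: walk_def)
  next
    case (step y z)
    then obtain xs where xs: "walk (verts G) uadj xs" "hd xs = u" "last xs = y" by blast
    have "uadj y z" using step(2) by (auto simp: mk_symmetric_def arcs_ends_def arc_to_ends_def uadj_def)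
    then show ?case using xs step
      by (intro exI[of _ "xs @ [z]"]) (auto simp: walk_def successively_append_iff)
  qed
qed

lemma tree_graph_uadj: "tree_graph (verts G) uadj"
  by unfold_locales (use uadj_sym uadj_in uadj_connected uadj_no_cycle in blast)+

lemma tail_neq_head: "e \<in> arcs G \<Longrightarrow> tail G e \<noteq> head G e"
  using tree_graph.not_adj_self[OF tree_graph_uadj] uadj_def by metis

text \<open>Two parallel edges form a cycle of length two.\<close>

lemma edge_unique:
  assumes e: "e \<in> arcs G" and f: "f \<in> arcs G"
    and ends: "tail G e = tail G f \<and> head G e = head G f \<or> tail G e = head G f \<and> head G e = tail G f"
  shows "e = f"
proof (rule ccontr)
  assume "e \<noteq> f"
  obtain b where b: "head (double_graph G) (f, b) = tail G e" "tail (double_graph G) (f, b) = head G e"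
  proof (cases "tail G e = tail G f \<and> head G e = head G f")
    case True
    then show thesis by (intro that[of False]) (simp_all add: double_graph_def)
  next
    case False
    then have "tail G e = head G f" "head G e = tail G f" using ends by blast+
    then show thesis by (intro that[of True]) (simp_all add: double_graph_def)
  qed
  let ?D = "double_graph G"
  have e': "(e, True) \<in> arcs ?D" "tail ?D (e, True) = tail G e" "head ?D (e, True) = head G e"
    and f': "(f, b) \<in> arcs ?D" and V: "tail G e \<in> verts ?D"
    using e f by (simp_all add: double_graph_def)
  have "pre_digraph.cycle ?D [(e, True), (f, b)]"
    unfolding pre_digraph.cycle_def pre_digraph.awalk_def
    by (intro exI[of _ "tail G e"])
      (use b e' f' V tail_neq_head[OF e] in \<open>simp add: pre_digraph.cas.simps pre_digraph.awalk_verts.simps\<close>)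
  from no_cycle[OF this] show False using \<open>e \<noteq> f\<close> by simp
qed

definition edge :: "'v \<Rightarrow> 'v \<Rightarrow> 'e" where
  "edge u v = (THE e. e \<in> arcs G \<and> (tail G e = u \<and> head G e = v \<or> tail G e = v \<and> head G e = u))"

lemma edge_eq:
  assumes "e \<in> arcs G"
  shows "edge (tail G e) (head G e) = e" "edge (head G e) (tail G e) = e"
  unfolding edge_def using assms edge_unique by (intro the_equality; blast)+

end

lemma oriented_tree_iff: "oriented_tree \<Gamma> \<longleftrightarrow> oriented_tree_graph \<Gamma>"
  unfolding oriented_tree_def oriented_tree_graph_def oriented_tree_graph_axioms_def by blast

locale tree_of_groups = graph_of_groups \<Gamma> G E t + oriented_tree_graph \<Gamma>
  for \<Gamma> :: "('v, 'e) pre_digraph"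
    and G :: "'v \<Rightarrow> ('a, 'm) monoid_scheme"
    and E :: "'e \<Rightarrow> 'a set"
    and t :: "'e \<Rightarrow> 'a \<Rightarrow> 'a"
begin

definition D :: "'v \<Rightarrow> 'v \<Rightarrow> 'a set" where
  "D u v = (let e = edge u v in if tail \<Gamma> e = u then E e else t e ` E e)"

definition \<theta> :: "'v \<Rightarrow> 'v \<Rightarrow> 'a \<Rightarrow> 'a" where
  "\<theta> u v = (let e = edge u v in if tail \<Gamma> e = u then t e else inv_into (E e) (t e))"

lemma D_edge:
  assumes "e \<in> arcs \<Gamma>"
  shows "D (tail \<Gamma> e) (head \<Gamma> e) = E e" "D (head \<Gamma> e) (tail \<Gamma> e) = t e ` E e"
    "\<theta> (tail \<Gamma> e) (head \<Gamma> e) = t e" "\<theta> (head \<Gamma> e) (tail \<Gamma> e) = inv_into (E e) (t e)"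
  using edge_eq[OF assms] tail_neq_head[OF assms] by (simp_all add: D_def \<theta>_def)

lemma uadj_cases:
  assumes "uadj u v"
  obtains (forward) e where "e \<in> arcs \<Gamma>" "u = tail \<Gamma> e" "v = head \<Gamma> e"
    | (backward) e where "e \<in> arcs \<Gamma>" "u = head \<Gamma> e" "v = tail \<Gamma> e"
  using assms unfolding uadj_def by blast

lemma t_props:
  assumes "e \<in> arcs \<Gamma>"
  shows "inj_on (t e) (E e)" "g \<in> E e \<Longrightarrow> t e g \<in> carrier (G (head \<Gamma> e))"
    "g \<in> E e \<Longrightarrow> h \<in> E e \<Longrightarrow> t e (g \<otimes>\<^bsub>G (tail \<Gamma> e)\<^esub> h) = t e g \<otimes>\<^bsub>G (head \<Gamma> e)\<^esub> t e h"
  using edge_mon[OF assms] by (auto simp: mon_def hom_def)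

lemma simple_tree_of_groups:
  assumes "v0 \<in> verts \<Gamma>"
  shows "simple_tree_of_groups (verts \<Gamma>) uadj G D \<theta> v0"
proof -
  interpret T: tree_graph "verts \<Gamma>" uadj by (rule tree_graph_uadj)
  show ?thesis
  proof (rule simple_tree_of_groups.intro[OF tree_graph_uadj], rule simple_tree_of_groups_axioms.intro)
    show "v0 \<in> verts \<Gamma>" by fact
    show "group (G v)" if "v \<in> verts \<Gamma>" for v by (rule vertex_group[OF that])
    fix u v assume "uadj u v"
    then show "subgroup (D u v) (G u)"
    proof (cases rule: uadj_cases)
      case (forward e)
      then show ?thesis using D_edge edge_group by simp
    next
      case (backward e)
      interpret h: group_hom "G (tail \<Gamma> e)\<lparr>carrier := E e\<rparr>" "G (head \<Gamma> e)" "t e"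
        using edge_mon[OF backward(1)] vertex_group backward(1)
          subgroup.subgroup_is_group[OF edge_group[OF backward(1)]]
        by (simp add: group_hom_def group_hom_axioms_def mon_def)
      show ?thesis using h.img_is_subgroup backward D_edge by simp
    qed
    fix g assume "g \<in> D u v"
    have both: "\<theta> u v g \<in> D v u \<and> \<theta> v u (\<theta> u v g) = g"
      using \<open>uadj u v\<close>
    proof (cases rule: uadj_cases)
      case (forward e)
      then show ?thesis using \<open>g \<in> D u v\<close> D_edge t_props(1) by (auto simp: inv_into_f_f)
    next
      case (backward e)
      then show ?thesis using \<open>g \<in> D u v\<close> D_edge t_props(1) by (auto simp: inv_into_f_f)
    qed
    then show "\<theta> u v g \<in> D v u" ..
    from both show "\<theta> v u (\<theta> u v g) = g" ..
    fix h assume "h \<in> D u v"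
    show "\<theta> u v (g \<otimes>\<^bsub>G u\<^esub> h) = \<theta> u v g \<otimes>\<^bsub>G v\<^esub> \<theta> u v h"
      using \<open>uadj u v\<close>
    proof (cases rule: uadj_cases)
      case (forward e)
      then show ?thesis using \<open>g \<in> D u v\<close> \<open>h \<in> D u v\<close> D_edge t_props(3) by simp
    next
      case (backward e)
      then obtain g' h' where gh: "g = t e g'" "h = t e h'" "g' \<in> E e" "h' \<in> E e"
        using \<open>g \<in> D u v\<close> \<open>h \<in> D u v\<close> D_edge by auto
      have "g' \<otimes>\<^bsub>G (tail \<Gamma> e)\<^esub> h' \<in> E e"
        using subgroup.m_closed[OF edge_group[OF backward(1)] gh(3,4)] .
      then show ?thesis
        using gh backward D_edge(4) t_props(1)[OF backward(1)] t_props(3)[OF backward(1) gh(3,4)]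
        by (simp add: inv_into_f_f flip: t_props(3)[OF backward(1) gh(3,4)])
    qed
  qed
qed

definition F :: "('v \<times> 'a) list set monoid" where
  "F = free_product (verts \<Gamma>) G"

definition N :: "('v \<times> 'a) list set set" where
  "N = normal_closure F (edge_relators \<Gamma> G E t)"

definition \<iota> :: "'v \<Rightarrow> 'a \<Rightarrow> ('v \<times> 'a) list set set" where
  "\<iota> v g = N #>\<^bsub>F\<^esub> fp_incl (verts \<Gamma>) G v g"

lemma tree_fundamental_group_eq: "tree_fundamental_group \<Gamma> G E t = F Mod N"
  by (simp add: tree_fundamental_group_def F_def N_def)

lemma group_F: "group F"
  unfolding F_def by (rule group_free_product) (rule vertex_group)

lemma N_normal: "N \<lhd> F"
  unfolding N_def by (rule normal_closure_normal[OF group_F]) (use edge_relators_carrier in \<open>simp add: F_def\<close>)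

lemma incl_hom: "v \<in> verts \<Gamma> \<Longrightarrow> fp_incl (verts \<Gamma>) G v \<in> hom (G v) F"
  unfolding F_def by (rule fp_incl_hom) (rule vertex_group)

lemma quotient_hom: "(\<lambda>x. N #>\<^bsub>F\<^esub> x) \<in> hom F (F Mod N)"
  by (rule normal.r_coset_hom_Mod[OF N_normal])

lemma \<iota>_hom: "v \<in> verts \<Gamma> \<Longrightarrow> \<iota> v \<in> hom (G v) (F Mod N)"
  using hom_compose[OF incl_hom quotient_hom] by (simp add: \<iota>_def[abs_def] comp_def)

lemma \<iota>_edge:
  assumes e: "e \<in> arcs \<Gamma>" and g: "g \<in> E e"
  shows "\<iota> (head \<Gamma> e) (t e g) = \<iota> (tail \<Gamma> e) g"
proof -
  interpret F: group F by (rule group_F)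
  let ?x = "fp_incl (verts \<Gamma>) G (tail \<Gamma> e) g" and ?y = "fp_incl (verts \<Gamma>) G (head \<Gamma> e) (t e g)"
  have gc: "g \<in> carrier (G (tail \<Gamma> e))" using subgroup.mem_carrier[OF edge_group[OF e] g] .
  have x: "?x \<in> carrier F" using hom_in_carrier[OF incl_hom gc] e by simp
  have y: "?y \<in> carrier F" using hom_in_carrier[OF incl_hom t_props(2)[OF e g]] e by simp
  have N: "subgroup N F" using N_normal by (rule normal_imp_subgroup)
  have "?x \<otimes>\<^bsub>F\<^esub> inv\<^bsub>F\<^esub> ?y \<in> edge_relators \<Gamma> G E t"
    using e g unfolding edge_relators_def Let_def F_def by blast
  then have "?x \<otimes>\<^bsub>F\<^esub> inv\<^bsub>F\<^esub> ?y \<in> N" unfolding N_def normal_closure_def by blast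
  then have "?x \<in> N #>\<^bsub>F\<^esub> ?y" using subgroup.rcos_module_rev[OF N F.is_group y x] by simp
  then show ?thesis unfolding \<iota>_def by (rule F.repr_independence[OF _ y N])
qed

text \<open>Elements of the free product are classes of words, and \<open>\<iota> v g\<close> is the class of a letter.\<close>

lemma fundamental_group_induct:
  assumes x: "x \<in> carrier (F Mod N)" and one: "Q \<one>\<^bsub>F Mod N\<^esub>"
    and step: "\<And>v g y. v \<in> verts \<Gamma> \<Longrightarrow> g \<in> carrier (G v) \<Longrightarrow> y \<in> carrier (F Mod N) \<Longrightarrow> Q y \<Longrightarrow>
      Q (\<iota> v g \<otimes>\<^bsub>F Mod N\<^esub> y)"
  shows "Q x"
proof -
  let ?q = "\<lambda>u. N #>\<^bsub>F\<^esub> (fp_rel (verts \<Gamma>) G `` {u})"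
  have Q: "Q (?q u)" if "u \<in> fp_words (verts \<Gamma>) G" for u
    using that
  proof (induction u)
    case Nil
    have "?q [] = N #>\<^bsub>F\<^esub> \<one>\<^bsub>F\<^esub>" by (simp add: F_def free_product_one)
    then show ?case
      using one hom_one[OF quotient_hom group_F normal.factorgroup_is_group[OF N_normal]] by simp
  next
    case (Cons a u)
    obtain v g where a: "a = (v, g)" by force
    have v: "v \<in> verts \<Gamma>" "g \<in> carrier (G v)" and u: "u \<in> fp_words (verts \<Gamma>) G"
      using Cons.prems by (auto simp: a)
    have cu: "fp_rel (verts \<Gamma>) G `` {u} \<in> carrier F"
      unfolding F_def by (rule free_product_class_closed[OF u])
    have "fp_rel (verts \<Gamma>) G `` {a # u} = fp_incl (verts \<Gamma>) G v g \<otimes>\<^bsub>F\<^esub> fp_rel (verts \<Gamma>) G `` {u}"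
      unfolding F_def fp_incl_def
      using free_product_mult[of "verts \<Gamma>" G "[a]" u, OF vertex_group] v u by (simp add: a)
    then have "?q (a # u) = \<iota> v g \<otimes>\<^bsub>F Mod N\<^esub> ?q u"
      using hom_mult[OF quotient_hom hom_in_carrier[OF incl_hom[OF v(1)] v(2)] cu] by (simp add: \<iota>_def)
    then show ?case using step[OF v hom_in_carrier[OF quotient_hom cu] Cons.IH[OF u]] by simp
  qed
  obtain X where X: "X \<in> carrier F" "x = N #>\<^bsub>F\<^esub> X" using x by (auto simp: FactGroup_def RCOSETS_def)
  obtain u where "u \<in> fp_words (verts \<Gamma>) G" "X = fp_rel (verts \<Gamma>) G `` {u}"
    using X(1) unfolding F_def by (rule free_product_carrierE)
  then show ?thesis using Q X(2) by simp
qed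

text \<open>The extension to the free product kills the edge relators, hence their normal closure.\<close>

lemma fundamental_group_universal:
  fixes H :: "('h, 'n) monoid_scheme"
  assumes H: "group H" and f: "\<And>v. v \<in> verts \<Gamma> \<Longrightarrow> f v \<in> hom (G v) H"
    and glue: "\<And>e g. e \<in> arcs \<Gamma> \<Longrightarrow> g \<in> E e \<Longrightarrow> f (head \<Gamma> e) (t e g) = f (tail \<Gamma> e) g"
  shows "\<exists>\<psi>\<in>hom (F Mod N) H. \<forall>v\<in>verts \<Gamma>. \<forall>g\<in>carrier (G v). \<psi> (\<iota> v g) = f v g"
proof -
  interpret F: group F by (rule group_F)
  interpret H: group H by (rule H)
  obtain \<phi> where \<phi>: "\<phi> \<in> hom F H"
    and \<phi>f: "\<And>v g. v \<in> verts \<Gamma> \<Longrightarrow> g \<in> carrier (G v) \<Longrightarrow> \<phi> (fp_incl (verts \<Gamma>) G v g) = f v g"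
    using free_product_extend[of "verts \<Gamma>" G H f, OF vertex_group H f] unfolding F_def by blast
  interpret \<phi>: group_hom F H \<phi> using \<phi> by (simp add: group_hom_def group_hom_axioms_def group_F H)
  have "edge_relators \<Gamma> G E t \<subseteq> kernel F H \<phi>"
  proof
    fix r assume "r \<in> edge_relators \<Gamma> G E t"
    then obtain e g where e: "e \<in> arcs \<Gamma>" and g: "g \<in> E e"
      and r: "r = fp_incl (verts \<Gamma>) G (tail \<Gamma> e) g \<otimes>\<^bsub>F\<^esub> inv\<^bsub>F\<^esub> fp_incl (verts \<Gamma>) G (head \<Gamma> e) (t e g)"
      unfolding edge_relators_def Let_def F_def by blast
    have gc: "g \<in> carrier (G (tail \<Gamma> e))" using subgroup.mem_carrier[OF edge_group[OF e] g] .
    note tc = t_props(2)[OF e g]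
    have V: "tail \<Gamma> e \<in> verts \<Gamma>" "head \<Gamma> e \<in> verts \<Gamma>" using e by auto
    have c: "fp_incl (verts \<Gamma>) G (tail \<Gamma> e) g \<in> carrier F"
      "fp_incl (verts \<Gamma>) G (head \<Gamma> e) (t e g) \<in> carrier F"
      using hom_in_carrier[OF incl_hom[OF V(1)] gc] hom_in_carrier[OF incl_hom[OF V(2)] tc] by auto
    have "\<phi> r = f (tail \<Gamma> e) g \<otimes>\<^bsub>H\<^esub> inv\<^bsub>H\<^esub> f (head \<Gamma> e) (t e g)"
      unfolding r using c \<phi>f[OF V(1) gc] \<phi>f[OF V(2) tc] by simp
    also have "\<dots> = \<one>\<^bsub>H\<^esub>" using glue[OF e g] hom_in_carrier[OF f[OF V(1)] gc] by simp
    finally show "r \<in> kernel F H \<phi>" using c unfolding kernel_def r by simp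
  qed
  then have "N \<subseteq> kernel F H \<phi>"
    unfolding N_def normal_closure_def using \<phi>.normal_kernel by blast
  then obtain \<psi> where \<psi>: "\<psi> \<in> hom (F Mod N) H" "\<And>x. x \<in> carrier F \<Longrightarrow> \<psi> (N #>\<^bsub>F\<^esub> x) = \<phi> x"
    using \<phi>.FactGroup_universal_kernel[OF N_normal] by metis
  have "\<psi> (\<iota> v g) = f v g" if "v \<in> verts \<Gamma>" "g \<in> carrier (G v)" for v g
    using \<psi>(2)[OF hom_in_carrier[OF incl_hom[OF that(1)] that(2)]] \<phi>f[OF that] by (simp add: \<iota>_def)
  then show ?thesis using \<psi>(1) by blast
qed

lemma tree_amalgam:
  assumes "v0 \<in> verts \<Gamma>"
  shows "tree_amalgam (verts \<Gamma>) uadj G D \<theta> v0 (F Mod N) \<iota>"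
proof -
  interpret T: simple_tree_of_groups "verts \<Gamma>" uadj G D \<theta> v0
    by (rule simple_tree_of_groups[OF assms])
  interpret P: group "F Mod N" by (rule normal.factorgroup_is_group[OF N_normal])
  show ?thesis
  proof
    show "\<iota> v \<in> hom (G v) (F Mod N)" if "v \<in> verts \<Gamma>" for v by (rule \<iota>_hom[OF that])
    show "\<iota> v (\<theta> u v g) = \<iota> u g" if "uadj u v" "g \<in> D u v" for u v g
      using that
      by (cases rule: uadj_cases) (use \<iota>_edge D_edge t_props(1) in \<open>auto simp: inv_into_f_f\<close>)
    show "Q x" if "x \<in> carrier (F Mod N)" "Q \<one>\<^bsub>F Mod N\<^esub>"
      "\<And>v g y. v \<in> verts \<Gamma> \<Longrightarrow> g \<in> carrier (G v) \<Longrightarrow> y \<in> carrier (F Mod N) \<Longrightarrow> Q y \<Longrightarrow>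
        Q (\<iota> v g \<otimes>\<^bsub>F Mod N\<^esub> y)" for x Q
      using that by (rule fundamental_group_induct)
    fix f and \<Omega> :: "('a \<times> ('v \<times> 'a) list) set"
    assume f: "\<And>v. v \<in> verts \<Gamma> \<Longrightarrow> f v \<in> hom (G v) (BijGroup \<Omega>)"
      and glue: "\<And>u v g. uadj u v \<Longrightarrow> g \<in> D u v \<Longrightarrow> f v (\<theta> u v g) = f u g"
    have "f (head \<Gamma> e) (t e g) = f (tail \<Gamma> e) g" if "e \<in> arcs \<Gamma>" "g \<in> E e" for e g
      using glue[of "tail \<Gamma> e" "head \<Gamma> e" g] that D_edge by (auto simp: uadj_def)
    then show "\<exists>\<psi>\<in>hom (F Mod N) (BijGroup \<Omega>). \<forall>v\<in>verts \<Gamma>. \<forall>g\<in>carrier (G v). \<psi> (\<iota> v g) = f v g"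
      by (intro fundamental_group_universal group_BijGroup f)
  qed
qed

end

theorem proposition5:
  fixes \<Gamma> :: "('v, 'e) pre_digraph"
    and G :: "'v \<Rightarrow> ('a, 'm) monoid_scheme"
    and E :: "'e \<Rightarrow> 'a set"
    and t :: "'e \<Rightarrow> 'a \<Rightarrow> 'a"
  assumes "graph_of_groups \<Gamma> G E t"
    and "oriented_tree \<Gamma>"
    and "\<And>v. v \<in> verts \<Gamma> \<Longrightarrow> CSA_star_group (G v)"
    and "\<And>e. e \<in> arcs \<Gamma> \<Longrightarrow> maximal_abelian (E e) (G (tail \<Gamma> e))"
    and "\<And>e. e \<in> arcs \<Gamma> \<Longrightarrow> maximal_abelian (t e ` E e) (G (head \<Gamma> e))"
  shows "CSA_star_group (tree_fundamental_group \<Gamma> G E t)"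
proof -
  interpret tree_of_groups \<Gamma> G E t
    using assms(1,2) by (simp add: tree_of_groups_def oriented_tree_iff)
  obtain v0 where v0: "v0 \<in> verts \<Gamma>"
    using connected by (auto simp: connected_def strongly_connected_def mk_symmetric_def)
  interpret tree_amalgam "verts \<Gamma>" uadj G D \<theta> v0 "F Mod N" \<iota>
    by (rule tree_amalgam[OF v0])
  have csa: "csa_condition (G v)" "\<forall>a\<in>carrier (G v). a \<otimes>\<^bsub>G v\<^esub> a = \<one>\<^bsub>G v\<^esub> \<longrightarrow> a = \<one>\<^bsub>G v\<^esub>"
    and mal: "\<And>H. maximal_abelian H (G v) \<Longrightarrow> malnormal H (G v)" if "v \<in> verts \<Gamma>" for v
    using assms(3)[OF that] group.CSA_star_group_iff[OF vertex_group[OF that]]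
    by (auto simp: CSA_star_group_def CSA_group_def)
  interpret csa_tree_amalgam "verts \<Gamma>" uadj G D \<theta> v0 "F Mod N" \<iota>
  proof
    show "csa_condition (G v)" if "v \<in> verts \<Gamma>" for v by (rule csa(1)[OF that])
    show "g = \<one>\<^bsub>G v\<^esub>" if "v \<in> verts \<Gamma>" "g \<in> carrier (G v)" "g \<otimes>\<^bsub>G v\<^esub> g = \<one>\<^bsub>G v\<^esub>" for v g
      using csa(2) that by blast
    show "malnormal (D u v) (G u)" if "uadj u v" for u v
      using that by (cases rule: uadj_cases) (use mal assms(4,5) D_edge in auto)
  qed
  show ?thesis unfolding tree_fundamental_group_eq by (rule CSA_star_group_amalgam)
qed

end
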